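(* Let $V\subset\mathbb{R}^n$ be a central irreducible real algebraic variety with coordinate ring $\mathbb{R}[V]=\mathbb{R}[X_1,\ldots,X_n]/I$. Then the ring $\mathcal{R}^0_{\mathrm{reg}}(V)=\mathcal{R}^0(\mathbb{R}^n)/\mathcal{I}$, where $\mathcal{I}=\{f\in\mathcal{R}^0(\mathbb{R}^n)\mid V\subset\mathcal{Z}(f)\}$, has the substitution property over $\mathbb{R}[V]$.
   Context: $V$ is central if its set of non-singular points is dense in $V$ for the Euclidean topology. $\mathcal{R}^0(\mathbb{R}^n)$ is the ring of continuous rational functions on $\mathbb{R}^n$ (continuous functions that are regular on a non-empty Zariski open subset), and $\mathcal{Z}(f)$ is the zero set of $f$. The ring $\mathcal{R}^0(\mathbb{R}^n)/\mathcal{I}$ (the ring of regulous functions on $V$) is an $\mathbb{R}[V]$-algebra via the map induced by $\mathbb{R}[X_1,\ldots,X_n]\subset\mathcal{R}^0(\mathbb{R}^n)$. Substitution property of $B$ over $A$: for every real closed field $R$ and every ring homomorphism $\phi:A\to R$ there is exactly one ring homomorphism $B\to R$ whose composition with $A\to B$ equals $\phi$. *)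

theory Defs
  imports "HOL-Analysis.Analysis" "HOL-Algebra.QuotRing" "HOL-Algebra.Polynomials"
begin

section \<open>Polynomial functions on R^n (R infinite, so these are the polynomials R[X_1..X_n])\<close>

definition poly_fun :: "(real^'n \<Rightarrow> real) \<Rightarrow> bool" where
  "poly_fun p \<longleftrightarrow> (\<exists>S c. finite S \<and>
      p = (\<lambda>x. \<Sum>\<alpha>\<in>S. c \<alpha> * (\<Prod>i\<in>UNIV. (x $ i) ^ (\<alpha> i :: nat))))"

definition fun_ring :: "(real^'n \<Rightarrow> real) set \<Rightarrow> (real^'n \<Rightarrow> real) ring" where
  "fun_ring C = \<lparr> carrier = C, monoid.mult = (\<lambda>f g x. f x * g x), one = (\<lambda>x. 1),
                  zero = (\<lambda>x. 0), add = (\<lambda>f g x. f x + g x) \<rparr>"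

definition poly_ring :: "(real^'n \<Rightarrow> real) ring" where
  "poly_ring = fun_ring {p. poly_fun p}"

definition zero_set :: "(real^'n \<Rightarrow> real) set \<Rightarrow> (real^'n) set" where
  "zero_set S = {x. \<forall>p\<in>S. p x = 0}"

definition algebraic_set :: "(real^'n) set \<Rightarrow> bool" where
  "algebraic_set V \<longleftrightarrow> (\<exists>S. (\<forall>p\<in>S. poly_fun p) \<and> V = zero_set S)"

definition zariski_open :: "(real^'n) set \<Rightarrow> bool" where
  "zariski_open U \<longleftrightarrow> algebraic_set (- U)"

definition irreducible_alg :: "(real^'n) set \<Rightarrow> bool" where
  "irreducible_alg V \<longleftrightarrow> algebraic_set V \<and> V \<noteq> {} \<and>
     (\<forall>V1 V2. algebraic_set V1 \<and> algebraic_set V2 \<and> V = V1 \<union> V2 \<longrightarrow> V1 = V \<or> V2 = V)"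

definition vanishing_ideal :: "(real^'n) set \<Rightarrow> (real^'n \<Rightarrow> real) set" where
  "vanishing_ideal V = {p. poly_fun p \<and> (\<forall>x\<in>V. p x = 0)}"

definition coord_ring :: "(real^'n) set \<Rightarrow> (real^'n \<Rightarrow> real) set ring" where
  "coord_ring V = poly_ring Quot (vanishing_ideal V)"

text \<open>Dimension of V: Krull dimension of R[V], i.e. the maximal length d of a
  strictly increasing chain of prime ideals of R[X] containing I(V).\<close>
definition prime_chain :: "(real^'n) set \<Rightarrow> nat \<Rightarrow> bool" where
  "prime_chain V d \<longleftrightarrow> (\<exists>c. (\<forall>i\<le>d. primeideal (c i) poly_ring) \<and>
      vanishing_ideal V \<subseteq> c 0 \<and> (\<forall>i<d. c i \<subset> c (Suc i)))"

definition alg_dim :: "(real^'n) set \<Rightarrow> nat" where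
  "alg_dim V = (GREATEST d. prime_chain V d)"

definition grad :: "(real^'n \<Rightarrow> real) \<Rightarrow> real^'n \<Rightarrow> real^'n" where
  "grad f x = (\<chi> j. deriv (\<lambda>t. f (x + t *\<^sub>R axis j 1)) 0)"

text \<open>Non-singular points: the Jacobian of (generators of) I(V) at x has rank n - dim V.\<close>
definition nonsingular_points :: "(real^'n) set \<Rightarrow> (real^'n) set" where
  "nonsingular_points V = {x\<in>V. dim {grad f x | f. f \<in> vanishing_ideal V} = CARD('n) - alg_dim V}"

definition central :: "(real^'n) set \<Rightarrow> bool" where
  "central V \<longleftrightarrow> V \<subseteq> closure (nonsingular_points V)"

text \<open>Regular functions on a Zariski open U (BCR Def. 3.2.1).\<close>
definition regular_on :: "(real^'n \<Rightarrow> real) \<Rightarrow> (real^'n) set \<Rightarrow> bool" where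
  "regular_on f U \<longleftrightarrow> (\<exists>p q. poly_fun p \<and> poly_fun q \<and> (\<forall>x\<in>U. q x \<noteq> 0 \<and> f x = p x / q x))"

definition cont_rational :: "(real^'n \<Rightarrow> real) \<Rightarrow> bool" where
  "cont_rational f \<longleftrightarrow> continuous_on UNIV f \<and>
     (\<exists>U. zariski_open U \<and> U \<noteq> {} \<and> regular_on f U)"

definition R0_ring :: "(real^'n \<Rightarrow> real) ring" where
  "R0_ring = fun_ring {f. cont_rational f}"

definition regulous_ideal :: "(real^'n) set \<Rightarrow> (real^'n \<Rightarrow> real) set" where
  "regulous_ideal V = {f. cont_rational f \<and> V \<subseteq> {x. f x = 0}}"

definition regulous_ring :: "(real^'n) set \<Rightarrow> (real^'n \<Rightarrow> real) set ring" where
  "regulous_ring V = R0_ring Quot (regulous_ideal V)"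

text \<open>The structure map R[V] \<rightarrow> R^0(R^n)/\<I> induced by R[X] \<subseteq> R^0(R^n):
  the class of p is sent to the class of p.\<close>
definition struct_map :: "(real^'n) set \<Rightarrow> (real^'n \<Rightarrow> real) set \<Rightarrow> (real^'n \<Rightarrow> real) set" where
  "struct_map V C = (\<Union>p\<in>C. regulous_ideal V +>\<^bsub>R0_ring\<^esub> p)"

definition real_closed_field :: "('r, 'm) ring_scheme \<Rightarrow> bool" where
  "real_closed_field R \<longleftrightarrow> field R \<and>
     (\<forall>xs. set xs \<subseteq> carrier R \<longrightarrow>
        foldr (\<lambda>a s. a \<otimes>\<^bsub>R\<^esub> a \<oplus>\<^bsub>R\<^esub> s) xs \<zero>\<^bsub>R\<^esub> \<noteq> \<ominus>\<^bsub>R\<^esub> \<one>\<^bsub>R\<^esub>) \<and>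
     (\<forall>a\<in>carrier R. \<exists>b\<in>carrier R. b \<otimes>\<^bsub>R\<^esub> b = a \<or> b \<otimes>\<^bsub>R\<^esub> b = \<ominus>\<^bsub>R\<^esub> a) \<and>
     (\<forall>p. polynomial\<^bsub>R\<^esub> (carrier R) p \<and> odd (degree p) \<longrightarrow>
        (\<exists>x\<in>carrier R. ring.eval R p x = \<zero>\<^bsub>R\<^esub>))"

text \<open>B has the substitution property over A (via the structure map \<iota>), tested
  against real closed fields whose elements live in type 'r.\<close>
definition substitution_property ::
  "('a, 'c) ring_scheme \<Rightarrow> ('b, 'd) ring_scheme \<Rightarrow> ('a \<Rightarrow> 'b) \<Rightarrow> ('r, 'm) ring_scheme itself \<Rightarrow> bool" where
  "substitution_property A B \<iota> _ \<longleftrightarrow>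
     (\<forall>(R :: ('r, 'm) ring_scheme) \<phi>. real_closed_field R \<and> \<phi> \<in> ring_hom A R \<longrightarrow>
        (\<exists>\<psi>\<in>ring_hom B R. (\<forall>a\<in>carrier A. \<psi> (\<iota> a) = \<phi> a) \<and>
           (\<forall>\<psi>'\<in>ring_hom B R. (\<forall>a\<in>carrier A. \<psi>' (\<iota> a) = \<phi> a) \<longrightarrow>
               (\<forall>b\<in>carrier B. \<psi>' b = \<psi> b))))"

end

theory Submission
  imports Defs "HOL-Algebra.Algebraic_Closure_Type" "HOL-Library.Function_Algebras" "HOL-Library.Multiset"
begin

text \<open>
  A homomorphism \<open>\<phi>\<close> from the polynomials to a real closed field has a real prime kernel \<open>P\<close>. A continuous rational
  function \<open>f\<close> with \<open>q f = p\<close> is again rational on the zero set of \<open>P\<close>: expand \<open>p\<close> and \<open>q\<close> along the segment from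
  \<open>x\<close> to a point where \<open>q\<close> does not vanish, and compare the first coefficients outside \<open>P\<close>. This gives polynomials
  \<open>a\<close>, \<open>b\<close>, \<open>h\<close> with \<open>b\<close> outside \<open>P\<close>, \<open>h\<close> in \<open>P\<close> and \<open>b f = a\<close> wherever \<open>h = 0\<close>, and the extension has to send \<open>f\<close> to
  \<open>\<phi> a / \<phi> b\<close>.

  This is well defined by the real Nullstellensatz for \<open>P\<close>, i.e. the Artin--Lang theorem: the residue field of \<open>P\<close>
  is formally real, hence embeds into a real closed field, and sign conditions are transferred from there to the
  reals by eliminating one variable after the other with the Cohen--Hormander recursion.

  It is forced by the Lojasiewicz inequality: \<open>g = b f - a\<close> vanishes where \<open>h = 0\<close>, so some power of \<open>g\<close> is \<open>h\<^sup>2\<close> times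
  a continuous rational function, and every extension of \<open>\<phi>\<close> kills \<open>g\<close>. The inequality follows from the same
  elimination: the minimum of \<open>h\<close> on the part of a ball where \<open>\<bar>g\<bar> \<ge> y\<close> is a root of one of finitely many
  polynomials with coefficients polynomial in \<open>y\<close>.
\<close>

hide_const (open) Polynomials.degree
hide_const (open) Polynomials.lead_coeff
hide_const (open) Module.smult
hide_const (open) up_ring.monom
hide_const (open) up_ring.coeff

no_notation fps_nth (infixl "$" 75)

section \<open>Polynomials over real closed fields\<close>

text \<open>The zero set of P may lie entirely inside the zero set of q, where p / q says nothing;
  this is why f has to be followed along segments that leave the pole set. Elimination is never
  phrased with formulas. It says that two homomorphisms from a ring of polynomial functions to real
  closed fields which give the same signs to a finite set M also give matching sign diagrams. The
  two fields may differ, so one statement yields the transfer from the real closure to the reals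
  and, with both fields real, the Lojasiewicz bound. Members of \<open>rcf\<close> are types,
  whereas P is a term that comes from a homomorphism; hence the detour over one fixed prime that is
  a counterexample if there is any. V enters through one polynomial k with zero set V, a sum of
  squares of finitely many equations supplied by Hilbert's basis theorem. Since k is sent to 0,
  functions that agree on V have the same extension, and the extension descends to the
  quotient.\<close>

class rcf = linordered_field +
  assumes rcf_ivt: "a < b \<Longrightarrow> (\<Sum>k\<le>n. f k * a ^ k) < 0 \<Longrightarrow> 0 < (\<Sum>k\<le>n. f k * b ^ k) \<Longrightarrow>
    \<exists>x. a < x \<and> x < b \<and> (\<Sum>k\<le>(n::nat). f k * x ^ k) = 0"

text \<open>The class axiom speaks of coefficient sums, which make sense inside a class
  specification; here it is brought back to \<open>poly\<close>.\<close>

lemma poly_ivt_pos: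
  fixes p :: "'a::rcf poly"
  assumes "a < b" "poly p a < 0" "0 < poly p b"
  shows "\<exists>x. a < x \<and> x < b \<and> poly p x = 0"
  using rcf_ivt[where f = "coeff p" and n = "degree p" and a = a and b = b] assms by (simp add: poly_altdef)

lemma poly_ivt_neg:
  fixes p :: "'a::rcf poly"
  assumes "a < b" "poly p a > 0" "0 > poly p b"
  shows "\<exists>x. a < x \<and> x < b \<and> poly p x = 0"
  using poly_ivt_pos[of a b "- p"] assms by simp

instance real :: rcf
proof
  fix a b :: real and n :: nat and f :: "nat \<Rightarrow> real"
  assume *: "a < b" "(\<Sum>k\<le>n. f k * a ^ k) < 0" "0 < (\<Sum>k\<le>n. f k * b ^ k)"
  have eq: "poly (\<Sum>k\<le>n. monom (f k) k) x = (\<Sum>k\<le>n. f k * x ^ k)" for x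
    by (simp add: poly_sum poly_monom)
  show "\<exists>x. a < x \<and> x < b \<and> (\<Sum>k\<le>n. f k * x ^ k) = 0"
    using poly_IVT_pos[of a b "\<Sum>k\<le>n. monom (f k) k"] * unfolding eq by auto
qed

text \<open>Signs are integers so that signs of elements of two different fields can be compared.\<close>

definition sg :: "'a::linordered_idom \<Rightarrow> int" where
  "sg x = (if x = 0 then 0 else if x > 0 then 1 else - 1)"

lemma sg_eq_iff: "sg x = sg y \<longleftrightarrow> (x > 0 \<longleftrightarrow> y > 0) \<and> (x < 0 \<longleftrightarrow> y < 0)"
  by (auto simp: sg_def)

lemma sg_mult: "sg (x * y) = sg x * sg y"
  by (auto simp: sg_def zero_less_mult_iff)

lemma sg_0 [simp]: "sg 0 = 0" by (simp add: sg_def)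

lemma sg_1 [simp]: "sg 1 = 1" by (simp add: sg_def)

lemma sg_0_iff [simp]: "sg x = 0 \<longleftrightarrow> x = 0" by (simp add: sg_def)

lemma sg_uminus: "sg (- x) = - sg x" by (auto simp: sg_def)

lemma sg_poly_eq_of_no_root:
  fixes p :: "'a::rcf poly"
  assumes "\<And>x. min a b \<le> x \<Longrightarrow> x \<le> max a b \<Longrightarrow> poly p x \<noteq> 0"
  shows "sg (poly p a) = sg (poly p b)"
proof -
  have *: "sg (poly p a) = sg (poly p b)" if "a < b" "\<And>x. a \<le> x \<Longrightarrow> x \<le> b \<Longrightarrow> poly p x \<noteq> 0" for a b
  proof -
    have "poly p a \<noteq> 0" "poly p b \<noteq> 0" using that by auto
    moreover have "\<not> (poly p a < 0 \<and> 0 < poly p b)" "\<not> (0 < poly p a \<and> poly p b < 0)"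
      using poly_ivt_pos[OF that(1), of p] poly_ivt_neg[OF that(1), of p] that(2) by (auto dest: less_imp_le)
    ultimately show ?thesis by (auto simp: sg_eq_iff)
  qed
  show ?thesis
  proof (cases a b rule: linorder_cases)
    case less
    show ?thesis by (rule *[OF less assms]) (use less in auto)
  next
    case greater
    show ?thesis by (rule *[OF greater assms, symmetric]) (use greater in auto)
  qed simp
qed

text \<open>No maximum is available over a general real closed field. Instead p is factored as
  \<open>A ^ Suc i * (B ^ Suc j * r)\<close>, with A and B the linear factors of two neighbouring
  roots a and d, and r without a root from a to d. The cofactor s of \<open>A ^ i * B ^ j\<close> in
  the derivative then has opposite signs at a and d.\<close>

lemma poly_rolle:
  fixes p :: "'a::rcf poly"
  assumes "a < b" "poly p a = 0" "poly p b = 0" "p \<noteq> 0"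
  shows "\<exists>c. a < c \<and> c < b \<and> poly (pderiv p) c = 0"
proof -
  define S where "S = {x. poly p x = 0 \<and> a < x}"
  have fin: "finite S"
    using poly_roots_finite[OF \<open>p \<noteq> 0\<close>] by (auto simp: S_def)
  have bS: "b \<in> S" using assms by (auto simp: S_def)
  \<comment> \<open>The first root beyond a, so that p has none strictly between a and d.\<close>
  define d where "d = Min S"
  have d: "d \<in> S" "d \<le> b" "\<And>x. x \<in> S \<Longrightarrow> d \<le> x"
    using fin bS by (auto simp: d_def intro: Min_in)
  have ad: "a < d" "poly p d = 0" using d(1) by (auto simp: S_def)
  have nr: "poly p x \<noteq> 0" if "a < x" "x < d" for x
    using d(3)[of x] that by (auto simp: S_def)
  obtain q m where q: "p = [:- a, 1:] ^ m * q" "\<not> [:- a, 1:] dvd q"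
    using order_decomp[OF \<open>p \<noteq> 0\<close>] by blast
  have "q \<noteq> 0" using q by auto
  obtain r n where r: "q = [:- d, 1:] ^ n * r" "\<not> [:- d, 1:] dvd r"
    using order_decomp[OF \<open>q \<noteq> 0\<close>] by blast
  have qa: "poly q a \<noteq> 0" using q(2) poly_eq_0_iff_dvd by blast
  hence "m \<noteq> 0" using assms(2) q(1) by auto
  then obtain i where i: "m = Suc i" by (cases m) auto
  have "poly q d = 0" using ad q(1) by auto
  hence "n \<noteq> 0" using r poly_eq_0_iff_dvd by (metis mult_1 power_0)
  then obtain j where j: "n = Suc j" by (cases n) auto
  define A where "A = [:- a, 1:]"
  define B where "B = [:- d, 1:]"
  have p: "p = A ^ Suc i * (B ^ Suc j * r)"
    using q(1) r(1) i j by (simp add: A_def B_def)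
  have dA: "pderiv A = 1" "pderiv B = 1" by (simp_all add: A_def B_def pderiv_pCons)
  define k where "k = (of_nat (Suc i) :: 'a)"
  define l where "l = (of_nat (Suc j) :: 'a)"
  define s where "s = smult k (B * r) + smult l (A * r) + A * B * pderiv r"
  have dp: "pderiv p = A ^ i * B ^ j * s"
    unfolding p s_def pderiv_mult pderiv_power_Suc dA k_def[symmetric] l_def[symmetric]
    by (simp add: algebra_simps)
  have ra: "poly r a \<noteq> 0"
    using qa r(1) by auto
  have rd: "poly r d \<noteq> 0" using r(2) poly_eq_0_iff_dvd by blast
  have rr: "sg (poly r a) = sg (poly r d)"
  proof (rule sg_poly_eq_of_no_root)
    fix x assume "min a d \<le> x" "x \<le> max a d"
    hence "a \<le> x" "x \<le> d" using ad by auto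
    thus "poly r x \<noteq> 0"
      using ra rd nr[of x] by (cases "x = a"; cases "x = d") (auto simp: p)
  qed
  \<comment> \<open>At a only the term with \<open>B * r\<close> survives, at d only the one with
    \<open>A * r\<close>; a - d and d - a have opposite signs.\<close>
  have sa: "poly s a = k * (a - d) * poly r a"
    by (simp add: s_def A_def B_def algebra_simps)
  have sd: "poly s d = l * (d - a) * poly r d"
    by (simp add: s_def A_def B_def algebra_simps)
  have n: "0 < k" "0 < l"
    unfolding k_def l_def by (simp_all only: of_nat_0_less_iff zero_less_Suc)
  have "\<exists>c. a < c \<and> c < d \<and> poly s c = 0"
  proof (cases "poly r a > 0")
    case True
    hence "poly r d > 0" using rr by (simp add: sg_eq_iff)
    with True have "poly s a < 0" "poly s d > 0"
      using ad n unfolding sa sd by (simp_all add: mult_pos_neg mult_neg_pos)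
    thus ?thesis using poly_ivt_pos ad(1) by blast
  next
    case False
    hence "poly r a < 0" using ra by auto
    moreover hence "poly r d < 0" using rr by (simp add: sg_eq_iff)
    ultimately have "poly s a > 0" "poly s d < 0"
      using ad n unfolding sa sd by (simp_all add: mult_neg_neg mult_pos_neg mult_neg_pos)
    thus ?thesis using poly_ivt_neg ad(1) by blast
  qed
  thus ?thesis using d(2) by (auto simp: dp intro: order.strict_trans2)
qed

lemma poly_mvt:
  fixes p :: "'a::rcf poly"
  assumes "a < b"
  shows "\<exists>c. a < c \<and> c < b \<and> poly p b - poly p a = (b - a) * poly (pderiv p) c"
proof -
  define k where "k = (poly p b - poly p a) / (b - a)"
  define g where "g = p - [: poly p a - k * a, k:]"
  have k: "k * (b - a) = poly p b - poly p a" using assms by (simp add: k_def)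
  have g0: "poly g a = 0" "poly g b = 0"
    using k by (simp_all add: g_def algebra_simps)
  have dg: "pderiv g = pderiv p - [:k:]"
    by (simp add: g_def pderiv_diff pderiv_pCons)
  have "\<exists>c. a < c \<and> c < b \<and> poly (pderiv g) c = 0"
  \<comment> \<open>For affine p the tilted polynomial is zero and Rolle does not apply; every point
    in between serves.\<close>
  proof (cases "g = 0")
    case True
    thus ?thesis using dense[OF assms] by auto
  next
    case False
    thus ?thesis using poly_rolle assms g0 by blast
  qed
  then obtain c where "a < c" "c < b" "poly (pderiv p) c = k" by (auto simp: dg)
  thus ?thesis using k by (auto simp: algebra_simps)
qed

lemma poly_strict_mono:
  fixes p :: "'a::rcf poly"
  assumes "a < b" "\<And>c. a < c \<Longrightarrow> c < b \<Longrightarrow> poly (pderiv p) c > 0"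
  shows "poly p a < poly p b"
  using poly_mvt[OF assms(1), of p] assms by (metis diff_gt_0_iff_gt mult_pos_pos)

text \<open>The bound c > 0, stronger than positivity, carries the induction: x * c outgrows any
  constant term.\<close>

lemma poly_pos_large:
  fixes p :: "'a::linordered_field poly"
  assumes "lead_coeff p > 0"
  shows "\<exists>B c. c > 0 \<and> (\<forall>x\<ge>B. poly p x \<ge> c)"
  using assms
proof (induction p)
  case (pCons a p)
  show ?case
  proof (cases "p = 0")
    case True
    thus ?thesis using pCons.prems by (intro exI[of _ 0] exI[of _ a]) auto
  next
    case False
    then obtain B c where Bc: "c > 0" "\<And>x. x \<ge> B \<Longrightarrow> poly p x \<ge> c"
      using pCons by auto
    define B' where "B' = max (max B 0) ((1 - a) / c)"
    have "poly (pCons a p) x \<ge> 1" if "x \<ge> B'" for x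
    proof -
      have x: "x \<ge> B" "x \<ge> 0" "x \<ge> (1 - a) / c" using that by (auto simp: B'_def)
      have "1 - a \<le> x * c" using x(3) Bc(1) by (simp add: field_simps)
      also have "\<dots> \<le> x * poly p x" using x Bc(2) by (intro mult_left_mono) auto
      finally show ?thesis by simp
    qed
    thus ?thesis by (intro exI[of _ B'] exI[of _ 1]) auto
  qed
qed auto

lemma sg_poly_at_top:
  fixes p :: "'a::linordered_field poly"
  shows "\<exists>B. \<forall>x\<ge>B. sg (poly p x) = sg (lead_coeff p)"
proof (cases "lead_coeff p" "0 :: 'a" rule: linorder_cases)
  case less
  thus ?thesis using poly_pos_large[of "- p"] by (fastforce simp: sg_def)
next
  case greater
  thus ?thesis using poly_pos_large[of p] by (fastforce simp: sg_def)
qed auto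

lemma sg_poly_at_bot:
  fixes p :: "'a::linordered_field poly"
  shows "\<exists>B. \<forall>x\<le>B. sg (poly p x) = sg (lead_coeff p) * (-1) ^ degree p"
proof -
  obtain B where B: "\<And>x. x \<ge> B \<Longrightarrow> sg (poly (pcompose p [:0, -1:]) x) = sg (lead_coeff (pcompose p [:0, -1:]))"
    using sg_poly_at_top by blast
  have lc: "lead_coeff (pcompose p [:0, -1:]) = lead_coeff p * (-1) ^ degree p"
    by (simp add: lead_coeff_comp)
  have s: "sg ((-1::'a) ^ k) = (-1) ^ k" for k
    by (induction k) (simp_all add: sg_uminus)
  have "sg (poly p x) = sg (lead_coeff p) * (-1) ^ degree p" if "x \<le> - B" for x
  proof -
    have "- x \<ge> B" using that by simp
    from B[OF this] show ?thesis unfolding lc by (simp add: poly_pcompose sg_mult s)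
  qed
  thus ?thesis by blast
qed

section \<open>Matching the sign diagrams of two families of polynomials\<close>

text \<open>Here \<open>F\<close> is a finite order isomorphism between subsets of the two fields, and \<open>cut_eq F y y'\<close> says that it
  remains one when \<open>(y, y')\<close> is added.\<close>

definition cut_eq :: "('a::linordered_field \<times> 'b::linordered_field) set \<Rightarrow> 'a \<Rightarrow> 'b \<Rightarrow> bool" where
  "cut_eq F y y' \<longleftrightarrow> (\<forall>z z'. (z, z') \<in> F \<longrightarrow> sg (y - z) = sg (y' - z'))"

definition cut_compat :: "('a::linordered_field \<times> 'b::linordered_field) set \<Rightarrow> bool" where
  "cut_compat F \<longleftrightarrow> finite F \<and> (\<forall>z z'. (z, z') \<in> F \<longrightarrow> cut_eq F z z')"

text \<open>A common sign diagram expressed through positions, the intervals being the cuts of F. If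
  \<open>cut_compat F\<close> holds and p is nonzero, every root of p is forced to be a point of F;
  see \<open>root_mem_fst\<close>.\<close>

definition agrees ::
  "('a::linordered_field \<times> 'b::linordered_field) set \<Rightarrow> ('a poly \<times> 'b poly) set \<Rightarrow> bool" where
  "agrees F L \<longleftrightarrow> (\<forall>y y'. cut_eq F y y' \<longrightarrow> (\<forall>p q. (p, q) \<in> L \<longrightarrow> sg (poly p y) = sg (poly q y')))"

lemma cut_eqD: "cut_eq F y y' \<Longrightarrow> (z, z') \<in> F \<Longrightarrow> sg (y - z) = sg (y' - z')"
  by (auto simp: cut_eq_def)

lemma cut_eq_less: "cut_eq F y y' \<Longrightarrow> (z, z') \<in> F \<Longrightarrow> y < z \<longleftrightarrow> y' < z'"
  using cut_eqD[of F y y' z z'] by (auto simp: sg_eq_iff)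

lemma cut_eq_greater: "cut_eq F y y' \<Longrightarrow> (z, z') \<in> F \<Longrightarrow> z < y \<longleftrightarrow> z' < y'"
  using cut_eqD[of F y y' z z'] by (auto simp: sg_eq_iff)

lemma cut_eq_eq: "cut_eq F y y' \<Longrightarrow> (z, z') \<in> F \<Longrightarrow> y = z \<longleftrightarrow> y' = z'"
  using cut_eqD[of F y y' z z'] by (auto simp: sg_def split: if_splits)

lemma cut_eq_mono: "cut_eq F y y' \<Longrightarrow> G \<subseteq> F \<Longrightarrow> cut_eq G y y'"
  by (auto simp: cut_eq_def)

lemma cut_eq_converse [simp]: "cut_eq (F\<inverse>) y y' \<longleftrightarrow> cut_eq F y' y"
  by (auto simp: cut_eq_def)

lemma cut_compatD: "cut_compat F \<Longrightarrow> (z, z') \<in> F \<Longrightarrow> cut_eq F z z'"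
  by (auto simp: cut_compat_def)

lemma cut_compat_converse: "cut_compat F \<Longrightarrow> cut_compat (F\<inverse>)"
  by (auto simp: cut_compat_def)

lemma cut_compat_mono: "cut_compat F \<Longrightarrow> G \<subseteq> F \<Longrightarrow> cut_compat G"
  unfolding cut_compat_def by (auto intro: finite_subset cut_eq_mono[of F])

lemma agreesD: "agrees F L \<Longrightarrow> cut_eq F y y' \<Longrightarrow> (p, q) \<in> L \<Longrightarrow> sg (poly p y) = sg (poly q y')"
  by (auto simp: agrees_def)

lemma agrees_converse: "agrees F L \<Longrightarrow> agrees (F\<inverse>) (L\<inverse>)"
  by (auto simp: agrees_def)

lemma agrees_mono: "agrees F L \<Longrightarrow> F \<subseteq> G \<Longrightarrow> M \<subseteq> L \<Longrightarrow> agrees G M"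
  unfolding agrees_def by (meson cut_eq_mono subsetD)

lemma exists_between_finite:
  fixes A B :: "'a::linordered_field set"
  assumes "finite A" "finite B" "\<And>a b. a \<in> A \<Longrightarrow> b \<in> B \<Longrightarrow> a < b"
  shows "\<exists>c. (\<forall>a\<in>A. a < c) \<and> (\<forall>b\<in>B. c < b)"
proof (cases "A = {}")
  case True
  show ?thesis
  proof (cases "B = {}")
    case False
    have "Min B - 1 < b" if "b \<in> B" for b using Min_le[OF assms(2) that] by (simp add: algebra_simps add_strict_increasing)
    thus ?thesis using True by blast
  qed (use True in auto)
next
  case False
  note A = this
  show ?thesis
  proof (cases "B = {}")
    case True
    have "a < Max A + 1" if "a \<in> A" for a using Max_ge[OF assms(1) that] by (simp add: add_strict_increasing2)
    thus ?thesis using True by blast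
  next
    case False
    have "Max A < Min B" using assms A False by simp
    then obtain c where "Max A < c" "c < Min B" using dense by blast
    thus ?thesis using assms A False by (metis Max_less_iff Min_gr_iff)
  qed
qed

text \<open>The extension step of a back-and-forth argument: a linearly ordered field is dense and
  has no end points, so finitely many consistent conditions on \<open>y'\<close> can be met.\<close>

lemma cut_eq_exists:
  assumes "cut_compat F"
  shows "\<exists>y'. cut_eq F y y'"
proof (cases "y \<in> fst ` F")
  case True
  then obtain y' where "(y, y') \<in> F" by force
  thus ?thesis using cut_compatD[OF assms] by blast
next
  case False
  have fin: "finite F" using assms by (simp add: cut_compat_def)
  define A where "A = {z' |z z'. (z, z') \<in> F \<and> z < y}"
  define B where "B = {z' |z z'. (z, z') \<in> F \<and> y < z}"
  have "A \<subseteq> snd ` F" "B \<subseteq> snd ` F" by (force simp: A_def B_def)+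
  hence "finite A" "finite B" using fin finite_subset by blast+
  moreover have "a < b" if ab: "a \<in> A" "b \<in> B" for a b
  proof -
    obtain z w where *: "(z, a) \<in> F" "z < y" "(w, b) \<in> F" "y < w"
      using ab by (auto simp: A_def B_def)
    thus ?thesis using cut_eq_less[OF cut_compatD[OF assms *(1)] *(3)] by auto
  qed
  ultimately obtain c where c: "\<And>a. a \<in> A \<Longrightarrow> a < c" "\<And>b. b \<in> B \<Longrightarrow> c < b"
    using exists_between_finite by metis
  have "cut_eq F y c"
    unfolding cut_eq_def
  proof safe
    fix z z' assume *: "(z, z') \<in> F"
    hence "z \<noteq> y" using False by force
    thus "sg (y - z) = sg (c - z')"
    proof (cases "z < y")
      case True
      hence "z' \<in> A" using * by (auto simp: A_def)
      thus ?thesis using True c(1) by (simp add: sg_eq_iff not_less less_imp_le)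
    next
      case False
      hence "y < z" using \<open>z \<noteq> y\<close> by simp
      moreover from this have "z' \<in> B" using * by (auto simp: B_def)
      ultimately show ?thesis using c(2) by (simp add: sg_eq_iff not_less less_imp_le)
    qed
  qed
  thus ?thesis by blast
qed

text \<open>If y were not in F, all points of a short interval from y to b would lie in one cut.
  They share the partner \<open>y'\<close>, so p would vanish on the whole interval.\<close>

lemma root_mem_fst:
  assumes "cut_compat F" "agrees F L" "(p, q) \<in> L" "p \<noteq> 0" "poly p y = 0"
  shows "y \<in> fst ` F"
proof (rule ccontr)
  assume y: "y \<notin> fst ` F"
  obtain y' where y': "cut_eq F y y'" using cut_eq_exists[OF assms(1)] by blast
  have fin: "finite F" using assms by (simp add: cut_compat_def)
  have "\<exists>b. (\<forall>a\<in>{y}. a < b) \<and> (\<forall>z\<in>{z \<in> fst ` F. y < z}. b < z)"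
    by (rule exists_between_finite) (use fin in auto)
  then obtain b where b: "y < b" "\<And>z. z \<in> fst ` F \<Longrightarrow> y < z \<Longrightarrow> b < z" by blast
  have "{y..b} \<subseteq> {x. poly p x = 0}"
  proof
    fix t assume t: "t \<in> {y..b}"
    have "cut_eq F t y'"
      unfolding cut_eq_def
    proof safe
      fix z z' assume *: "(z, z') \<in> F"
      have "z \<noteq> y" using y * by force
      moreover have "y < z \<Longrightarrow> b < z" using b(2) * by force
      ultimately have "sg (t - z) = sg (y - z)" using t by (cases "y < z") (auto simp: sg_eq_iff)
      thus "sg (t - z) = sg (y' - z')" using cut_eqD[OF y' *] by simp
    qed
    hence "sg (poly p t) = sg (poly p y)"
      using agreesD[OF assms(2) _ assms(3)] y' by metis
    thus "t \<in> {x. poly p x = 0}" using assms(5) by simp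
  qed
  thus False using poly_roots_finite[OF assms(4)] infinite_Icc[OF b(1)] finite_subset by blast
qed

lemma sg_poly_eq_same_cut:
  fixes q :: "'a::rcf poly"
  assumes "\<And>z. z \<in> S \<Longrightarrow> sg (a - z) = sg (b - z)" "\<And>x. poly q x = 0 \<Longrightarrow> x \<in> S" "poly q a \<noteq> 0"
  shows "sg (poly q a) = sg (poly q b)"
proof (rule sg_poly_eq_of_no_root)
  fix x assume x: "min a b \<le> x" "x \<le> max a b"
  show "poly q x \<noteq> 0"
  proof
    assume "poly q x = 0"
    with assms have "sg (a - x) = sg (b - x)" "x \<noteq> a" by auto
    thus False using x by (auto simp: sg_eq_iff min_def max_def split: if_splits)
  qed
qed

text \<open>Keeping only the roots of members of L loses no sign information and ensures that at
  each remaining point some member vanishes. There a pseudo-remainder gives the sign of a further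
  polynomial.\<close>

lemma agrees_restrict_roots:
  fixes F :: "('a::rcf \<times> 'b::rcf) set"
  assumes "cut_compat F" "agrees F L" "\<forall>p q. (p, q) \<in> L \<longrightarrow> p \<noteq> 0 \<and> q \<noteq> 0"
  defines "G \<equiv> {(z, z'). (z, z') \<in> F \<and> (\<exists>(p, q)\<in>L. poly p z = 0)}"
  shows "cut_compat G" "agrees G L"
    and "\<And>p q y. (p, q) \<in> L \<Longrightarrow> poly p y = 0 \<Longrightarrow> y \<in> fst ` G"
    and "\<And>p q y'. (p, q) \<in> L \<Longrightarrow> poly q y' = 0 \<Longrightarrow> y' \<in> snd ` G"
    and "\<And>z z'. (z, z') \<in> G \<Longrightarrow> \<exists>(p, q)\<in>L. poly p z = 0 \<and> poly q z' = 0"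
proof -
  have sub: "G \<subseteq> F" by (auto simp: G_def)
  show cG: "cut_compat G" using cut_compat_mono[OF assms(1) sub] .
  show r1: "y \<in> fst ` G" if "(p, q) \<in> L" "poly p y = 0" for p q y
  proof -
    have "y \<in> fst ` F" using root_mem_fst[OF assms(1,2) that(1) _ that(2)] assms(3) that by blast
    thus ?thesis using that by (force simp: G_def)
  qed
  have F0: "poly p z = 0 \<longleftrightarrow> poly q z' = 0" if "(z, z') \<in> F" "(p, q) \<in> L" for p q z z'
    using agreesD[OF assms(2) cut_compatD[OF assms(1) that(1)] that(2)] by (metis sg_0_iff)
  show r2: "y' \<in> snd ` G" if "(p, q) \<in> L" "poly q y' = 0" for p q y'
  proof -
    have "y' \<in> fst ` (F\<inverse>)"
      using root_mem_fst[OF cut_compat_converse[OF assms(1)] agrees_converse[OF assms(2)], of q p y'] assms(3) that by blast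
    then obtain y where "(y, y') \<in> F" by force
    thus ?thesis using that F0[of y y' p q] by (force simp: G_def)
  qed
  show "\<exists>(p, q)\<in>L. poly p z = 0 \<and> poly q z' = 0" if "(z, z') \<in> G" for z z'
    using that F0 unfolding G_def by blast
  show "agrees G L"
    unfolding agrees_def
  proof safe
    fix y y' p q assume y: "cut_eq G y y'" and pq: "(p, q) \<in> L"
    \<comment> \<open>The given \<open>y'\<close> matches y only relative to G, so a partner w
      relative to all of F is compared with it. All roots of q are in G, so q has the same sign at w
      and \<open>y'\<close>.\<close>
    obtain w where w: "cut_eq F y w" using cut_eq_exists[OF assms(1)] by blast
    have wG: "cut_eq G y w" using cut_eq_mono[OF w sub] .
    have eq: "sg (poly p y) = sg (poly q w)" using agreesD[OF assms(2) w pq] .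
    show "sg (poly p y) = sg (poly q y')"
    proof (cases "poly q w = 0")
      case True
      hence "poly p y = 0" using eq by (metis sg_0_iff)
      from r1[OF pq this] obtain v where v: "(y, v) \<in> G" by force
      hence "y' = v" "w = v" using cut_eq_eq[OF y v] cut_eq_eq[OF wG v] by auto
      thus ?thesis using eq by simp
    next
      case False
      have "sg (poly q w) = sg (poly q y')"
      proof (rule sg_poly_eq_same_cut[where S = "snd ` G"])
        fix z' assume "z' \<in> snd ` G"
        then obtain z where "(z, z') \<in> G" by force
        thus "sg (w - z') = sg (y' - z')" using cut_eqD[OF y] cut_eqD[OF wG] by metis
      qed (use r2 pq False in auto)
      thus ?thesis using eq by simp
    qed
  qed
qed

section \<open>Adding the roots of one more pair of polynomials to a sign diagram\<close>

text \<open>The last two conjuncts provide end points beyond all roots, so that every root has neighbours in \<open>F\<close>.\<close>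

definition ready :: "('a::rcf \<times> 'b::rcf) set \<Rightarrow> 'a poly \<Rightarrow> 'b poly \<Rightarrow> bool" where
  "ready F p q \<longleftrightarrow> cut_compat F \<and> p \<noteq> 0 \<and> q \<noteq> 0 \<and> agrees F {(pderiv p, pderiv q)} \<and>
     (\<forall>y. poly (pderiv p) y = 0 \<longrightarrow> y \<in> fst ` F) \<and> (\<forall>y. poly (pderiv q) y = 0 \<longrightarrow> y \<in> snd ` F) \<and>
     (\<forall>z z'. (z, z') \<in> F \<longrightarrow> sg (poly p z) = sg (poly q z')) \<and>
     (\<exists>m m'. (m, m') \<in> F \<and> (\<forall>y y'. y < m \<longrightarrow> y' < m' \<longrightarrow>
        sg (poly p y) = sg (poly q y') \<and> poly p y \<noteq> 0 \<and> poly q y' \<noteq> 0)) \<and>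
     (\<exists>M M'. (M, M') \<in> F \<and> (\<forall>y y'. y > M \<longrightarrow> y' > M' \<longrightarrow>
        sg (poly p y) = sg (poly q y') \<and> poly p y \<noteq> 0 \<and> poly q y' \<noteq> 0))"

lemma ready_converse:
  assumes "ready F p q"
  shows "ready (F\<inverse>) q p"
proof -
  have c: "{(pderiv p, pderiv q)}\<inverse> = {(pderiv q, pderiv p)}" by auto
  have f: "fst ` (F\<inverse>) = snd ` F" "snd ` (F\<inverse>) = fst ` F" by force+
  have *: "cut_compat F" "agrees F {(pderiv p, pderiv q)}"
    using assms by (simp_all add: ready_def)
  show ?thesis
    using assms cut_compat_converse[OF *(1)] agrees_converse[OF *(2)]
    unfolding ready_def converse_iff f c by (elim conjE exE, intro conjI) (blast | metis)+
qed

lemma ready_uminus: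
  assumes "ready F p q"
  shows "ready F (- p) (- q)"
proof -
  have "agrees F {(pderiv (- p), pderiv (- q))}"
    using assms unfolding ready_def agrees_def by (simp add: pderiv_minus sg_uminus)
  thus ?thesis
    using assms unfolding ready_def by (simp only: pderiv_minus poly_minus sg_uminus neg_equal_0_iff_equal neg_equal_iff_equal) simp
qed

lemma neighbours:
  assumes "cut_compat F" "(m, m') \<in> F" "m < y" "(M, M') \<in> F" "y < M" "y \<notin> fst ` F"
  shows "\<exists>z z' w w'. (z, z') \<in> F \<and> (w, w') \<in> F \<and> z < y \<and> y < w \<and>
    (\<forall>v v'. (v, v') \<in> F \<longrightarrow> v < y \<longrightarrow> v \<le> z) \<and> (\<forall>v v'. (v, v') \<in> F \<longrightarrow> y < v \<longrightarrow> w \<le> v)"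
proof -
  have fin: "finite F" using assms by (simp add: cut_compat_def)
  define A where "A = {z \<in> fst ` F. z < y}"
  define B where "B = {z \<in> fst ` F. y < z}"
  have f: "finite A" "finite B" using fin by (auto simp: A_def B_def)
  have n: "m \<in> A" "M \<in> B" using assms by (force simp: A_def B_def)+
  have "Max A \<in> A" "Min B \<in> B" using f n by (auto intro: Max_in Min_in)
  then obtain z' w' where "(Max A, z') \<in> F" "(Min B, w') \<in> F" "Max A < y" "y < Min B"
    by (auto simp: A_def B_def)
  moreover have "v \<le> Max A" if "(v, v') \<in> F" "v < y" for v v'
    by (rule Max_ge[OF f(1)]) (use that in \<open>force simp: A_def\<close>)
  moreover have "Min B \<le> v" if "(v, v') \<in> F" "y < v" for v v'
    by (rule Min_le[OF f(2)]) (use that in \<open>force simp: B_def\<close>)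
  ultimately show ?thesis by blast
qed

lemma sg_poly_on_gap:
  fixes p :: "'a::rcf poly"
  assumes "\<And>x. poly p x = 0 \<Longrightarrow> x \<in> S" "z < y" "y < w" "\<And>v. v \<in> S \<Longrightarrow> z < v \<Longrightarrow> v < w \<Longrightarrow> False"
    "z < c" "c < w"
  shows "sg (poly p c) = sg (poly p y)"
proof (rule sg_poly_eq_of_no_root)
  fix x assume "min c y \<le> x" "x \<le> max c y"
  hence "z < x" "x < w" using assms by (auto simp: min_def max_def split: if_splits)
  thus "poly p x \<noteq> 0" using assms(1,4) by blast
qed

text \<open>Between neighbouring points of F the derivative has no root, so p is strictly monotone
  there and has opposite signs at the two neighbours of y. These signs are shared with q at the
  partners, and the intermediate value property yields a root of q in the matching gap.\<close>

lemma ready_root_exists: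
  fixes F :: "('a::rcf \<times> 'b::rcf) set"
  assumes "ready F p q" "poly p y = 0"
  shows "\<exists>y'. poly q y' = 0 \<and> cut_eq F y y'"
proof (cases "y \<in> fst ` F")
  case True
  then obtain y' where y': "(y, y') \<in> F" by force
  hence "sg (poly p y) = sg (poly q y')" using assms unfolding ready_def by blast
  hence "poly q y' = 0" using assms by (metis sg_0_iff)
  moreover have "cut_eq F y y'" using assms y' unfolding ready_def by (metis cut_compatD)
  ultimately show ?thesis by blast
next
  case False
  have c: "cut_compat F" using assms by (simp add: ready_def)
  have sF: "sg (poly p z) = sg (poly q z')" if "(z, z') \<in> F" for z z'
    using assms that unfolding ready_def by blast
  have r1: "\<And>x. poly (pderiv p) x = 0 \<Longrightarrow> x \<in> fst ` F"
    using assms unfolding ready_def by blast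
  obtain m m' M M' where mM: "(m, m') \<in> F" "(M, M') \<in> F"
    and m: "\<And>y y'. y < m \<Longrightarrow> y' < m' \<Longrightarrow> poly p y \<noteq> 0"
    and M: "\<And>y y'. y > M \<Longrightarrow> y' > M' \<Longrightarrow> poly p y \<noteq> 0"
    using assms unfolding ready_def by metis
  have "m \<noteq> y" "M \<noteq> y" using False mM by force+
  \<comment> \<open>Beyond the end points p does not vanish; \<open>m' - 1\<close> and
    \<open>M' + 1\<close> merely instantiate a point beyond the ends in the other field.\<close>
  hence "m < y" "y < M"
    using m[of y "m' - 1"] M[of y "M' + 1"] assms(2) by (cases "y < m"; cases "M < y"; simp)+
  from neighbours[OF c mM(1) this(1) mM(2) this(2) False] obtain z z' w w' where
    zw: "(z, z') \<in> F" "(w, w') \<in> F" "z < y" "y < w"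
    "\<forall>v v'. (v, v') \<in> F \<longrightarrow> v < y \<longrightarrow> v \<le> z" "\<forall>v v'. (v, v') \<in> F \<longrightarrow> y < v \<longrightarrow> w \<le> v"
    by blast
  have gap: False if v: "v \<in> fst ` F" "z < v" "v < w" for v
  proof -
    obtain v' where "(v, v') \<in> F" using v by force
    moreover have "v \<noteq> y" using v False by auto
    ultimately show False using zw(5,6) v by (metis linorder_neqE not_le)
  qed
  have dp: "sg (poly (pderiv p) c) = sg (poly (pderiv p) y)" if "z < c" "c < w" for c
    by (rule sg_poly_on_gap[OF r1 zw(3,4) gap that]) auto
  have z'w': "z' < w'" using cut_eq_less[OF cut_compatD[OF c zw(1)] zw(2)] zw by auto
  have "\<exists>y'. z' < y' \<and> y' < w' \<and> poly q y' = 0"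
  proof (cases "poly (pderiv p) y > 0")
    case True
    have "poly p z < poly p y" "poly p y < poly p w"
      using True dp zw(3,4) by (auto intro!: poly_strict_mono simp: sg_eq_iff)
    hence "poly q z' < 0" "poly q w' > 0"
      using sF[OF zw(1)] sF[OF zw(2)] assms(2) by (auto simp: sg_eq_iff)
    thus ?thesis using poly_ivt_pos z'w' by blast
  next
    case F: False
    have "poly (pderiv p) y \<noteq> 0" using r1 False by blast
    hence neg: "poly (pderiv p) y < 0" using F by auto
    have "poly (- p) z < poly (- p) y" "poly (- p) y < poly (- p) w"
      using neg dp zw(3,4) by (auto intro!: poly_strict_mono simp: sg_eq_iff pderiv_minus simp del: poly_minus) (auto simp: sg_eq_iff)
    hence "poly q z' > 0" "poly q w' < 0"
      using sF[OF zw(1)] sF[OF zw(2)] assms(2) by (auto simp: sg_eq_iff)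
    thus ?thesis using poly_ivt_neg z'w' by blast
  qed
  then obtain y' where y': "z' < y'" "y' < w'" "poly q y' = 0" by blast
  have "cut_eq F y y'"
    unfolding cut_eq_def
  proof (intro allI impI)
    fix v v' assume v: "(v, v') \<in> F"
    have "v \<noteq> y" using v False by force
    show "sg (y - v) = sg (y' - v')"
    proof (cases "v < y")
      case True
      hence "v \<le> z" using zw(5) v by blast
      hence "v' \<le> z'" using cut_eq_less[OF cut_compatD[OF c zw(1)] v] by auto
      thus ?thesis using True y' by (simp add: sg_def)
    next
      case F: False
      hence "w \<le> v" using zw(6) v \<open>v \<noteq> y\<close> by auto
      hence "w' \<le> v'" using cut_eq_greater[OF cut_compatD[OF c zw(2)] v] by auto
      thus ?thesis using F \<open>v \<noteq> y\<close> y' by (simp add: sg_def)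
    qed
  qed
  thus ?thesis using y' by blast
qed

text \<open>By Rolle a critical point of r lies strictly between two distinct roots; being in S, it
  would separate them.\<close>

lemma root_unique_in_cut:
  fixes r :: "'a::rcf poly"
  assumes "\<And>z. z \<in> S \<Longrightarrow> sg (a - z) = sg (b - z)" "poly r a = 0" "poly r b = 0" "r \<noteq> 0"
    "\<And>x. poly (pderiv r) x = 0 \<Longrightarrow> x \<in> S"
  shows "a = b"
proof -
  have *: False if ab: "a < b" "poly r a = 0" "poly r b = 0" "\<And>z. z \<in> S \<Longrightarrow> sg (a - z) = sg (b - z)" for a b
  proof -
    obtain c where "a < c" "c < b" "c \<in> S"
      using poly_rolle[OF ab(1-3) assms(4)] assms(5) by blast
    thus False using ab(4)[of c] by (simp add: sg_eq_iff)
  qed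
  show ?thesis using *[of a b] *[of b a] assms(1-3) by (metis linorder_neqE)
qed

text \<open>Under \<open>ready F p q\<close> a cut holds at most one root on either side, by
  \<open>root_unique_in_cut\<close>, so cuts alone determine the pairing.\<close>

definition add_roots where
  "add_roots F p q = F \<union> {(y, y'). poly p y = 0 \<and> poly q y' = 0 \<and> cut_eq F y y'}"

lemma add_roots_uminus [simp]: "add_roots F (- p) (- q) = add_roots F p q"
  by (simp add: add_roots_def)

lemma cut_compat_add_roots:
  fixes F :: "('a::rcf \<times> 'b::rcf) set"
  assumes "ready F p q"
  shows "cut_compat (add_roots F p q)"
proof -
  have c: "cut_compat F" "p \<noteq> 0" "q \<noteq> 0" using assms by (simp_all add: ready_def)
  have r1: "\<And>x. poly (pderiv p) x = 0 \<Longrightarrow> x \<in> fst ` F" and r2: "\<And>x. poly (pderiv q) x = 0 \<Longrightarrow> x \<in> snd ` F"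
    using assms unfolding ready_def by blast+
  have "finite (add_roots F p q)"
  proof -
    have "add_roots F p q \<subseteq> F \<union> {x. poly p x = 0} \<times> {x. poly q x = 0}" by (auto simp: add_roots_def)
    moreover have "finite (F \<union> {x. poly p x = 0} \<times> {x. poly q x = 0})"
      using c(1) poly_roots_finite[OF c(2)] poly_roots_finite[OF c(3)] by (simp add: cut_compat_def)
    ultimately show ?thesis by (rule finite_subset)
  qed
  moreover have "sg (a - b) = sg (a' - b')"
    if a: "(a, a') \<in> add_roots F p q" and b: "(b, b') \<in> add_roots F p q" for a a' b b'
  proof (cases "(a, a') \<in> F \<or> (b, b') \<in> F")
    case True
    have ca: "cut_eq F a a'" "cut_eq F b b'"
      using a b cut_compatD[OF c(1)] by (auto simp: add_roots_def)
    show ?thesis using True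
    proof
      assume "(a, a') \<in> F"
      hence "sg (b - a) = sg (b' - a')" using cut_eqD[OF ca(2)] by blast
      thus ?thesis by (auto simp: sg_eq_iff)
    qed (use cut_eqD[OF ca(1)] in blast)
  next
    case False
    hence ab: "poly p a = 0" "poly q a' = 0" "cut_eq F a a'" "poly p b = 0" "poly q b' = 0" "cut_eq F b b'"
      using a b by (auto simp: add_roots_def)
    show ?thesis
    \<comment> \<open>Either a point of F separates the two roots, and its position fixes their
      order on both sides, or they share a cut and coincide.\<close>
    proof (cases "\<exists>z z'. (z, z') \<in> F \<and> sg (a - z) \<noteq> sg (b - z)")
      case True
      then obtain z z' where z: "(z, z') \<in> F" "sg (a - z) \<noteq> sg (b - z)" by blast
      have "sg (a - z) = sg (a' - z')" "sg (b - z) = sg (b' - z')"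
        using cut_eqD[OF ab(3) z(1)] cut_eqD[OF ab(6) z(1)] by auto
      thus ?thesis using z(2) by (auto simp: sg_def split: if_splits)
    next
      case False
      hence 1: "sg (a - z) = sg (b - z)" if "z \<in> fst ` F" for z using that by force
      have 2: "sg (a' - z') = sg (b' - z')" if "z' \<in> snd ` F" for z'
        using that False cut_eqD[OF ab(3)] cut_eqD[OF ab(6)] by force
      have "a = b" using root_unique_in_cut[of "fst ` F" a b p] 1 ab r1 c by blast
      moreover have "a' = b'" using root_unique_in_cut[of "snd ` F" a' b' q] 2 ab r2 c by blast
      ultimately show ?thesis by simp
    qed
  qed
  ultimately show ?thesis by (auto simp: cut_compat_def cut_eq_def)
qed

text \<open>In matching gaps p and q are both strictly increasing. If the signs at y and
  \<open>y'\<close> were opposite, p would have a root on one side of y, and the partner of that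
  root would lie on the same side of \<open>y'\<close>, against the monotonicity of q.\<close>

lemma sg_eq_of_cut_eq_add_roots:
  fixes F :: "('a::rcf \<times> 'b::rcf) set"
  assumes "ready F p q" "cut_eq (add_roots F p q) y y'" "(m, m') \<in> F" "m < y" "(M, M') \<in> F" "y < M"
    "y \<notin> fst ` F" "poly p y \<noteq> 0" "poly q y' \<noteq> 0" "poly (pderiv p) y > 0"
  shows "sg (poly p y) = sg (poly q y')"
proof -
  have c: "cut_compat F" "agrees F {(pderiv p, pderiv q)}" using assms by (simp_all add: ready_def)
  have sF: "sg (poly p z) = sg (poly q z')" if "(z, z') \<in> F" for z z'
    using assms(1) that unfolding ready_def by blast
  have r1: "\<And>x. poly (pderiv p) x = 0 \<Longrightarrow> x \<in> fst ` F" and r2: "\<And>x. poly (pderiv q) x = 0 \<Longrightarrow> x \<in> snd ` F"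
    using assms(1) unfolding ready_def by blast+
  have cF: "cut_eq F y y'" using cut_eq_mono[OF assms(2)] by (auto simp: add_roots_def)
  from neighbours[OF c(1) assms(3-7)] obtain z z' w w' where
    zw: "(z, z') \<in> F" "(w, w') \<in> F" "z < y" "y < w"
    "\<forall>v v'. (v, v') \<in> F \<longrightarrow> v < y \<longrightarrow> v \<le> z" "\<forall>v v'. (v, v') \<in> F \<longrightarrow> y < v \<longrightarrow> w \<le> v"
    by blast
  have zw': "z' < y'" "y' < w'" using cut_eq_greater[OF cF zw(1)] cut_eq_less[OF cF zw(2)] zw by auto
  have gap0: False if "(v, v') \<in> F" "z < v" "v < w" for v v'
  proof -
    have "v \<noteq> y" using that assms(7) by force
    thus False using zw(5,6) that by (metis linorder_neqE not_le)
  qed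
  have gap: False if "v \<in> fst ` F" "z < v" "v < w" for v using gap0 that by force
  have gap': False if v: "v' \<in> snd ` F" "z' < v'" "v' < w'" for v'
  proof -
    obtain v where v1: "(v, v') \<in> F" using v by force
    have "z < v" "v < w"
      using cut_eq_less[OF cut_compatD[OF c(1) zw(1)] v1] cut_eq_greater[OF cut_compatD[OF c(1) zw(2)] v1] v by auto
    thus False using gap0 v1 by blast
  qed
  have dp: "poly (pderiv p) x > 0" if "z < x" "x < w" for x
    using sg_poly_on_gap[OF r1 zw(3,4) gap that] assms(10) by (simp add: sg_eq_iff)
  have "poly (pderiv q) y' > 0"
    using agreesD[OF c(2) cF] assms(10) by (simp add: sg_eq_iff)
  hence dq: "poly (pderiv q) x > 0" if "z' < x" "x < w'" for x
    using sg_poly_on_gap[OF r2 zw' gap' that] by (simp add: sg_eq_iff)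
  have mate: "\<exists>x'. poly q x' = 0 \<and> z' < x' \<and> x' < w' \<and> (x < y \<longleftrightarrow> x' < y') \<and> (y < x \<longleftrightarrow> y' < x')"
    if x: "poly p x = 0" "z < x" "x < w" for x
  proof -
    obtain x' where x': "poly q x' = 0" "cut_eq F x x'" using ready_root_exists[OF assms(1) x(1)] by blast
    hence "(x, x') \<in> add_roots F p q" using x by (simp add: add_roots_def)
    thus ?thesis
      using x' x cut_eq_greater[OF x'(2) zw(1)] cut_eq_less[OF x'(2) zw(2)]
        cut_eq_less[OF assms(2)] cut_eq_greater[OF assms(2)] by blast
  qed
  have 1: False if pq: "poly p y > 0" "poly q y' < 0"
  proof -
    have "poly q z' < poly q y'" by (rule poly_strict_mono) (use zw' dq in auto)
    hence "poly p z < 0" using pq sF[OF zw(1)] by (simp add: sg_eq_iff)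
    then obtain x where x: "z < x" "x < y" "poly p x = 0" using poly_ivt_pos zw(3) pq(1) by blast
    then obtain x' where x': "poly q x' = 0" "z' < x'" "x' < y'" using mate[of x] zw by force
    have "poly q x' < poly q y'" by (rule poly_strict_mono) (use x' zw' dq in auto)
    thus False using x' pq by simp
  qed
  have 2: False if pq: "poly p y < 0" "poly q y' > 0"
  proof -
    have "poly q y' < poly q w'" by (rule poly_strict_mono) (use zw' dq in auto)
    hence "poly p w > 0" using pq sF[OF zw(2)] by (simp add: sg_eq_iff)
    then obtain x where x: "y < x" "x < w" "poly p x = 0" using poly_ivt_pos zw(4) pq(1) by blast
    then obtain x' where x': "poly q x' = 0" "x' < w'" "y' < x'" using mate[of x] zw by force
    have "poly q y' < poly q x'" by (rule poly_strict_mono) (use x' zw' dq in auto)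
    thus False using x' pq by simp
  qed
  show ?thesis using 1 2 assms(8,9) unfolding sg_eq_iff by (metis linorder_neqE order.asym)
qed

lemma agrees_add_roots:
  fixes F :: "('a::rcf \<times> 'b::rcf) set"
  assumes "ready F p q"
  shows "agrees (add_roots F p q) {(p, q)}"
proof -
  have sub: "F \<subseteq> add_roots F p q" by (auto simp: add_roots_def)
  have "sg (poly p y) = sg (poly q y')" if yy: "cut_eq (add_roots F p q) y y'" for y y'
  proof -
    have cF: "cut_eq F y y'" using cut_eq_mono[OF yy sub] .
    consider (1) "poly p y = 0" | (2) "poly q y' = 0" | (3) "y \<in> fst ` F"
      | (4) "poly p y \<noteq> 0" "poly q y' \<noteq> 0" "y \<notin> fst ` F" by blast
    thus ?thesis
    proof cases
      case 1
      then obtain x' where x': "poly q x' = 0" "cut_eq F y x'" using ready_root_exists[OF assms] by blast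
      hence "(y, x') \<in> add_roots F p q" using 1 by (simp add: add_roots_def)
      hence "y' = x'" using cut_eq_eq[OF yy] by blast
      thus ?thesis using 1 x' by simp
    next
      case 2
      then obtain x where x: "poly p x = 0" "cut_eq F x y'"
        using ready_root_exists[OF ready_converse[OF assms]] by auto
      hence "(x, y') \<in> add_roots F p q" using 2 by (simp add: add_roots_def)
      hence "y = x" using cut_eq_eq[OF yy] by blast
      thus ?thesis using 2 x by simp
    next
      case 3
      then obtain v where v: "(y, v) \<in> F" by force
      hence "y' = v" using cut_eq_eq[OF cF] by blast
      thus ?thesis using v assms unfolding ready_def by blast
    next
      case 4
      have "\<exists>m m'. (m, m') \<in> F \<and> (\<forall>y y'. y < m \<longrightarrow> y' < m' \<longrightarrow> sg (poly p y) = sg (poly q y'))"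
        using assms unfolding ready_def by blast
      moreover have "\<exists>m m'. (m, m') \<in> F \<and> (\<forall>y y'. y > m \<longrightarrow> y' > m' \<longrightarrow> sg (poly p y) = sg (poly q y'))"
        using assms unfolding ready_def by blast
      ultimately obtain m m' M M' where mM: "(m, m') \<in> F" "(M, M') \<in> F"
        and m: "\<forall>y y'. y < m \<longrightarrow> y' < m' \<longrightarrow> sg (poly p y) = sg (poly q y')"
        and M: "\<forall>y y'. y > M \<longrightarrow> y' > M' \<longrightarrow> sg (poly p y) = sg (poly q y')"
        by blast
      have ne: "y \<noteq> m" "y \<noteq> M" using mM 4 by force+
      consider "y < m" | "M < y" | "m < y" "y < M" using ne by force
      thus ?thesis
      proof cases
        case 1
        thus ?thesis using m cut_eq_less[OF cF mM(1)] by blast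
      next
        case 2
        thus ?thesis using M cut_eq_greater[OF cF mM(2)] by blast
      next
        case 3
        have "poly (pderiv p) y \<noteq> 0" using 4 assms unfolding ready_def by blast
        \<comment> \<open>A decreasing p is handled by negating both polynomials.\<close>
        then consider "poly (pderiv p) y > 0" | "poly (pderiv (- p)) y > 0"
          by (cases "poly (pderiv p) y" "0 :: 'a" rule: linorder_cases) (auto simp: pderiv_minus)
        thus ?thesis
        proof cases
          case 1
          thus ?thesis using sg_eq_of_cut_eq_add_roots[OF assms yy mM(1) 3(1) mM(2) 3(2)] 4 by blast
        next
          case 2
          have "sg (poly (- p) y) = sg (poly (- q) y')"
            using sg_eq_of_cut_eq_add_roots[OF ready_uminus[OF assms], of y y' m m' M M'] yy mM 3 4 2 by simp
          thus ?thesis by (simp add: sg_uminus)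
        qed
      qed
    qed
  qed
  thus ?thesis by (auto simp: agrees_def)
qed

lemma cut_compat_insert:
  assumes "cut_compat F" "cut_eq F z z'"
  shows "cut_compat (insert (z, z') F)"
proof -
  have *: "sg (w - z) = sg (w' - z')" if "(w, w') \<in> F" for w w'
    using cut_eqD[OF assms(2) that] by (auto simp: sg_eq_iff)
  show ?thesis
    using assms * unfolding cut_compat_def cut_eq_def by auto
qed

text \<open>The combinatorial core of the recursion: once the derivatives belong to L, the signs of
  p and q at the roots of L and near infinity determine all others. F is first cut down to the roots
  of L, the points where these signs are known, and then given an end point on each side.\<close>

lemma agrees_insert_of_pderiv:
  fixes F :: "('a::rcf \<times> 'b::rcf) set"
  assumes "cut_compat F" "agrees F L" "\<forall>r s. (r, s) \<in> L \<longrightarrow> r \<noteq> 0 \<and> s \<noteq> 0"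
    and "(pderiv p, pderiv q) \<in> L" "degree p = degree q" "sg (lead_coeff p) = sg (lead_coeff q)"
    and "\<And>r s z z'. (r, s) \<in> L \<Longrightarrow> (z, z') \<in> F \<Longrightarrow> poly r z = 0 \<Longrightarrow> poly s z' = 0 \<Longrightarrow>
      sg (poly p z) = sg (poly q z')"
  shows "\<exists>G. cut_compat G \<and> agrees G (insert (p, q) L)"
proof -
  define G where "G = {(z, z'). (z, z') \<in> F \<and> (\<exists>(p, q)\<in>L. poly p z = 0)}"
  note G = agrees_restrict_roots[OF assms(1-3), folded G_def]
  have sub: "G \<subseteq> F" by (auto simp: G_def)
  have fin: "finite G" using G(1) by (simp add: cut_compat_def)
  have sG: "sg (poly p z) = sg (poly q z')" if "(z, z') \<in> G" for z z'
    using G(5)[OF that] assms(7) that sub by blast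
  have p0: "p \<noteq> 0" "q \<noteq> 0" using assms(3,4) by (metis pderiv_0)+
  obtain A A' B B' where
    AB: "\<forall>x\<ge>A. sg (poly p x) = sg (lead_coeff p)" "\<forall>x\<ge>A'. sg (poly q x) = sg (lead_coeff q)"
    "\<forall>x\<le>B. sg (poly p x) = sg (lead_coeff p) * (-1) ^ degree p"
    "\<forall>x\<le>B'. sg (poly q x) = sg (lead_coeff q) * (-1) ^ degree q"
    using sg_poly_at_top sg_poly_at_bot by metis
  have ex: "\<exists>c. (\<forall>a\<in>S. a < c) \<and> (\<forall>b\<in>{}. c < b)" "\<exists>c. (\<forall>a\<in>{}. a < c) \<and> (\<forall>b\<in>S. c < b)"
    "\<exists>c. (\<forall>a\<in>S'. a < c) \<and> (\<forall>b\<in>{}. c < b)" "\<exists>c. (\<forall>a\<in>{}. a < c) \<and> (\<forall>b\<in>S'. c < b)"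
    if "finite S" "finite S'" for S :: "'a set" and S' :: "'b set"
    by (rule exists_between_finite; use that in simp)+
  obtain M where M: "A < M" "\<And>z. z \<in> fst ` G \<Longrightarrow> z < M"
    using ex(1)[of "insert A (fst ` G)" "{}"] fin by auto
  obtain M' where M': "A' < M'" "\<And>z. z \<in> snd ` G \<Longrightarrow> z < M'"
    using ex(3)[of "{}" "insert A' (snd ` G)"] fin by auto
  \<comment> \<open>m is also placed below M, because the two new points have to be ordered alike in
    both fields.\<close>
  obtain m where m: "m < B" "m < M" "\<And>z. z \<in> fst ` G \<Longrightarrow> m < z"
    using ex(2)[of "insert M (insert B (fst ` G))" "{}"] fin by auto
  obtain m' where m': "m' < B'" "m' < M'" "\<And>z. z \<in> snd ` G \<Longrightarrow> m' < z"
    using ex(4)[of "{}" "insert M' (insert B' (snd ` G))"] fin by auto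
  define H where "H = insert (m, m') (insert (M, M') G)"
  have "cut_eq G M M'" unfolding cut_eq_def using M(2) M'(2) by (force simp: sg_def)
  hence 1: "cut_compat (insert (M, M') G)" by (rule cut_compat_insert[OF G(1)])
  have "sg (m - z) = sg (m' - z')" if "(z, z') \<in> insert (M, M') G" for z z'
  proof -
    have "m < z" "m' < z'" using that m m' by force+
    thus ?thesis by (simp add: sg_def)
  qed
  hence "cut_eq (insert (M, M') G) m m'" by (simp add: cut_eq_def)
  hence cH: "cut_compat H" unfolding H_def by (rule cut_compat_insert[OF 1])
  have GH: "G \<subseteq> H" by (auto simp: H_def)
  have lc: "lead_coeff p \<noteq> 0" "lead_coeff q \<noteq> 0" using p0 by auto
  have top: "sg (poly p y) = sg (poly q y') \<and> poly p y \<noteq> 0 \<and> poly q y' \<noteq> 0" if "y \<ge> M" "y' \<ge> M'" for y y'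
  proof -
    have "y \<ge> A" "y' \<ge> A'" using that M(1) M'(1) by auto
    hence "sg (poly p y) = sg (lead_coeff p)" "sg (poly q y') = sg (lead_coeff q)" using AB by blast+
    thus ?thesis using lc assms(6) by (metis sg_0_iff)
  qed
  have bot: "sg (poly p y) = sg (poly q y') \<and> poly p y \<noteq> 0 \<and> poly q y' \<noteq> 0" if "y \<le> m" "y' \<le> m'" for y y'
  proof -
    have "y \<le> B" "y' \<le> B'" using that m(1) m'(1) by auto
    hence *: "sg (poly p y) = sg (lead_coeff p) * (-1) ^ degree p" "sg (poly q y') = sg (lead_coeff q) * (-1) ^ degree q"
      using AB by blast+
    hence "sg (poly p y) \<noteq> 0" "sg (poly q y') \<noteq> 0" using lc by simp_all
    thus ?thesis using * assms(5,6) by (metis sg_0_iff)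
  qed
  have "ready H p q"
    unfolding ready_def
  proof (intro conjI)
    show "agrees H {(pderiv p, pderiv q)}" by (rule agrees_mono[OF G(2) GH]) (use assms(4) in auto)
    show "\<forall>y. poly (pderiv p) y = 0 \<longrightarrow> y \<in> fst ` H" "\<forall>y. poly (pderiv q) y = 0 \<longrightarrow> y \<in> snd ` H"
      using G(3,4)[OF assms(4)] GH by blast+
    show "\<forall>z z'. (z, z') \<in> H \<longrightarrow> sg (poly p z) = sg (poly q z')"
      using sG top[of M M'] bot[of m m'] by (auto simp: H_def)
    show "\<exists>m m'. (m, m') \<in> H \<and> (\<forall>y y'. y < m \<longrightarrow> y' < m' \<longrightarrow>
        sg (poly p y) = sg (poly q y') \<and> poly p y \<noteq> 0 \<and> poly q y' \<noteq> 0)"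
      by (rule exI[of _ m], rule exI[of _ m'], intro conjI allI impI)
        (simp add: H_def, (use bot less_imp_le in metis)+)
    show "\<exists>M M'. (M, M') \<in> H \<and> (\<forall>y y'. y > M \<longrightarrow> y' > M' \<longrightarrow>
        sg (poly p y) = sg (poly q y') \<and> poly p y \<noteq> 0 \<and> poly q y' \<noteq> 0)"
      by (rule exI[of _ M], rule exI[of _ M'], intro conjI allI impI)
        (simp add: H_def, (use top less_imp_le in metis)+)
  qed (use cH p0 in auto)
  note r = this
  have "agrees (add_roots H p q) L"
    by (rule agrees_mono[OF G(2)]) (use GH in \<open>auto simp: add_roots_def\<close>)
  hence "agrees (add_roots H p q) (insert (p, q) L)"
    using agrees_add_roots[OF r] by (auto simp: agrees_def)
  thus ?thesis using cut_compat_add_roots[OF r] by blast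
qed

section \<open>Elimination of one variable\<close>

text \<open>Coefficient rings are sets rather than types: in the application they are the nested
  rings \<open>pfun I\<close>, whose variables disappear one after the other.\<close>

definition ring_set :: "'c::comm_ring_1 set \<Rightarrow> bool" where
  "ring_set B \<longleftrightarrow> 0 \<in> B \<and> 1 \<in> B \<and> (\<forall>a\<in>B. - a \<in> B) \<and> (\<forall>a\<in>B. \<forall>b\<in>B. a + b \<in> B \<and> a * b \<in> B)"

text \<open>Only the behaviour on B counts, so a homomorphism restricts along inclusions of
  coefficient rings without a change of the function.\<close>

definition hom_on :: "'c::comm_ring_1 set \<Rightarrow> ('c \<Rightarrow> 'a::comm_ring_1) \<Rightarrow> bool" where
  "hom_on B e \<longleftrightarrow> e 0 = 0 \<and> e 1 = 1 \<and> (\<forall>a\<in>B. \<forall>b\<in>B. e (a + b) = e a + e b \<and> e (a * b) = e a * e b)"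

definition polys_in :: "'c::comm_ring_1 set \<Rightarrow> 'c poly set" where
  "polys_in B = {P. \<forall>i. coeff P i \<in> B}"

text \<open>The library derivative asks for a coefficient ring without zero divisors, which a ring of functions is not.\<close>

definition poly_deriv :: "'c::comm_ring_1 poly \<Rightarrow> 'c poly" where
  "poly_deriv P = (\<Sum>i<degree P. monom (of_nat (Suc i) * coeff P (Suc i)) i)"

lemma coeff_poly_deriv: "coeff (poly_deriv P) i = of_nat (Suc i) * coeff P (Suc i)"
proof -
  have "coeff (poly_deriv P) i = (\<Sum>j<degree P. if j = i then of_nat (Suc j) * coeff P (Suc j) else 0)"
    by (simp add: poly_deriv_def coeff_sum)
  also have "\<dots> = (if i < degree P then of_nat (Suc i) * coeff P (Suc i) else 0)"
    by (subst sum.delta) auto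
  also have "\<dots> = of_nat (Suc i) * coeff P (Suc i)" by (auto simp: coeff_eq_0)
  finally show ?thesis .
qed

lemma degree_poly_deriv_less: "degree P > 0 \<Longrightarrow> degree (poly_deriv P) < degree P"
proof -
  assume *: "degree P > 0"
  have "degree (poly_deriv P) \<le> degree P - 1"
    by (rule degree_le) (auto simp: coeff_poly_deriv coeff_eq_0)
  thus ?thesis using * by simp
qed

context
  fixes B :: "'c::comm_ring_1 set"
  assumes B: "ring_set B"
begin

lemma ring_set_0: "0 \<in> B" and ring_set_1: "1 \<in> B" and ring_set_uminus: "a \<in> B \<Longrightarrow> - a \<in> B"
  and ring_set_add: "a \<in> B \<Longrightarrow> b \<in> B \<Longrightarrow> a + b \<in> B"
  and ring_set_mult: "a \<in> B \<Longrightarrow> b \<in> B \<Longrightarrow> a * b \<in> B"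
  using B by (auto simp: ring_set_def)

lemma ring_set_sum: "(\<And>i. i \<in> I \<Longrightarrow> f i \<in> B) \<Longrightarrow> sum f I \<in> B"
  by (induction I rule: infinite_finite_induct) (auto intro: ring_set_0 ring_set_add)

lemma ring_set_of_nat: "of_nat n \<in> B"
  by (induction n) (auto intro: ring_set_0 ring_set_1 ring_set_add)

lemma ring_set_power: "a \<in> B \<Longrightarrow> a ^ n \<in> B"
  by (induction n) (auto intro: ring_set_1 ring_set_mult)

lemma polys_in_add: "P \<in> polys_in B \<Longrightarrow> Q \<in> polys_in B \<Longrightarrow> P + Q \<in> polys_in B"
  by (auto simp: polys_in_def intro: ring_set_add)

lemma polys_in_uminus: "P \<in> polys_in B \<Longrightarrow> - P \<in> polys_in B"
  by (auto simp: polys_in_def intro: ring_set_uminus)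

lemma polys_in_diff: "P \<in> polys_in B \<Longrightarrow> Q \<in> polys_in B \<Longrightarrow> P - Q \<in> polys_in B"
  using polys_in_add[of P "- Q"] polys_in_uminus[of Q] by simp

lemma polys_in_mult: "P \<in> polys_in B \<Longrightarrow> Q \<in> polys_in B \<Longrightarrow> P * Q \<in> polys_in B"
  by (auto simp: polys_in_def coeff_mult intro!: ring_set_sum ring_set_mult)

lemma polys_in_smult: "c \<in> B \<Longrightarrow> P \<in> polys_in B \<Longrightarrow> smult c P \<in> polys_in B"
  by (auto simp: polys_in_def intro: ring_set_mult)

lemma polys_in_monom: "c \<in> B \<Longrightarrow> monom c n \<in> polys_in B"
  by (auto simp: polys_in_def ring_set_0)

lemma polys_in_poly_deriv: "P \<in> polys_in B \<Longrightarrow> poly_deriv P \<in> polys_in B"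
  by (auto simp: polys_in_def coeff_poly_deriv simp del: of_nat_Suc intro!: ring_set_mult ring_set_of_nat)

lemma polys_in_0: "0 \<in> polys_in B"
  by (auto simp: polys_in_def ring_set_0)

lemma pseudo_division:
  assumes "P \<in> polys_in B" "Q \<in> polys_in B"
  shows "\<exists>R k S. R \<in> polys_in B \<and> S \<in> polys_in B \<and>
    smult (lead_coeff Q ^ k) P = Q * S + R \<and> (R = 0 \<or> degree R < degree Q)"
proof (cases "degree Q = 0")
  case True
  then obtain c where "Q = [:c:]" by (rule degree_eq_zeroE)
  \<comment> \<open>A constant divisor, 0 included, divides its own multiple of P exactly.\<close>
  hence "smult (lead_coeff Q ^ 1) P = Q * P + 0" by simp
  thus ?thesis using assms polys_in_0 by blast
next
  case False
  define b where "b = lead_coeff Q"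
  have b: "b \<in> B" using assms by (auto simp: b_def polys_in_def)
  show ?thesis using assms(1)
  proof (induction "degree P" arbitrary: P rule: less_induct)
    case less
    show ?case
    proof (cases "degree P < degree Q")
      case True
      have "smult (lead_coeff Q ^ 0) P = Q * 0 + P" by simp
      thus ?thesis using True less.prems polys_in_0 by blast
    next
      case ge: False
      define T where "T = monom (lead_coeff P) (degree P - degree Q)"
      have T: "T \<in> polys_in B" using less.prems by (auto simp: T_def polys_in_def ring_set_0)
      define P1 where "P1 = smult b P - T * Q"
      have P1: "P1 \<in> polys_in B"
        unfolding P1_def using less.prems T assms(2) b by (intro polys_in_diff polys_in_smult polys_in_mult)
      have "degree P1 \<le> degree P - 1"
      proof (rule degree_le, intro allI impI)
        fix i assume "degree P - 1 < i"
        hence i: "degree P \<le> i" using ge False by linarith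
        show "coeff P1 i = 0"
        proof (cases "i = degree P")
          case True
          thus ?thesis using ge by (simp add: P1_def T_def coeff_monom_mult b_def)
        next
          case neq: False
          hence "degree P < i" "degree Q < i - (degree P - degree Q)" using i ge by auto
          thus ?thesis by (simp add: P1_def T_def coeff_monom_mult coeff_eq_0)
        qed
      qed
      hence "degree P1 < degree P" using ge False by linarith
      from less.hyps[OF this P1] obtain R k S where
        R: "R \<in> polys_in B" "S \<in> polys_in B" "smult (b ^ k) P1 = Q * S + R" "R = 0 \<or> degree R < degree Q"
        unfolding b_def by blast
      have "smult (b ^ Suc k) P = smult (b ^ k) P1 + smult (b ^ k) (T * Q)"
        by (simp add: P1_def smult_diff_right mult.commute)
      also have "\<dots> = Q * (S + smult (b ^ k) T) + R"
        unfolding R(3) by (simp add: algebra_simps)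
      finally have "smult (lead_coeff Q ^ Suc k) P = Q * (S + smult (b ^ k) T) + R" unfolding b_def .
      moreover have "S + smult (b ^ k) T \<in> polys_in B"
        using R T b by (intro polys_in_add polys_in_smult ring_set_power)
      ultimately show ?thesis using R by blast
    qed
  qed
qed

definition prem :: "'c poly \<Rightarrow> 'c poly \<Rightarrow> 'c poly" where
  "prem P Q = (SOME R. \<exists>k S. R \<in> polys_in B \<and> S \<in> polys_in B \<and>
    smult (lead_coeff Q ^ k) P = Q * S + R \<and> (R = 0 \<or> degree R < degree Q))"

lemma prem:
  assumes "P \<in> polys_in B" "Q \<in> polys_in B"
  shows "prem P Q \<in> polys_in B" "prem P Q = 0 \<or> degree (prem P Q) < degree Q"
    "\<exists>k S. S \<in> polys_in B \<and> smult (lead_coeff Q ^ k) P = Q * S + prem P Q"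
  using someI_ex[OF pseudo_division[OF assms], folded prem_def] by blast+

context
  fixes e :: "'c \<Rightarrow> 'a::comm_ring_1"
  assumes e: "hom_on B e"
begin

lemma hom_on_0 [simp]: "e 0 = 0" and hom_on_1 [simp]: "e 1 = 1"
  and hom_on_add: "a \<in> B \<Longrightarrow> b \<in> B \<Longrightarrow> e (a + b) = e a + e b"
  and hom_on_mult: "a \<in> B \<Longrightarrow> b \<in> B \<Longrightarrow> e (a * b) = e a * e b"
  using e by (auto simp: hom_on_def)

lemma hom_on_uminus: "a \<in> B \<Longrightarrow> e (- a) = - e a"
  using hom_on_add[of a "- a"] ring_set_uminus[of a] by (simp add: eq_neg_iff_add_eq_0 add.commute)

lemma hom_on_sum: "(\<And>i. i \<in> I \<Longrightarrow> f i \<in> B) \<Longrightarrow> e (sum f I) = (\<Sum>i\<in>I. e (f i))"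
  by (induction I rule: infinite_finite_induct) (auto simp: hom_on_add ring_set_sum)

lemma hom_on_of_nat: "e (of_nat n) = of_nat n"
  by (induction n) (auto simp: hom_on_add ring_set_1 ring_set_of_nat)

lemma hom_on_power: "a \<in> B \<Longrightarrow> e (a ^ n) = e a ^ n"
  by (induction n) (auto simp: hom_on_mult ring_set_power)

lemma coeff_map_hom: "coeff (map_poly e P) i = e (coeff P i)"
  by (rule coeff_map_poly) simp

lemma map_hom_add: "P \<in> polys_in B \<Longrightarrow> Q \<in> polys_in B \<Longrightarrow> map_poly e (P + Q) = map_poly e P + map_poly e Q"
  by (rule poly_eqI) (auto simp: coeff_map_hom hom_on_add polys_in_def)

lemma map_hom_mult: "P \<in> polys_in B \<Longrightarrow> Q \<in> polys_in B \<Longrightarrow> map_poly e (P * Q) = map_poly e P * map_poly e Q"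
  by (rule poly_eqI)
    (auto simp: coeff_map_hom coeff_mult polys_in_def hom_on_sum hom_on_mult ring_set_mult)

lemma map_hom_smult: "c \<in> B \<Longrightarrow> P \<in> polys_in B \<Longrightarrow> map_poly e (smult c P) = smult (e c) (map_poly e P)"
  by (rule poly_eqI) (auto simp: coeff_map_hom hom_on_mult polys_in_def)

lemma map_hom_poly_deriv:
  "P \<in> polys_in B \<Longrightarrow> coeff (map_poly e (poly_deriv P)) i = of_nat (Suc i) * coeff (map_poly e P) (Suc i)"
  by (auto simp: coeff_map_hom coeff_poly_deriv hom_on_mult polys_in_def ring_set_of_nat hom_on_of_nat simp del: of_nat_Suc)

lemma degree_map_hom: "e (lead_coeff P) \<noteq> 0 \<Longrightarrow> degree (map_poly e P) = degree P"
  by (rule antisym[OF map_poly_degree_leq le_degree]) (simp add: coeff_map_hom)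

lemma poly_map_const: "degree P = 0 \<Longrightarrow> poly (map_poly e P) y = e (coeff P 0)"
  by (elim degree_eq_zeroE) (simp add: map_poly_pCons)

end

end

text \<open>The termination measure is the multiset of degrees: one polynomial may be exchanged for
  any number of polynomials of smaller degree.\<close>

lemma mult_degrees_remove1:
  assumes "Q \<in> set L" "\<And>R. R \<in> set N \<Longrightarrow> degree R < degree Q"
  shows "(mset (map degree (N @ remove1 Q L)), mset (map degree L)) \<in> Multiset.mult less_than"
proof -
  have "mset L = add_mset Q (mset (remove1 Q L))" using assms(1) by simp
  hence 1: "mset (map degree L) = mset (map degree (remove1 Q L)) + {#degree Q#}"
    by (metis add_mset_add_single image_mset_add_mset mset_map)
  have 2: "mset (map degree (N @ remove1 Q L)) = mset (map degree (remove1 Q L)) + mset (map degree N)"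
    by (simp add: add.commute)
  show ?thesis unfolding 1 2 by (rule one_step_implies_mult) (use assms(2) in auto)
qed

text \<open>At a root of Q the pseudo-division identity reduces to
  \<open>b ^ k * P = prem B P Q\<close>, where b is the leading coefficient of Q. The signs of b and
  of the remainder therefore determine that of P.\<close>

lemma sg_eq_of_pseudo_remainder:
  fixes e :: "'c::comm_ring_1 \<Rightarrow> 'a::rcf" and e' :: "'c \<Rightarrow> 'b::rcf"
  assumes B: "ring_set B" and e: "hom_on B e" "hom_on B e'"
    and PQ: "P \<in> polys_in B" "Q \<in> polys_in B"
    and lc: "e (lead_coeff Q) \<noteq> 0" "sg (e (lead_coeff Q)) = sg (e' (lead_coeff Q))"
    and root: "poly (map_poly e Q) z = 0" "poly (map_poly e' Q) z' = 0"
    and rem: "sg (poly (map_poly e (prem B P Q)) z) = sg (poly (map_poly e' (prem B P Q)) z')"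
  shows "sg (poly (map_poly e P) z) = sg (poly (map_poly e' P) z')"
proof -
  define b where "b = lead_coeff Q"
  have b: "b \<in> B" using PQ by (auto simp: b_def polys_in_def)
  obtain k S where S: "S \<in> polys_in B" "smult (b ^ k) P = Q * S + prem B P Q"
    using prem(3)[OF B PQ] unfolding b_def by blast
  note R = prem(1)[OF B PQ]
  have 1: "e b ^ k * poly (map_poly e P) z = poly (map_poly e (prem B P Q)) z"
  proof -
    have "smult (e b ^ k) (map_poly e P) = map_poly e (smult (b ^ k) P)"
      using b PQ by (simp add: map_hom_smult[OF B e(1)] ring_set_power[OF B] hom_on_power[OF B e(1)])
    also have "\<dots> = map_poly e Q * map_poly e S + map_poly e (prem B P Q)"
      unfolding S(2) using S(1) PQ R
      by (simp add: map_hom_add[OF B e(1)] map_hom_mult[OF B e(1)] polys_in_mult[OF B])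
    finally have "poly (smult (e b ^ k) (map_poly e P)) z = poly (map_poly e Q * map_poly e S + map_poly e (prem B P Q)) z"
      by simp
    thus ?thesis using root by simp
  qed
  have 2: "e' b ^ k * poly (map_poly e' P) z' = poly (map_poly e' (prem B P Q)) z'"
  proof -
    have "smult (e' b ^ k) (map_poly e' P) = map_poly e' (smult (b ^ k) P)"
      using b PQ by (simp add: map_hom_smult[OF B e(2)] ring_set_power[OF B] hom_on_power[OF B e(2)])
    also have "\<dots> = map_poly e' Q * map_poly e' S + map_poly e' (prem B P Q)"
      unfolding S(2) using S(1) PQ R
      by (simp add: map_hom_add[OF B e(2)] map_hom_mult[OF B e(2)] polys_in_mult[OF B])
    finally have "poly (smult (e' b ^ k) (map_poly e' P)) z' = poly (map_poly e' Q * map_poly e' S + map_poly e' (prem B P Q)) z'"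
      by simp
    thus ?thesis using root by simp
  qed
  have "sg (e b ^ k) = sg (e' b ^ k)"
    using lc(2) by (induction k) (simp_all add: sg_mult b_def)
  moreover have "sg (e b ^ k) \<noteq> 0" using lc(1) by (simp add: b_def)
  moreover have "sg (e b ^ k) * sg (poly (map_poly e P) z) = sg (e' b ^ k) * sg (poly (map_poly e' P) z')"
    using rem unfolding 1[symmetric] 2[symmetric] by (simp add: sg_mult)
  ultimately show ?thesis by (metis mult_left_cancel)
qed

text \<open>Elimination without formulas: the signs of the elements of M decide the whole sign
  diagram of the family L. The targets of \<open>e\<close> and \<open>e'\<close> may be different
  fields.\<close>

definition diag_match ::
  "'c::comm_ring_1 set \<Rightarrow> 'c poly set \<Rightarrow> 'c set \<Rightarrow> ('c \<Rightarrow> 'a::rcf) \<Rightarrow> ('c \<Rightarrow> 'b::rcf) \<Rightarrow> bool" where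
  "diag_match B L M e e' \<longleftrightarrow> (hom_on B e \<longrightarrow> hom_on B e' \<longrightarrow> (\<forall>m\<in>M. sg (e m) = sg (e' m)) \<longrightarrow>
     (\<exists>F. cut_compat F \<and> agrees F ((\<lambda>P. (map_poly e P, map_poly e' P)) ` L)))"

text \<open>The Cohen--Hormander recursion: the sign diagram of a family is computed from that of the
  family in which a member \<open>P\<close> of maximal degree is replaced by its derivative and its
  pseudo-remainders; a vanishing leading coefficient is handled by truncation.\<close>

theorem sign_diagram_determined:
  fixes L :: "'c::comm_ring_1 poly list"
  assumes B: "ring_set B"
  shows "set L \<subseteq> polys_in B \<Longrightarrow> \<exists>M. finite M \<and> M \<subseteq> B \<and>
    (\<forall>(e :: 'c \<Rightarrow> 'a::rcf) (e' :: 'c \<Rightarrow> 'b::rcf). diag_match B (set L) M e e')"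
proof (induction L rule: wf_induct_rule[OF wf_inv_image[OF wf_mult[OF wf_less_than], of "\<lambda>L. mset (map degree L)"]])
  case (1 L)
  note IH = "1.IH" and LB = "1.prems"
  have coeffB: "coeff Q i \<in> B" if "Q \<in> set L" for Q i
    using that LB by (auto simp: polys_in_def)
  have const: "sg (poly (map_poly e Q) y) = sg (poly (map_poly e' Q) y')"
    if "hom_on B e" "hom_on B e'" "degree Q = 0" "sg (e (coeff Q 0)) = sg (e' (coeff Q 0))"
    for e :: "'c \<Rightarrow> 'a" and e' :: "'c \<Rightarrow> 'b" and Q y y'
    using that by (simp add: poly_map_const[OF B])
  show ?case
  proof (cases "\<forall>Q\<in>set L. degree Q = 0")
    case True
    define M where "M = (\<lambda>Q. coeff Q 0) ` set L"
    have "diag_match B (set L) M e e'" for e :: "'c \<Rightarrow> 'a" and e' :: "'c \<Rightarrow> 'b"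
      unfolding diag_match_def
      by (intro impI exI[of _ "{}"]) (use True const in \<open>auto simp: cut_compat_def agrees_def M_def\<close>)
    moreover have "finite M" "M \<subseteq> B" using coeffB by (auto simp: M_def)
    ultimately show ?thesis by blast
  next
    case False
    define d where "d = Max (degree ` set L)"
    have ne: "set L \<noteq> {}" using False by auto
    have "d \<in> degree ` set L" unfolding d_def using ne by (intro Max_in) auto
    then obtain P where P: "P \<in> set L" "degree P = d" by auto
    have max: "degree Q \<le> d" if "Q \<in> set L" for Q using that by (simp add: d_def)
    have d0: "d > 0" using False max by (metis gr0I le_zero_eq)
    have PB: "P \<in> polys_in B" "poly_deriv P \<in> polys_in B"
      using P LB polys_in_poly_deriv[OF B] by auto
    \<comment> \<open>Truncation by the leading term, for homomorphisms that send the leading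
      coefficient to 0.\<close>
    define tr where "tr Q = Q - monom (lead_coeff Q) (degree Q)" for Q :: "'c poly"
    have tr_deg: "degree (tr Q) < degree Q" if "degree Q > 0" for Q
    proof -
      have "degree (tr Q) \<le> degree Q - 1" by (rule degree_le) (auto simp: tr_def coeff_eq_0)
      thus ?thesis using that by simp
    qed
    have "\<exists>M. finite M \<and> M \<subseteq> B \<and>
      (\<forall>(e :: 'c \<Rightarrow> 'a) (e' :: 'c \<Rightarrow> 'b). diag_match B (set ([tr Q] @ remove1 Q L)) M e e')"
      if Q: "Q \<in> set L" "degree Q > 0" for Q
    proof (rule IH)
      show "([tr Q] @ remove1 Q L, L) \<in> inv_image (Multiset.mult less_than) (\<lambda>L. mset (map degree L))"
        unfolding in_inv_image by (rule mult_degrees_remove1) (use Q tr_deg in auto)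
      have "tr Q \<in> polys_in B"
        unfolding tr_def using Q coeffB LB by (intro polys_in_diff[OF B] polys_in_monom[OF B]) auto
      thus "set ([tr Q] @ remove1 Q L) \<subseteq> polys_in B"
        using LB set_remove1_subset[of Q L] by auto
    qed
    then obtain MT where MT: "\<And>Q. Q \<in> set L \<Longrightarrow> degree Q > 0 \<Longrightarrow> finite (MT Q) \<and> MT Q \<subseteq> B \<and>
      (\<forall>(e :: 'c \<Rightarrow> 'a) (e' :: 'c \<Rightarrow> 'b). diag_match B (set ([tr Q] @ remove1 Q L)) (MT Q) e e')"
      by metis
    \<comment> \<open>The divisors. Constant members of L are left out: their signs involve no
      roots, and \<open>agrees_insert_of_pderiv\<close> wants polynomials that stay nonzero under
      \<open>e\<close> and \<open>e'\<close>.\<close>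
    define L0 where "L0 = poly_deriv P # filter (\<lambda>Q. degree Q > 0) (remove1 P L)"
    define N where "N = poly_deriv P # map (prem B P) L0"
    have L0B: "Q \<in> polys_in B" if "Q \<in> set L0" for Q
      using that PB LB set_remove1_subset[of P L] by (auto simp: L0_def)
    have Ndeg: "degree R < d" if "R \<in> set N" for R
    proof -
      have dd: "degree (poly_deriv P) < d" using degree_poly_deriv_less[of P] P d0 by simp
      moreover have "degree (prem B P Q) < d" if Q: "Q \<in> set L0" for Q
      proof -
        have "degree Q \<le> d" using Q dd max set_remove1_subset[of P L] by (auto simp: L0_def)
        thus ?thesis using prem(2)[OF B PB(1) L0B[OF Q]] d0 by auto
      qed
      ultimately show ?thesis using that by (auto simp: N_def)
    qed
    have "\<exists>M. finite M \<and> M \<subseteq> B \<and>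
      (\<forall>(e :: 'c \<Rightarrow> 'a) (e' :: 'c \<Rightarrow> 'b). diag_match B (set (N @ remove1 P L)) M e e')"
    proof (rule IH)
      show "(N @ remove1 P L, L) \<in> inv_image (Multiset.mult less_than) (\<lambda>L. mset (map degree L))"
        unfolding in_inv_image by (rule mult_degrees_remove1) (use P Ndeg in auto)
      show "set (N @ remove1 P L) \<subseteq> polys_in B"
        using LB PB set_remove1_subset[of P L] prem(1)[OF B PB(1) L0B] by (auto simp: N_def)
    qed
    then obtain MN where MN: "finite MN" "MN \<subseteq> B"
      "\<And>(e :: 'c \<Rightarrow> 'a) (e' :: 'c \<Rightarrow> 'b). diag_match B (set (N @ remove1 P L)) MN e e'"
      by blast
    \<comment> \<open>Collected are the elements tested by each recursive call, the leading
      coefficients, which tell truncation from the generic case, and the constant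
      coefficients.\<close>
    define M where "M = MN \<union> (\<Union>Q\<in>{Q\<in>set L. degree Q > 0}. MT Q) \<union> lead_coeff ` set (poly_deriv P # L) \<union> (\<lambda>Q. coeff Q 0) ` set L"
    have "finite M" using MN MT by (auto simp: M_def)
    moreover have "M \<subseteq> B"
    proof -
      have "(\<Union>Q\<in>{Q\<in>set L. degree Q > 0}. MT Q) \<subseteq> B" using MT by blast
      moreover have "lead_coeff ` set (poly_deriv P # L) \<union> (\<lambda>Q. coeff Q 0) ` set L \<subseteq> B"
        using coeffB PB(2) by (auto simp: polys_in_def)
      ultimately show ?thesis using MN(2) unfolding M_def by blast
    qed
    moreover have "diag_match B (set L) M e e'" for e :: "'c \<Rightarrow> 'a" and e' :: "'c \<Rightarrow> 'b"
      unfolding diag_match_def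
    proof (intro impI)
      assume e: "hom_on B e" and e': "hom_on B e'" and sM: "\<forall>m\<in>M. sg (e m) = sg (e' m)"
      let ?h = "\<lambda>P. (map_poly e P, map_poly e' P)"
      have sM1: "sg (e (lead_coeff Q)) = sg (e' (lead_coeff Q))" if "Q \<in> set (poly_deriv P # L)" for Q
        using sM that unfolding M_def by blast
      have sM2: "sg (e (coeff Q 0)) = sg (e' (coeff Q 0))" if "Q \<in> set L" for Q
        using sM that unfolding M_def by blast
      have sM3: "\<forall>m\<in>MN. sg (e m) = sg (e' m)" using sM unfolding M_def by blast
      have sM4: "\<forall>m\<in>MT Q. sg (e m) = sg (e' m)" if "Q \<in> set L" "degree Q > 0" for Q
        using sM that unfolding M_def by blast
      show "\<exists>F. cut_compat F \<and> agrees F (?h ` set L)"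
      proof (cases "\<exists>Q\<in>set L. degree Q > 0 \<and> e (lead_coeff Q) = 0")
        case True
        then obtain Q where Q: "Q \<in> set L" "degree Q > 0" "e (lead_coeff Q) = 0" by blast
        have "sg (e (lead_coeff Q)) = sg (e' (lead_coeff Q))" by (rule sM1) (use Q in simp)
        hence Q': "e' (lead_coeff Q) = 0" using Q by (metis sg_0_iff)
        have tr_eq: "map_poly e (tr Q) = map_poly e Q" "map_poly e' (tr Q) = map_poly e' Q"
          using Q Q' by (auto simp: poly_eq_iff coeff_map_hom[OF B e] coeff_map_hom[OF B e'] tr_def
              hom_on_0[OF B e] hom_on_0[OF B e'])
        obtain F where F: "cut_compat F" "agrees F (?h ` set ([tr Q] @ remove1 Q L))"
          using MT[OF Q(1,2)] e e' sM4[OF Q(1,2)] unfolding diag_match_def by blast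
        have "set L \<subseteq> insert Q (set (remove1 Q L))" by (metis insert_iff in_set_remove1 subsetI)
        hence "?h ` set L \<subseteq> ?h ` set ([tr Q] @ remove1 Q L)" using tr_eq by auto
        thus ?thesis using F agrees_mono[OF F(2) order.refl] by blast
      next
        case nz: False
        obtain F where F: "cut_compat F" "agrees F (?h ` set (N @ remove1 P L))"
          using MN(3) e e' sM3 unfolding diag_match_def by blast
        have elP: "e (lead_coeff P) \<noteq> 0" using nz P d0 by auto
        \<comment> \<open>The derivative has exact degree d - 1: its candidate leading coefficient
          is mapped to a nonzero element, since the target field has characteristic 0.\<close>
        have lcd: "lead_coeff (poly_deriv P) = of_nat d * lead_coeff P \<and> e (lead_coeff (poly_deriv P)) \<noteq> 0"
        proof -
          have c: "coeff (poly_deriv P) (d - 1) = of_nat d * lead_coeff P"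
            using d0 P by (simp add: coeff_poly_deriv del: of_nat_Suc)
          have ec: "e (of_nat d * lead_coeff P) = of_nat d * e (lead_coeff P)"
            using coeffB[OF P(1)] by (simp add: hom_on_mult[OF B e] ring_set_of_nat[OF B] hom_on_of_nat[OF B e])
          hence ne: "e (of_nat d * lead_coeff P) \<noteq> 0" using elP d0 by simp
          hence "coeff (poly_deriv P) (d - 1) \<noteq> 0" unfolding c using hom_on_0[OF B e] by metis
          hence "degree (poly_deriv P) \<ge> d - 1" by (rule le_degree)
          hence "degree (poly_deriv P) = d - 1" using degree_poly_deriv_less[of P] P d0 by simp
          thus ?thesis using c ne by simp
        qed
        have L0sub: "Q = poly_deriv P \<or> Q \<in> set L \<and> degree Q > 0" if "Q \<in> set L0" for Q
          using that set_remove1_subset[of P L] by (auto simp: L0_def)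
        have L0nz1: "e (lead_coeff Q) \<noteq> 0" if "Q \<in> set L0" for Q
          using L0sub[OF that] nz lcd by blast
        have L0nz2: "sg (e (lead_coeff Q)) = sg (e' (lead_coeff Q))" if "Q \<in> set L0" for Q
          by (rule sM1) (use L0sub[OF that] in auto)
        note L0nz = L0nz1 L0nz2
        have L0nz': "e' (lead_coeff Q) \<noteq> 0" if "Q \<in> set L0" for Q using L0nz[OF that] by (metis sg_0_iff)
        have sub: "set L0 \<subseteq> set (N @ remove1 P L)" by (auto simp: L0_def N_def)
        have "\<exists>G. cut_compat G \<and> agrees G (insert (map_poly e P, map_poly e' P) (?h ` set L0))"
        proof (rule agrees_insert_of_pderiv[OF F(1)])
          show "agrees F (?h ` set L0)" by (rule agrees_mono[OF F(2)]) (use sub in auto)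
          show "\<forall>r s. (r, s) \<in> ?h ` set L0 \<longrightarrow> r \<noteq> 0 \<and> s \<noteq> 0"
          proof safe
            fix Q assume "Q \<in> set L0" "map_poly e Q = 0"
            thus False using L0nz(1) by (metis coeff_0 coeff_map_hom[OF B e])
          next
            fix Q assume "Q \<in> set L0" "map_poly e' Q = 0"
            thus False using L0nz' by (metis coeff_0 coeff_map_hom[OF B e'])
          qed
          have "pderiv (map_poly e P) = map_poly e (poly_deriv P)" "pderiv (map_poly e' P) = map_poly e' (poly_deriv P)"
            by (rule poly_eqI; simp only: coeff_pderiv map_hom_poly_deriv[OF B e PB(1)] map_hom_poly_deriv[OF B e' PB(1)])+
          thus "(pderiv (map_poly e P), pderiv (map_poly e' P)) \<in> ?h ` set L0" by (simp add: L0_def)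
          have sP: "sg (e (lead_coeff P)) = sg (e' (lead_coeff P))" by (rule sM1) (use P in simp)
          hence elP': "e' (lead_coeff P) \<noteq> 0" using elP by (metis sg_0_iff)
          note dm = degree_map_hom[OF B e elP] degree_map_hom[OF B e' elP']
          show "degree (map_poly e P) = degree (map_poly e' P)" unfolding dm ..
          show "sg (lead_coeff (map_poly e P)) = sg (lead_coeff (map_poly e' P))"
            using sP unfolding dm by (simp add: coeff_map_hom[OF B e] coeff_map_hom[OF B e'])
          fix r s z z' assume rs: "(r, s) \<in> ?h ` set L0" and z: "(z, z') \<in> F" and "poly r z = 0" "poly s z' = 0"
          then obtain Q where Q: "Q \<in> set L0" "poly (map_poly e Q) z = 0" "poly (map_poly e' Q) z' = 0" by auto
          have "sg (poly (map_poly e (prem B P Q)) z) = sg (poly (map_poly e' (prem B P Q)) z')"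
            by (rule agreesD[OF F(2) cut_compatD[OF F(1) z]]) (use Q in \<open>auto simp: N_def\<close>)
          thus "sg (poly (map_poly e P) z) = sg (poly (map_poly e' P) z')"
            using sg_eq_of_pseudo_remainder[OF B e e' PB(1) L0B[OF Q(1)] L0nz[OF Q(1)] Q(2,3)] by blast
        qed
        then obtain G where G: "cut_compat G" "agrees G (insert (?h P) (?h ` set L0))" by blast
        have "agrees G (?h ` set L)"
          unfolding agrees_def
        proof (intro allI impI)
          fix y y' r s assume y: "cut_eq G y y'" and "(r, s) \<in> ?h ` set L"
          then obtain Q where Q: "Q \<in> set L" "r = map_poly e Q" "s = map_poly e' Q" by auto
          show "sg (poly r y) = sg (poly s y')"
          proof (cases "degree Q = 0")
            case True
            have "sg (e (coeff Q 0)) = sg (e' (coeff Q 0))" by (rule sM2) (use Q in simp)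
            thus ?thesis unfolding Q using const[OF e e' True] by blast
          next
            case False
            hence "Q = P \<or> Q \<in> set L0" using Q(1) by (auto simp: L0_def)
            thus ?thesis unfolding Q by (intro agreesD[OF G(2) y]) auto
          qed
        qed
        thus ?thesis using G(1) by blast
      qed
    qed
    ultimately show ?thesis by blast
  qed
qed

section \<open>Elimination in several variables and the Artin--Lang theorem\<close>

text \<open>With functions in place of formal polynomials, evaluation at a point is a homomorphism
  by definition, and the free index type leaves room for auxiliary variables.\<close>

inductive_set pfun :: "'i set \<Rightarrow> (('i \<Rightarrow> real) \<Rightarrow> real) set" for I :: "'i set" where
  pfun_const: "(\<lambda>x. c) \<in> pfun I"
| pfun_var: "i \<in> I \<Longrightarrow> (\<lambda>x. x i) \<in> pfun I"
| pfun_add: "f \<in> pfun I \<Longrightarrow> g \<in> pfun I \<Longrightarrow> (\<lambda>x. f x + g x) \<in> pfun I"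
| pfun_mult: "f \<in> pfun I \<Longrightarrow> g \<in> pfun I \<Longrightarrow> (\<lambda>x. f x * g x) \<in> pfun I"

lemma ring_set_pfun: "ring_set (pfun I)"
proof -
  have "- f \<in> pfun I" if "f \<in> pfun I" for f
    using pfun_mult[OF pfun_const[of "-1"] that] by (simp add: fun_Compl_def)
  thus ?thesis
    unfolding ring_set_def zero_fun_def one_fun_def plus_fun_def times_fun_def
    by (auto intro: pfun.intros)
qed

lemma pfun_mono: "f \<in> pfun I \<Longrightarrow> I \<subseteq> J \<Longrightarrow> f \<in> pfun J"
  by (induction rule: pfun.induct) (auto intro: pfun.intros)

lemma pfun_cong: "f \<in> pfun I \<Longrightarrow> (\<And>i. i \<in> I \<Longrightarrow> x i = y i) \<Longrightarrow> f x = f y"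
  by (induction rule: pfun.induct) auto

lemma pfun_sum: "(\<And>a. a \<in> A \<Longrightarrow> f a \<in> pfun I) \<Longrightarrow> (\<lambda>x. \<Sum>a\<in>A. f a x) \<in> pfun I"
  by (induction A rule: infinite_finite_induct) (auto intro: pfun.intros)

lemma pfun_prod: "(\<And>a. a \<in> A \<Longrightarrow> f a \<in> pfun I) \<Longrightarrow> (\<lambda>x. \<Prod>a\<in>A. f a x) \<in> pfun I"
  by (induction A rule: infinite_finite_induct) (auto intro: pfun.intros)

lemma pfun_power: "f \<in> pfun I \<Longrightarrow> (\<lambda>x. f x ^ n) \<in> pfun I"
  by (induction n) (auto intro: pfun.intros)

lemma pfun_uminus: "f \<in> pfun I \<Longrightarrow> (\<lambda>x. - f x) \<in> pfun I"
  using pfun_mult[OF pfun_const[of "-1"], of f] by simp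

lemma pfun_diff: "f \<in> pfun I \<Longrightarrow> g \<in> pfun I \<Longrightarrow> (\<lambda>x. f x - g x) \<in> pfun I"
  using pfun_add[OF _ pfun_uminus, of f I g] by simp

lemma hom_on_ev: "hom_on (pfun I) (\<lambda>f. f x)"
  by (simp add: hom_on_def)

lemma pfun_empty: "f \<in> pfun {} \<Longrightarrow> \<exists>c. f = (\<lambda>x. c)"
  by (induction rule: pfun.induct) auto

text \<open>Functions form a commutative ring pointwise, so f can be written as the value of a
  polynomial over that ring at the coordinate function of i.\<close>

lemma pfun_insert_as_poly:
  assumes "f \<in> pfun (insert i I)"
  shows "\<exists>P\<in>polys_in (pfun I). poly P (\<lambda>x. x i) = f"
  using assms
proof (induction rule: pfun.induct)
  case (pfun_const c)
  have "[:\<lambda>x. c:] \<in> polys_in (pfun I)"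
    using ring_set_0[OF ring_set_pfun[of I]] by (auto simp: polys_in_def coeff_pCons pfun.intros split: nat.split)
  thus ?case by (rule rev_bexI) simp
next
  case (pfun_var j)
  show ?case
  proof (cases "j = i")
    case True
    have "[:0, 1:] \<in> polys_in (pfun I)"
      using ring_set_0[OF ring_set_pfun[of I]] ring_set_1[OF ring_set_pfun[of I]]
      by (auto simp: polys_in_def coeff_pCons split: nat.split)
    thus ?thesis by (rule rev_bexI) (simp add: True)
  next
    case False
    hence "[:\<lambda>x. x j:] \<in> polys_in (pfun I)"
      using ring_set_0[OF ring_set_pfun[of I]] pfun_var by (auto simp: polys_in_def coeff_pCons pfun.intros split: nat.split)
    thus ?thesis by (rule rev_bexI) simp
  qed
next
  case (pfun_add f g)
  then obtain P Q where PQ: "P \<in> polys_in (pfun I)" "Q \<in> polys_in (pfun I)" "poly P (\<lambda>x. x i) = f" "poly Q (\<lambda>x. x i) = g"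
    by blast
  show ?case
    by (rule rev_bexI[OF polys_in_add[OF ring_set_pfun PQ(1,2)]]) (simp add: PQ(3,4) plus_fun_def)
next
  case (pfun_mult f g)
  then obtain P Q where PQ: "P \<in> polys_in (pfun I)" "Q \<in> polys_in (pfun I)" "poly P (\<lambda>x. x i) = f" "poly Q (\<lambda>x. x i) = g"
    by blast
  show ?case
    by (rule rev_bexI[OF polys_in_mult[OF ring_set_pfun PQ(1,2)]]) (simp add: PQ(3,4) times_fun_def)
qed

lemma hom_poly:
  assumes B: "ring_set B" and e: "hom_on B e" and "a \<in> B" "P \<in> polys_in B"
  shows "poly P a \<in> B \<and> e (poly P a) = poly (map_poly e P) (e a)"
  using assms(4)
proof (induction P)
  case 0
  thus ?case using ring_set_0[OF B] hom_on_0[OF B e] by simp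
next
  case (pCons c P)
  have "c \<in> B" "P \<in> polys_in B"
  proof -
    have *: "coeff (pCons c P) n \<in> B" for n using pCons.prems unfolding polys_in_def by simp
    show "c \<in> B" using *[of 0] by simp
    show "P \<in> polys_in B" unfolding polys_in_def using *[of "Suc _"] by simp
  qed
  thus ?case
    using pCons.IH assms(3) ring_set_add[OF B] ring_set_mult[OF B]
    by (simp add: map_poly_pCons hom_on_0[OF B e] hom_on_add[OF B e] hom_on_mult[OF B e])
qed

lemma hom_on_subset: "hom_on B e \<Longrightarrow> A \<subseteq> B \<Longrightarrow> hom_on A e"
  unfolding hom_on_def by blast

lemma polys_in_mono: "P \<in> polys_in A \<Longrightarrow> A \<subseteq> B \<Longrightarrow> P \<in> polys_in B"
  unfolding polys_in_def by blast

text \<open>Evaluation at x serves as the second homomorphism on \<open>pfun I\<close>. Once the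
  sign diagrams match, t is placed in the cut that corresponds to the image of the variable i under
  e.\<close>

lemma eliminate_variable:
  fixes L :: "(('i \<Rightarrow> real) \<Rightarrow> real) set"
  assumes "finite L" "L \<subseteq> pfun (insert i I)" "i \<notin> I"
  shows "\<exists>M. finite M \<and> M \<subseteq> pfun I \<and> (\<forall>(e :: (('i \<Rightarrow> real) \<Rightarrow> real) \<Rightarrow> 'a::rcf) x.
    hom_on (pfun (insert i I)) e \<longrightarrow> (\<forall>m\<in>M. sg (e m) = sg (m x)) \<longrightarrow>
    (\<exists>t. \<forall>l\<in>L. sg (e l) = sg (l (x(i := t)))))"
proof -
  obtain P where P: "\<And>l. l \<in> L \<Longrightarrow> P l \<in> polys_in (pfun I)" "\<And>l. l \<in> L \<Longrightarrow> poly (P l) (\<lambda>x. x i) = l"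
  proof -
    have "\<forall>l\<in>L. \<exists>P. P \<in> polys_in (pfun I) \<and> poly P (\<lambda>x. x i) = l"
      using pfun_insert_as_poly[of _ i I] assms(2) by blast
    from bchoice[OF this] that show ?thesis by blast
  qed
  obtain ls where ls: "set ls = L" using assms(1) finite_list by blast
  have "set (map P ls) \<subseteq> polys_in (pfun I)" using P ls by auto
  from sign_diagram_determined[OF ring_set_pfun this, where 'a = 'a and 'b = real]
  obtain M where M: "finite M" "M \<subseteq> pfun I"
    "\<And>(e :: (('i \<Rightarrow> real) \<Rightarrow> real) \<Rightarrow> 'a) (e' :: (('i \<Rightarrow> real) \<Rightarrow> real) \<Rightarrow> real). diag_match (pfun I) (P ` L) M e e'"
    using ls by auto
  have "\<exists>t. \<forall>l\<in>L. sg (e l) = sg (l (x(i := t)))"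
    if e: "hom_on (pfun (insert i I)) e" and m: "\<forall>m\<in>M. sg (e m) = sg (m x)"
    for e :: "(('i \<Rightarrow> real) \<Rightarrow> real) \<Rightarrow> 'a" and x
  proof -
    have sub: "pfun I \<subseteq> pfun (insert i I)" using pfun_mono by blast
    have "\<exists>F. cut_compat F \<and> agrees F ((\<lambda>P. (map_poly e P, map_poly (\<lambda>f. f x) P)) ` P ` L)"
      using M(3)[of e "\<lambda>f. f x"] hom_on_subset[OF e sub] hom_on_ev m unfolding diag_match_def by blast
    then obtain F where F: "cut_compat F" "agrees F ((\<lambda>P. (map_poly e P, map_poly (\<lambda>f. f x) P)) ` P ` L)"
      by blast
    obtain t where t: "cut_eq F (e (\<lambda>x. x i)) t" using cut_eq_exists[OF F(1)] by blast
    have "sg (e l) = sg (l (x(i := t)))" if l: "l \<in> L" for l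
    proof -
      have s: "sg (poly (map_poly e (P l)) (e (\<lambda>x. x i))) = sg (poly (map_poly (\<lambda>f. f x) (P l)) t)"
        by (rule agreesD[OF F(2) t]) (use l in auto)
      have Pl: "P l \<in> polys_in (pfun (insert i I))" using polys_in_mono[OF P(1)[OF l] sub] .
      have xi: "(\<lambda>x. x i) \<in> pfun (insert i I)" by (rule pfun_var) simp
      \<comment> \<open>The coefficients do not involve the variable i, so the change of x at i
        leaves them alone.\<close>
      have "map_poly (\<lambda>f. f x) (P l) = map_poly (\<lambda>f. f (x(i := t))) (P l)"
      proof (rule poly_eqI)
        fix k
        have "coeff (P l) k \<in> pfun I" using P(1)[OF l] by (simp add: polys_in_def)
        hence "coeff (P l) k x = coeff (P l) k (x(i := t))"
          by (rule pfun_cong) (use assms(3) in auto)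
        thus "coeff (map_poly (\<lambda>f. f x) (P l)) k = coeff (map_poly (\<lambda>f. f (x(i := t))) (P l)) k"
          by (simp add: coeff_map_poly)
      qed
      moreover have "poly (P l) (\<lambda>x. x i) (x(i := t)) = poly (map_poly (\<lambda>f. f (x(i := t))) (P l)) t"
        using hom_poly[OF ring_set_pfun hom_on_ev xi Pl, of "x(i := t)"] by simp
      ultimately have "poly (map_poly (\<lambda>f. f x) (P l)) t = l (x(i := t))" using P(2)[OF l] by simp
      moreover have "poly (map_poly e (P l)) (e (\<lambda>x. x i)) = e l"
        using hom_poly[OF ring_set_pfun e xi Pl] P(2)[OF l] by simp
      ultimately show ?thesis using s by simp
    qed
    thus ?thesis by blast
  qed
  thus ?thesis using M(1,2) by blast
qed

theorem eliminate_variables: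
  fixes L :: "(('i \<Rightarrow> real) \<Rightarrow> real) set"
  assumes "finite J"
  shows "J \<inter> I = {} \<Longrightarrow> finite L \<Longrightarrow> L \<subseteq> pfun (I \<union> J) \<Longrightarrow>
    \<exists>M. finite M \<and> M \<subseteq> pfun I \<and> (\<forall>(e :: (('i \<Rightarrow> real) \<Rightarrow> real) \<Rightarrow> 'a::rcf) x.
      hom_on (pfun (I \<union> J)) e \<longrightarrow> (\<forall>m\<in>M. sg (e m) = sg (m x)) \<longrightarrow>
      (\<exists>z. (\<forall>i. i \<notin> J \<longrightarrow> z i = x i) \<and> (\<forall>l\<in>L. sg (e l) = sg (l z))))"
  using assms
proof (induction J arbitrary: L rule: finite_induct)
  case empty
  show ?case by (rule exI[of _ L]) (use empty.prems in auto)
next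
  case (insert j J)
  have eq: "I \<union> insert j J = insert j (I \<union> J)" by auto
  have j: "j \<notin> I \<union> J" using insert by auto
  obtain M where M: "finite M" "M \<subseteq> pfun (I \<union> J)" "\<And>(e :: (('i \<Rightarrow> real) \<Rightarrow> real) \<Rightarrow> 'a) x.
    hom_on (pfun (insert j (I \<union> J))) e \<Longrightarrow> (\<forall>m\<in>M. sg (e m) = sg (m x)) \<Longrightarrow>
    (\<exists>t. \<forall>l\<in>L. sg (e l) = sg (l (x(j := t))))"
    using eliminate_variable[OF insert.prems(2) insert.prems(3)[unfolded eq] j, where 'a = 'a] by blast
  have "J \<inter> I = {}" using insert.prems by auto
  from insert.IH[OF this M(1,2)] obtain N where N: "finite N" "N \<subseteq> pfun I"
    "\<And>(e :: (('i \<Rightarrow> real) \<Rightarrow> real) \<Rightarrow> 'a) x. hom_on (pfun (I \<union> J)) e \<Longrightarrow> (\<forall>m\<in>N. sg (e m) = sg (m x)) \<Longrightarrow>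
      (\<exists>z. (\<forall>i. i \<notin> J \<longrightarrow> z i = x i) \<and> (\<forall>l\<in>M. sg (e l) = sg (l z)))"
    by blast
  have "\<exists>z. (\<forall>i. i \<notin> insert j J \<longrightarrow> z i = x i) \<and> (\<forall>l\<in>L. sg (e l) = sg (l z))"
    if e: "hom_on (pfun (I \<union> insert j J)) e" and m: "\<forall>m\<in>N. sg (e m) = sg (m x)"
    for e :: "(('i \<Rightarrow> real) \<Rightarrow> real) \<Rightarrow> 'a" and x
  proof -
    have "hom_on (pfun (I \<union> J)) e" by (rule hom_on_subset[OF e]) (auto intro: pfun_mono)
    from N(3)[OF this m] obtain z where z: "\<And>i. i \<notin> J \<Longrightarrow> z i = x i" "\<forall>l\<in>M. sg (e l) = sg (l z)" by blast
    from M(3)[OF e[unfolded eq] z(2)] obtain t where t: "\<forall>l\<in>L. sg (e l) = sg (l (z(j := t)))" by blast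
    show ?thesis by (rule exI[of _ "z(j := t)"]) (use z(1) t in auto)
  qed
  thus ?case using N(1,2) by blast
qed

text \<open>Positive reals are squares of reals, and a homomorphism sends squares to nonnegative
  elements.\<close>

lemma sg_hom_const:
  fixes e :: "(('i \<Rightarrow> real) \<Rightarrow> real) \<Rightarrow> 'a::rcf"
  assumes e: "hom_on (pfun I) e"
  shows "sg (e (\<lambda>x. c)) = sg c"
proof -
  have m: "e (\<lambda>x. a * b) = e (\<lambda>x. a) * e (\<lambda>x. b)" for a b
    using hom_on_mult[OF ring_set_pfun e pfun_const[of a] pfun_const[of b]] by (simp add: times_fun_def)
  have pos: "e (\<lambda>x. a) > 0" if "a > 0" for a
  proof -
    have "e (\<lambda>x. a) = e (\<lambda>x. sqrt a) * e (\<lambda>x. sqrt a)" using m[of "sqrt a" "sqrt a"] that by simp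
    hence "e (\<lambda>x. a) \<ge> 0" by simp
    moreover have "e (\<lambda>x. a) * e (\<lambda>x. 1 / a) = 1"
      using m[of a "1 / a"] that hom_on_1[OF ring_set_pfun e] by (simp add: one_fun_def)
    hence "e (\<lambda>x. a) \<noteq> 0" by auto
    ultimately show ?thesis by simp
  qed
  have neg: "e (\<lambda>x. - a) = - e (\<lambda>x. a)" for a
    using hom_on_uminus[OF ring_set_pfun e pfun_const[of a]] by (simp add: fun_Compl_def)
  show ?thesis
    using pos[of c] pos[of "- c"] neg[of c] hom_on_0[OF ring_set_pfun e]
    by (cases c "0 :: real" rule: linorder_cases) (auto simp: sg_def zero_fun_def)
qed

text \<open>Eliminating all variables leaves conditions on real constants, and these hold because
  homomorphisms preserve the signs of constants.\<close>

theorem artin_lang: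
  fixes e :: "(('i::finite \<Rightarrow> real) \<Rightarrow> real) \<Rightarrow> 'a::rcf"
  assumes e: "hom_on (pfun UNIV) e" and "finite L" "L \<subseteq> pfun UNIV"
  shows "\<exists>x. \<forall>l\<in>L. sg (e l) = sg (l x)"
proof -
  have "\<exists>M. finite M \<and> M \<subseteq> pfun {} \<and> (\<forall>(e :: (('i \<Rightarrow> real) \<Rightarrow> real) \<Rightarrow> 'a) x.
      hom_on (pfun ({} \<union> UNIV)) e \<longrightarrow> (\<forall>m\<in>M. sg (e m) = sg (m x)) \<longrightarrow>
      (\<exists>z. (\<forall>i. i \<notin> UNIV \<longrightarrow> z i = x i) \<and> (\<forall>l\<in>L. sg (e l) = sg (l z))))"
    by (rule eliminate_variables) (use assms(2,3) in auto)
  then obtain M where M: "M \<subseteq> pfun {}" "\<forall>(e :: (('i \<Rightarrow> real) \<Rightarrow> real) \<Rightarrow> 'a) x.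
      hom_on (pfun ({} \<union> UNIV)) e \<longrightarrow> (\<forall>m\<in>M. sg (e m) = sg (m x)) \<longrightarrow>
      (\<exists>z. (\<forall>i. i \<notin> UNIV \<longrightarrow> z i = x i) \<and> (\<forall>l\<in>L. sg (e l) = sg (l z)))"
    by (elim exE conjE)
  have "\<forall>m\<in>M. sg (e m) = sg (m (\<lambda>_. 0))"
  proof
    fix m assume "m \<in> M"
    then obtain c where "m = (\<lambda>x. c)" using M(1) pfun_empty by blast
    thus "sg (e m) = sg (m (\<lambda>_. 0))" using sg_hom_const[OF e] by simp
  qed
  thus ?thesis using M(2)[rule_format, of e "\<lambda>_. 0"] e by auto
qed

section \<open>The Lojasiewicz inequality for continuous rational functions\<close>

lemma poly_fun_imp_pfun:
  assumes "poly_fun p"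
  shows "(\<lambda>z. p (\<chi> i. z i)) \<in> pfun UNIV"
proof -
  obtain S c where p: "p = (\<lambda>x. \<Sum>\<alpha>\<in>S. c \<alpha> * (\<Prod>i\<in>UNIV. (x $ i) ^ (\<alpha> i :: nat)))"
    using assms by (auto simp: poly_fun_def)
  show ?thesis
    unfolding p by (simp, intro pfun_sum pfun_mult[OF pfun_const] pfun_prod pfun_power pfun_var) simp
qed

lemma pfun_reindex: "f \<in> pfun I \<Longrightarrow> (\<lambda>z. f (\<lambda>i. z (h i))) \<in> pfun (h ` I)"
  by (induction rule: pfun.induct) (auto intro: pfun.intros)

lemma sum_fun_apply: "(sum f A) x = (\<Sum>a\<in>A. f a x)"
  for f :: "'b \<Rightarrow> 'a \<Rightarrow> 'c::comm_monoid_add"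
  by (induction A rule: infinite_finite_induct) auto

lemma power_fun_apply: "(f ^ n) x = (f x) ^ n"
  for f :: "'a \<Rightarrow> 'c::monoid_mult"
  by (induction n) auto

lemma pfun_insert_expand:
  assumes "f \<in> pfun (insert i I)"
  shows "\<exists>D c. (\<forall>k. c k \<in> pfun I) \<and> (\<forall>z. f z = (\<Sum>k\<le>(D::nat). c k z * z i ^ k))"
proof -
  obtain P where P: "P \<in> polys_in (pfun I)" "poly P (\<lambda>x. x i) = f"
    using pfun_insert_as_poly[OF assms] by blast
  have "f z = (\<Sum>k\<le>degree P. coeff P k z * z i ^ k)" for z
    unfolding P(2)[symmetric] poly_altdef by (simp add: sum_fun_apply power_fun_apply)
  thus ?thesis using P(1) by (auto simp: polys_in_def)
qed

text \<open>The order of C at 0 is at most its degree. An exponent E that bounds the degree thus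
  serves for all choices of the coefficients, and only the two constants depend on them.\<close>

lemma poly_lower_bound_at_0:
  fixes C :: "real poly"
  assumes "C \<noteq> 0" "degree C \<le> E"
  shows "\<exists>\<delta>>0. \<exists>\<kappa>>0. \<forall>y. 0 < y \<longrightarrow> y < \<delta> \<longrightarrow> \<kappa> * y ^ E \<le> \<bar>poly C y\<bar>"
proof -
  obtain Q where Q: "C = [:- 0, 1:] ^ Polynomial.order 0 C * Q" "\<not> [:- 0, 1:] dvd Q"
    using order_decomp[OF assms(1)] by blast
  have Q0: "poly Q 0 \<noteq> 0" using Q(2) poly_eq_0_iff_dvd by blast
  have i: "Polynomial.order 0 C \<le> E" using order_degree[OF assms(1)] assms(2) by (rule order.trans)
  have "isCont (poly Q) 0" by simp
  hence "\<exists>d>0. \<forall>y. dist y 0 < d \<longrightarrow> dist (poly Q y) (poly Q 0) < \<bar>poly Q 0\<bar> / 2"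
    unfolding continuous_at_eps_delta using Q0 by (metis half_gt_zero zero_less_abs_iff)
  then obtain d where d: "d > 0" "\<And>y. \<bar>y\<bar> < d \<Longrightarrow> \<bar>poly Q y - poly Q 0\<bar> < \<bar>poly Q 0\<bar> / 2"
    by (auto simp: dist_real_def)
  have "\<bar>poly Q 0\<bar> / 2 * y ^ E \<le> \<bar>poly C y\<bar>" if y: "0 < y" "y < min d 1" for y
  proof -
    have 1: "poly C y = y ^ Polynomial.order 0 C * poly Q y"
      by (subst Q(1)) (simp add: poly_monom)
    have "\<bar>poly Q 0\<bar> / 2 \<le> \<bar>poly Q y\<bar>" using d(2)[of y] y by linarith
    moreover have "y ^ E \<le> y ^ Polynomial.order 0 C" using y i by (intro power_decreasing) auto
    ultimately have "\<bar>poly Q 0\<bar> / 2 * y ^ E \<le> \<bar>poly Q y\<bar> * y ^ Polynomial.order 0 C"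
      using y by (intro mult_mono) auto
    thus ?thesis using y unfolding 1 by (simp add: abs_mult mult.commute)
  qed
  moreover have "min d 1 > 0" "\<bar>poly Q 0\<bar> / 2 > 0" using d Q0 by auto
  ultimately show ?thesis by blast
qed

text \<open>A lower bound for small positive roots: the term of index j must be balanced by D
  others, each of size at most \<open>K * s ^ Suc j\<close>.\<close>

lemma pos_root_lower_bound:
  fixes a :: "nat \<Rightarrow> real"
  assumes "0 < s" "s \<le> 1" "(\<Sum>k\<le>D. a k * s ^ k) = 0" "\<And>k. k \<le> D \<Longrightarrow> \<bar>a k\<bar> \<le> K"
    "j \<le> D" "\<And>k. k < j \<Longrightarrow> a k = 0"
  shows "\<bar>a j\<bar> \<le> s * (real D * K)"
proof -
  have K: "0 \<le> K" using assms(4)[of 0] by simp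
  have "(\<Sum>k\<le>D. a k * s ^ k) = (\<Sum>k\<in>{..D} - {j}. a k * s ^ k) + a j * s ^ j"
    using assms(5) by (subst sum.remove[of _ j]) auto
  hence "a j * s ^ j = - (\<Sum>k\<in>{..D} - {j}. a k * s ^ k)" using assms(3) by linarith
  hence "\<bar>a j * s ^ j\<bar> = \<bar>\<Sum>k\<in>{..D} - {j}. a k * s ^ k\<bar>" by simp
  hence "\<bar>a j\<bar> * s ^ j = \<bar>\<Sum>k\<in>{..D} - {j}. a k * s ^ k\<bar>" using assms(1) by (simp add: abs_mult)
  also have "\<dots> \<le> (\<Sum>k\<in>{..D} - {j}. K * s ^ Suc j)"
  proof (rule order.trans[OF sum_abs sum_mono])
    fix k assume k: "k \<in> {..D} - {j}"
    show "\<bar>a k * s ^ k\<bar> \<le> K * s ^ Suc j"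
    proof (cases "k < j")
      case True
      thus ?thesis using assms(1,6) K by simp
    next
      case False
      hence "s ^ k \<le> s ^ Suc j" using k assms(1,2) by (intro power_decreasing) auto
      thus ?thesis using assms(1) assms(4)[of k] k K by (simp add: abs_mult mult_mono)
    qed
  qed
  also have "\<dots> = real D * (K * s ^ Suc j)" using assms(5) by simp
  also have "\<dots> = s * (real D * K) * s ^ j" by (simp add: mult_ac)
  finally show ?thesis using assms(1) by simp
qed

lemma abs_poly_le:
  fixes C :: "real poly"
  assumes "\<bar>y\<bar> \<le> 1"
  shows "\<bar>poly C y\<bar> \<le> (\<Sum>i\<le>degree C. \<bar>coeff C i\<bar>)"
  unfolding poly_altdef
proof (rule order.trans[OF sum_abs sum_mono])
  fix i
  have "\<bar>y\<bar> ^ i \<le> 1" using assms by (simp add: power_le_one)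
  thus "\<bar>coeff C i * y ^ i\<bar> \<le> \<bar>coeff C i\<bar>" by (simp add: abs_mult power_abs mult_left_le)
qed

text \<open>Choosing \<open>E\<close> before \<open>r\<close> is what gives one Lojasiewicz exponent for the whole space instead of one
  for each ball.\<close>

lemma root_growth:
  assumes m: "m \<in> pfun {i, j, k}" and ne: "i \<noteq> j" "i \<noteq> k" "j \<noteq> k"
  shows "\<exists>E. \<forall>r. \<exists>\<delta>>0. \<exists>\<kappa>>0. \<forall>z. z i = r \<longrightarrow> 0 < z j \<longrightarrow> z j < \<delta> \<longrightarrow> 0 < z k \<longrightarrow> z k \<le> 1 \<longrightarrow>
    m z = 0 \<longrightarrow> (\<exists>t. m (z(k := t)) \<noteq> 0) \<longrightarrow> \<kappa> * z j ^ E \<le> z k"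
proof -
  have "{i, j, k} = insert k {i, j}" by auto
  then obtain D c where c: "\<And>l. c l \<in> pfun {i, j}" "\<And>z. m z = (\<Sum>l\<le>(D::nat). c l z * z k ^ l)"
    using pfun_insert_expand[of m k "{i, j}"] m by auto
  have "{i, j} = insert j {i}" by auto
  hence "\<forall>l. \<exists>D b. (\<forall>k. b k \<in> pfun {i}) \<and> (\<forall>z. c l z = (\<Sum>k\<le>(D::nat). b k z * z j ^ k))"
    using pfun_insert_expand[of _ j "{i}"] c(1) by auto
  then obtain D' b where b: "\<And>l k. b l k \<in> pfun {i}" "\<And>l z. c l z = (\<Sum>k\<le>(D' l::nat). b l k z * z j ^ k)"
    by metis
  define E where "E = Max (D' ` {..D})"
  have DE: "D' l \<le> E" if "l \<le> D" for l using that by (simp add: E_def)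
  show ?thesis
  proof (rule exI[of _ E], rule allI)
    fix r
    \<comment> \<open>The coefficients of m with respect to the variable k, with the variable i
      frozen at r. Their degrees in the variable j are bounded by E for every r.\<close>
    define C where "C l = (\<Sum>k\<le>D' l. monom (b l k (\<lambda>_. r)) k)" for l
    have C: "c l z = poly (C l) (z j)" if "z i = r" for l z
    proof -
      have "b l k z = b l k (\<lambda>_. r)" for k by (rule pfun_cong[OF b(1)]) (use that in auto)
      thus ?thesis by (simp add: C_def b(2) poly_sum poly_monom)
    qed
    have degC: "degree (C l) \<le> E" if "l \<le> D" for l
      unfolding C_def
      by (rule degree_sum_le) (use DE[OF that] in \<open>auto intro: order.trans[OF degree_monom_le]\<close>)
    have "\<forall>l. \<exists>\<delta> \<kappa>. l \<le> D \<longrightarrow> C l \<noteq> 0 \<longrightarrow> \<delta> > 0 \<and> \<kappa> > 0 \<and> (\<forall>y. 0 < y \<longrightarrow> y < \<delta> \<longrightarrow> \<kappa> * y ^ E \<le> \<bar>poly (C l) y\<bar>)"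
      using poly_lower_bound_at_0 degC by blast
    then obtain \<delta> \<kappa> where dk: "\<And>l. l \<le> D \<Longrightarrow> C l \<noteq> 0 \<Longrightarrow> \<delta> l > 0 \<and> \<kappa> l > 0 \<and>
      (\<forall>y. 0 < y \<longrightarrow> y < \<delta> l \<longrightarrow> \<kappa> l * y ^ E \<le> \<bar>poly (C l) y\<bar>)"
      by metis
    define S where "S = {l. l \<le> D \<and> C l \<noteq> 0}"
    have S: "finite S" by (simp add: S_def)
    define \<delta>' where "\<delta>' = Min (insert 1 (\<delta> ` S))"
    define \<kappa>' where "\<kappa>' = Min (insert 1 (\<kappa> ` S))"
    define K where "K = 1 + (\<Sum>l\<le>D. \<Sum>i\<le>degree (C l). \<bar>coeff (C l) i\<bar>)"
    have pos: "\<delta>' > 0" "\<kappa>' > 0" using S dk by (auto simp: \<delta>'_def \<kappa>'_def S_def)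
    have le: "\<delta>' \<le> \<delta> l" "\<kappa>' \<le> \<kappa> l" if "l \<in> S" for l
      using S that by (auto simp: \<delta>'_def \<kappa>'_def)
    have d1: "\<delta>' \<le> 1" using S by (auto simp: \<delta>'_def)
    have K: "\<bar>poly (C l) y\<bar> \<le> K" if "l \<le> D" "\<bar>y\<bar> \<le> 1" for l y
    proof -
      have "\<bar>poly (C l) y\<bar> \<le> (\<Sum>i\<le>degree (C l). \<bar>coeff (C l) i\<bar>)" by (rule abs_poly_le[OF that(2)])
      also have "\<dots> \<le> (\<Sum>l\<le>D. \<Sum>i\<le>degree (C l). \<bar>coeff (C l) i\<bar>)"
        using that(1) by (intro member_le_sum) (auto intro: sum_nonneg)
      finally show ?thesis by (simp add: K_def)
    qed
    have K0: "K > 0" unfolding K_def by (intro add_pos_nonneg sum_nonneg) auto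
    \<comment> \<open>\<open>Suc D\<close> keeps the denominator positive when D is 0.\<close>
    have "\<kappa>' / (real (Suc D) * K) * z j ^ E \<le> z k"
      if z: "z i = r" "0 < z j" "z j < \<delta>'" "0 < z k" "z k \<le> 1" "m z = 0" "\<exists>t. m (z(k := t)) \<noteq> 0" for z
    proof -
      define a where "a l = poly (C l) (z j)" for l
      have m: "m (z(k := t)) = (\<Sum>l\<le>D. a l * t ^ l)" for t
        using C[of "z(k := t)"] z(1) ne by (simp add: c(2) a_def)
      have ex: "\<exists>l\<le>D. a l \<noteq> 0"
      proof (rule ccontr)
        assume "\<not> ?thesis"
        hence "m (z(k := t)) = 0" for t unfolding m by (intro sum.neutral) auto
        thus False using z(7) by blast
      qed
      \<comment> \<open>The first coefficient that does not vanish at \<open>z j\<close>; it exists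
        because m is not identically 0 along the variable k.\<close>
      define l where "l = (LEAST l. a l \<noteq> 0)"
      obtain l0 where l0: "l0 \<le> D" "a l0 \<noteq> 0" using ex by blast
      have l: "a l \<noteq> 0" "\<And>k. k < l \<Longrightarrow> a k = 0" "l \<le> D"
        using LeastI[of "\<lambda>l. a l \<noteq> 0", OF l0(2)] not_less_Least[of _ "\<lambda>l. a l \<noteq> 0"]
          Least_le[of "\<lambda>l. a l \<noteq> 0", OF l0(2)] l0(1)
        unfolding l_def by (blast, blast, linarith)
      hence lS: "l \<in> S" by (auto simp: S_def a_def)
      have "\<bar>a l\<bar> \<le> z k * (real D * K)"
      proof (rule pos_root_lower_bound)
        show "(\<Sum>l\<le>D. a l * z k ^ l) = 0" using m[of "z k"] z(6) by simp
        show "\<bar>a l\<bar> \<le> K" if "l \<le> D" for l unfolding a_def using K[OF that] z(2,3) d1 by simp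
      qed (use z l in auto)
      also have "\<dots> \<le> z k * (real (Suc D) * K)" using z K0 by (simp add: mult_left_mono)
      finally have 1: "\<bar>a l\<bar> \<le> z k * (real (Suc D) * K)" .
      have "\<kappa>' * z j ^ E \<le> \<kappa> l * z j ^ E" using le[OF lS] z by (simp add: mult_right_mono)
      also have "\<dots> \<le> \<bar>a l\<bar>" using dk[of l] lS le[OF lS] z(2,3) by (auto simp: S_def a_def)
      finally have "\<kappa>' * z j ^ E \<le> z k * (real (Suc D) * K)" using 1 by simp
      thus ?thesis using K0 by (simp add: divide_simps del: of_nat_Suc)
    qed
    moreover have "\<kappa>' / (real (Suc D) * K) > 0" using pos K0 by simp
    ultimately show "\<exists>\<delta>>0. \<exists>\<kappa>>0. \<forall>z. z i = r \<longrightarrow> 0 < z j \<longrightarrow> z j < \<delta> \<longrightarrow> 0 < z k \<longrightarrow> z k \<le> 1 \<longrightarrow>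
      m z = 0 \<longrightarrow> (\<exists>t. m (z(k := t)) \<noteq> 0) \<longrightarrow> \<kappa> * z j ^ E \<le> z k"
      using pos by blast
  qed
qed

lemma root_growth_finite:
  assumes "finite M" "M \<subseteq> pfun {i, j, k}" and ne: "i \<noteq> j" "i \<noteq> k" "j \<noteq> k"
  shows "\<exists>E. \<forall>r. \<exists>\<delta>>0. \<exists>\<kappa>>0. \<forall>z. z i = r \<longrightarrow> 0 < z j \<longrightarrow> z j < \<delta> \<longrightarrow> 0 < z k \<longrightarrow> z k \<le> 1 \<longrightarrow>
    (\<exists>m\<in>M. m z = 0 \<and> (\<exists>t. m (z(k := t)) \<noteq> 0)) \<longrightarrow> \<kappa> * z j ^ E \<le> z k"
  using assms(1,2)
proof (induction rule: finite_induct)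
  case empty
  show ?case by (rule exI[of _ 0], rule allI, rule exI[of _ 1], rule conjI, simp, rule exI[of _ 1], simp)
next
  case (insert m M)
  obtain E1 where E1: "\<And>r. \<exists>\<delta>>0. \<exists>\<kappa>>0. \<forall>z. z i = r \<longrightarrow> 0 < z j \<longrightarrow> z j < \<delta> \<longrightarrow> 0 < z k \<longrightarrow> z k \<le> 1 \<longrightarrow>
    m z = 0 \<longrightarrow> (\<exists>t. m (z(k := t)) \<noteq> 0) \<longrightarrow> \<kappa> * z j ^ E1 \<le> z k"
    using root_growth[OF _ ne, of m] insert.prems by blast
  obtain E2 where E2: "\<And>r. \<exists>\<delta>>0. \<exists>\<kappa>>0. \<forall>z. z i = r \<longrightarrow> 0 < z j \<longrightarrow> z j < \<delta> \<longrightarrow> 0 < z k \<longrightarrow> z k \<le> 1 \<longrightarrow>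
    (\<exists>m\<in>M. m z = 0 \<and> (\<exists>t. m (z(k := t)) \<noteq> 0)) \<longrightarrow> \<kappa> * z j ^ E2 \<le> z k"
    using insert.IH insert.prems by blast
  define E where "E = max E1 E2"
  show ?case
  proof (rule exI[of _ E], rule allI)
    fix r
    obtain d1 k1 where 1: "d1 > 0" "k1 > 0" "\<And>z. z i = r \<Longrightarrow> 0 < z j \<Longrightarrow> z j < d1 \<Longrightarrow> 0 < z k \<Longrightarrow> z k \<le> 1 \<Longrightarrow>
      m z = 0 \<Longrightarrow> (\<exists>t. m (z(k := t)) \<noteq> 0) \<Longrightarrow> k1 * z j ^ E1 \<le> z k" using E1[of r] by blast
    obtain d2 k2 where 2: "d2 > 0" "k2 > 0" "\<And>z. z i = r \<Longrightarrow> 0 < z j \<Longrightarrow> z j < d2 \<Longrightarrow> 0 < z k \<Longrightarrow> z k \<le> 1 \<Longrightarrow>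
      (\<exists>m\<in>M. m z = 0 \<and> (\<exists>t. m (z(k := t)) \<noteq> 0)) \<Longrightarrow> k2 * z j ^ E2 \<le> z k" using E2[of r] by blast
    have le: "min k1 k2 * y ^ E \<le> k1 * y ^ E1" "min k1 k2 * y ^ E \<le> k2 * y ^ E2" if "0 < y" "y < 1" for y
      using that 1 2 by (auto simp: E_def intro!: mult_mono power_decreasing)
    have "min k1 k2 * z j ^ E \<le> z k"
      if z: "z i = r" "0 < z j" "z j < min (min d1 d2) 1" "0 < z k" "z k \<le> 1"
        "\<exists>m\<in>insert m M. m z = 0 \<and> (\<exists>t. m (z(k := t)) \<noteq> 0)" for z
    proof -
      have "k1 * z j ^ E1 \<le> z k \<or> k2 * z j ^ E2 \<le> z k"
        using z 1(3)[of z] 2(3)[of z] by auto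
      thus ?thesis using le[of "z j"] z by force
    qed
    moreover have "min (min d1 d2) 1 > 0" "min k1 k2 > 0" using 1 2 by auto
    ultimately show "\<exists>\<delta>>0. \<exists>\<kappa>>0. \<forall>z. z i = r \<longrightarrow> 0 < z j \<longrightarrow> z j < \<delta> \<longrightarrow> 0 < z k \<longrightarrow> z k \<le> 1 \<longrightarrow>
      (\<exists>m\<in>insert m M. m z = 0 \<and> (\<exists>t. m (z(k := t)) \<noteq> 0)) \<longrightarrow> \<kappa> * z j ^ E \<le> z k"
      by blast
  qed
qed

lemma pfun_line: "f \<in> pfun I \<Longrightarrow> \<exists>R. \<forall>t. f (z(i := t)) = poly R t"
proof (induction rule: pfun.induct)
  case (pfun_const c)
  show ?case by (rule exI[of _ "[:c:]"]) simp
next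
  case (pfun_var j)
  show ?case by (rule exI[of _ "if j = i then [:0, 1:] else [:z j:]"]) simp
next
  case (pfun_add f g)
  then obtain R S where "\<And>t. f (z(i := t)) = poly R t" "\<And>t. g (z(i := t)) = poly S t" by blast
  hence "f (z(i := t)) + g (z(i := t)) = poly (R + S) t" for t by (simp only: poly_add)
  thus ?case by blast
next
  case (pfun_mult f g)
  then obtain R S where "\<And>t. f (z(i := t)) = poly R t" "\<And>t. g (z(i := t)) = poly S t" by blast
  hence "f (z(i := t)) * g (z(i := t)) = poly (R * S) t" for t by (simp only: poly_mult)
  thus ?case by blast
qed

lemma continuous_on_poly_fun: "poly_fun p \<Longrightarrow> continuous_on S p"
  by (auto simp: poly_fun_def intro!: continuous_intros)

lemma compact_ball_level:
  fixes g :: "real^'n \<Rightarrow> real"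
  assumes "continuous_on UNIV g"
  shows "compact {a. (\<Sum>i\<in>UNIV. (a $ i)\<^sup>2) \<le> r \<and> y \<le> \<bar>g a\<bar>}" (is "compact ?K")
proof -
  have "closed {a. y \<le> \<bar>g a\<bar>}"
    by (intro closed_Collect_le continuous_intros assms)
  moreover have "closed {a::real^'n. (\<Sum>i\<in>UNIV. (a $ i)\<^sup>2) \<le> r}"
    by (intro closed_Collect_le continuous_intros)
  moreover have "?K = {a. (\<Sum>i\<in>UNIV. (a $ i)\<^sup>2) \<le> r} \<inter> {a. y \<le> \<bar>g a\<bar>}" by auto
  ultimately have "closed ?K" by (simp add: closed_Int)
  moreover have "bounded ?K"
  proof (rule boundedI[of _ "sqrt r"])
    fix a :: "real^'n" assume "a \<in> ?K"
    thus "norm a \<le> sqrt r" by (simp add: norm_vec_def L2_set_def)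
  qed
  ultimately show ?thesis by (simp add: compact_eq_bounded_closed)
qed

text \<open>Fix r and y = |g x|. On the part of the ball where |g| is at least y, h has a positive
  minimum. If no relevant member of M had a root in the interval from 0 to h x, the value of h could
  be moved below that minimum without a change of sign in M, and elimination would produce a point
  that cannot exist. So h x is at least such a root, which \<open>root_growth_finite\<close> bounds
  from below.\<close>

theorem lojasiewicz_rational:
  fixes g p q h :: "real^'n \<Rightarrow> real"
  assumes pf: "poly_fun p" "poly_fun q" "poly_fun h"
    and cont: "continuous_on UNIV g" and eq: "\<And>x. q x * g x = p x"
    and h0: "\<And>x. h x \<ge> 0" and zero: "\<And>x. h x = 0 \<Longrightarrow> g x = 0"
  shows "\<exists>E. \<forall>r. \<exists>\<delta>>0. \<exists>\<kappa>>0. \<forall>x. (\<Sum>i\<in>UNIV. (x $ i)\<^sup>2) \<le> r \<longrightarrow> q x \<noteq> 0 \<longrightarrow>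
    g x \<noteq> 0 \<longrightarrow> \<bar>g x\<bar> < \<delta> \<longrightarrow> \<kappa> * \<bar>g x\<bar> ^ E \<le> h x"
proof -
  define v :: "('n + nat \<Rightarrow> real) \<Rightarrow> real^'n" where "v z = (\<chi> i. z (Inl i))" for z
  \<comment> \<open>The variables \<open>Inr 0\<close>, \<open>Inr 1\<close>, \<open>Inr 2\<close>
    carry the bound r on the sum of squares, the level y of |g| and the value s of h; the
    coordinates of the point are eliminated.\<close>
  define I :: "('n + nat) set" where "I = {Inr 0, Inr 1, Inr 2}"
  define J :: "('n + nat) set" where "J = range Inl"
  have lift: "(\<lambda>z. f (v z)) \<in> pfun (I \<union> J)" if "poly_fun f" for f
  proof -
    have "(\<lambda>z. f (v z)) \<in> pfun (Inl ` UNIV)"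
      using pfun_reindex[OF poly_fun_imp_pfun[OF that], of Inl] unfolding v_def .
    thus ?thesis by (rule pfun_mono) (auto simp: J_def)
  qed
  have var: "(\<lambda>z. z i) \<in> pfun (I \<union> J)" if "i \<in> I \<union> J" for i using that by (rule pfun_var)
  have IJ: "Inr 0 \<in> I \<union> J" "Inr 1 \<in> I \<union> J" "Inr 2 \<in> I \<union> J" "\<And>i. Inl i \<in> I \<union> J"
    by (auto simp: I_def J_def)
  define l1 where "l1 z = z (Inr 0) - (\<Sum>i\<in>UNIV. (z (Inl i))\<^sup>2)" for z :: "'n + nat \<Rightarrow> real"
  define l2 where "l2 z = q (v z)" for z
  \<comment> \<open>Where q does not vanish, l3 = 0 expresses |g| = y (for y > 0) through the
    polynomials p and q.\<close>
  define l3 where "l3 z = (p (v z))\<^sup>2 - (z (Inr 1))\<^sup>2 * (q (v z))\<^sup>2" for z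
  define l4 where "l4 z = z (Inr 2) - h (v z)" for z
  define L where "L = {l1, l2, l3, l4}"
  have "l1 \<in> pfun (I \<union> J)"
    unfolding l1_def by (intro pfun_diff pfun_sum pfun_power var IJ)
  moreover have "l2 \<in> pfun (I \<union> J)" unfolding l2_def by (rule lift[OF pf(2)])
  moreover have "l3 \<in> pfun (I \<union> J)"
    unfolding l3_def by (intro pfun_diff pfun_mult pfun_power var IJ lift pf)
  moreover have "l4 \<in> pfun (I \<union> J)"
    unfolding l4_def by (intro pfun_diff var IJ lift pf)
  ultimately have LP: "L \<subseteq> pfun (I \<union> J)" by (simp add: L_def)
  have "\<exists>M. finite M \<and> M \<subseteq> pfun I \<and> (\<forall>(e :: (('n + nat \<Rightarrow> real) \<Rightarrow> real) \<Rightarrow> real) x.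
      hom_on (pfun (I \<union> J)) e \<longrightarrow> (\<forall>m\<in>M. sg (e m) = sg (m x)) \<longrightarrow>
      (\<exists>z. (\<forall>i. i \<notin> J \<longrightarrow> z i = x i) \<and> (\<forall>l\<in>L. sg (e l) = sg (l z))))"
    by (rule eliminate_variables) (use LP in \<open>auto simp: L_def I_def J_def\<close>)
  then obtain M where M: "finite M" "M \<subseteq> pfun I" and M2: "\<forall>(e :: (('n + nat \<Rightarrow> real) \<Rightarrow> real) \<Rightarrow> real) x.
      hom_on (pfun (I \<union> J)) e \<longrightarrow> (\<forall>m\<in>M. sg (e m) = sg (m x)) \<longrightarrow>
      (\<exists>z. (\<forall>i. i \<notin> J \<longrightarrow> z i = x i) \<and> (\<forall>l\<in>L. sg (e l) = sg (l z)))"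
    by (elim exE conjE)
  have "\<exists>E. \<forall>r. \<exists>\<delta>>0. \<exists>\<kappa>>0. \<forall>z. z (Inr 0) = r \<longrightarrow> 0 < z (Inr 1) \<longrightarrow> z (Inr 1) < \<delta> \<longrightarrow> 0 < z (Inr 2) \<longrightarrow> z (Inr 2) \<le> 1 \<longrightarrow>
    (\<exists>m\<in>M. m z = 0 \<and> (\<exists>t. m (z(Inr 2 := t)) \<noteq> 0)) \<longrightarrow> \<kappa> * z (Inr 1) ^ E \<le> z (Inr 2)"
    by (rule root_growth_finite) (use M in \<open>auto simp: I_def\<close>)
  then obtain E where E: "\<And>r. \<exists>\<delta>>0. \<exists>\<kappa>>0. \<forall>z. z (Inr 0) = r \<longrightarrow> 0 < z (Inr 1) \<longrightarrow> z (Inr 1) < \<delta> \<longrightarrow> 0 < z (Inr 2) \<longrightarrow> z (Inr 2) \<le> 1 \<longrightarrow>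
    (\<exists>m\<in>M. m z = 0 \<and> (\<exists>t. m (z(Inr 2 := t)) \<noteq> 0)) \<longrightarrow> \<kappa> * z (Inr 1) ^ E \<le> z (Inr 2)"
    by (elim exE) blast
  show ?thesis
  proof (rule exI[of _ E], rule allI)
    fix r
    obtain \<delta> \<kappa> where dk: "\<delta> > 0" "\<kappa> > 0" and grow: "\<forall>z. z (Inr 0) = r \<longrightarrow> 0 < z (Inr 1) \<longrightarrow> z (Inr 1) < \<delta> \<longrightarrow> 0 < z (Inr 2) \<longrightarrow> z (Inr 2) \<le> 1 \<longrightarrow>
      (\<exists>m\<in>M. m z = 0 \<and> (\<exists>t. m (z(Inr 2 := t)) \<noteq> 0)) \<longrightarrow> \<kappa> * z (Inr 1) ^ E \<le> z (Inr 2)"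
      using E[of r] by (elim exE conjE)
    have main: "min \<kappa> 1 * \<bar>g x\<bar> ^ E \<le> h x"
      if x: "(\<Sum>i\<in>UNIV. (x $ i)\<^sup>2) \<le> r" "q x \<noteq> 0" "g x \<noteq> 0" "\<bar>g x\<bar> < min \<delta> 1" for x
    proof -
      define y where "y = \<bar>g x\<bar>"
      have y: "0 < y" "y < \<delta>" "y < 1" using x by (auto simp: y_def)
      have hx: "h x > 0" using h0[of x] zero[of x] x(3) by (cases "h x = 0") auto
      show ?thesis
      proof (cases "h x \<le> 1")
        case False
        have "min \<kappa> 1 * y ^ E \<le> 1 * 1" using y dk by (intro mult_mono power_le_one) auto
        thus ?thesis using False by (simp add: y_def)
      next
        case True
        define s where "s = h x"
        define z0 where "z0 i = (case i of Inl j \<Rightarrow> x $ j | Inr n \<Rightarrow> if n = 0 then r else if n = 1 then y else s)" for i :: "'n + nat"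
        have z0: "z0 (Inr 0) = r" "z0 (Inr 1) = y" "z0 (Inr 2) = s" "v z0 = x"
          by (auto simp: z0_def v_def vec_eq_iff)
        have "\<exists>t. 0 < t \<and> t \<le> s \<and> (\<exists>m\<in>M. m (z0(Inr 2 := t)) = 0 \<and> (\<exists>t'. m (z0(Inr 2 := t')) \<noteq> 0))"
        proof (rule ccontr)
          assume none: "\<not> ?thesis"
          define K where "K = {a. (\<Sum>i\<in>UNIV. (a $ i)\<^sup>2) \<le> r \<and> y \<le> \<bar>g a\<bar>}"
          have "compact K" unfolding K_def by (rule compact_ball_level[OF cont])
          moreover have "x \<in> K" using x by (simp add: K_def y_def)
          ultimately obtain a where a: "a \<in> K" "\<And>b. b \<in> K \<Longrightarrow> h a \<le> h b"
            using continuous_attains_inf[of K h] continuous_on_poly_fun[OF pf(3)] by blast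
          have "g a \<noteq> 0" using a(1) y by (auto simp: K_def)
          hence ha: "h a > 0" using h0[of a] zero[of a] by (cases "h a = 0") auto
          \<comment> \<open>Below the minimum of h on K but not above s, so that the passage from s
            to t stays where \<open>none\<close> excludes roots.\<close>
          define t where "t = min (h a / 2) s"
          have t: "0 < t" "t \<le> s" "t < h a" using ha hx by (auto simp: t_def s_def)
          have "sg (m z0) = sg (m (z0(Inr 2 := t)))" if m: "m \<in> M" for m
          \<comment> \<open>Members of M that vanish identically in the last variable are not
            covered by \<open>none\<close>, but they keep the sign 0.\<close>
          proof (cases "\<exists>t'. m (z0(Inr 2 := t')) \<noteq> 0")
            case False
            hence "m (z0(Inr 2 := s)) = 0" "m (z0(Inr 2 := t)) = 0" by blast+
            thus ?thesis using z0(3) by (metis fun_upd_triv)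
          next
            case True
            have mI: "m \<in> pfun I" using m M by blast
            obtain R where R: "\<And>t. m (z0(Inr 2 := t)) = poly R t"
              using pfun_line[OF mI, of z0 "Inr 2"] by blast
            have "sg (poly R s) = sg (poly R t)"
            proof (rule sg_poly_eq_of_no_root)
              fix u assume "min s t \<le> u" "u \<le> max s t"
              hence "0 < u" "u \<le> s" using t by auto
              thus "poly R u \<noteq> 0" using none True m unfolding R[symmetric] by blast
            qed
            thus ?thesis using z0(3) unfolding R[symmetric] by (metis fun_upd_triv)
          qed
          hence "\<exists>z. (\<forall>i. i \<notin> J \<longrightarrow> z i = (z0(Inr 2 := t)) i) \<and> (\<forall>l\<in>L. sg (l z0) = sg (l z))"
            using M2[rule_format, OF hom_on_ev, of z0 "z0(Inr 2 := t)"] by blast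
          then obtain z where z: "\<And>i. i \<notin> J \<Longrightarrow> z i = (z0(Inr 2 := t)) i" "\<And>l. l \<in> L \<Longrightarrow> sg (l z0) = sg (l z)" by blast
          have zr: "z (Inr 0) = r" "z (Inr 1) = y" "z (Inr 2) = t"
            using z(1)[of "Inr 0"] z(1)[of "Inr 1"] z(1)[of "Inr 2"] z0 by (auto simp: J_def)
          define b where "b = v z"
          have "l1 z0 \<ge> 0" using x z0 by (simp add: l1_def z0_def)
          hence "l1 z \<ge> 0" using z(2)[of l1] by (auto simp: L_def sg_eq_iff not_less[symmetric])
          hence b1: "(\<Sum>i\<in>UNIV. (b $ i)\<^sup>2) \<le> r" using zr by (simp add: l1_def b_def v_def)
          have "l2 z0 \<noteq> 0" using x z0 by (simp add: l2_def)
          hence "l2 z \<noteq> 0" using z(2)[of l2] by (metis L_def insertCI sg_0_iff)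
          hence b2: "q b \<noteq> 0" by (simp add: l2_def b_def)
          have "l3 z0 = 0" unfolding l3_def z0 eq[symmetric] by (simp add: y_def power_mult_distrib)
          hence "l3 z = 0" using z(2)[of l3] by (metis L_def insertCI sg_0_iff)
          hence "(q b)\<^sup>2 * (g b)\<^sup>2 = y\<^sup>2 * (q b)\<^sup>2"
            unfolding l3_def zr b_def[symmetric] eq[symmetric] by (simp add: power_mult_distrib)
          hence "(g b)\<^sup>2 = y\<^sup>2" using b2 by simp
          hence "\<bar>g b\<bar> = y" using y by (auto simp: power2_eq_iff)
          hence "b \<in> K" using b1 by (simp add: K_def)
          hence "h a \<le> h b" by (rule a(2))
          moreover have "l4 z0 = 0" by (simp add: l4_def z0 s_def)
          hence "l4 z = 0" using z(2)[of l4] by (metis L_def insertCI sg_0_iff)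
          hence "h b = t" by (simp add: l4_def zr b_def)
          ultimately show False using t by simp
        qed
        then obtain t where t: "0 < t" "t \<le> s" "\<exists>m\<in>M. m (z0(Inr 2 := t)) = 0 \<and> (\<exists>t'. m (z0(Inr 2 := t')) \<noteq> 0)"
          by blast
        have "\<kappa> * y ^ E \<le> t"
          using grow[rule_format, of "z0(Inr 2 := t)"] z0 t y True by (simp add: s_def)
        moreover have "min \<kappa> 1 * y ^ E \<le> \<kappa> * y ^ E" using y by (intro mult_right_mono) auto
        ultimately show ?thesis using t by (simp add: s_def y_def)
      qed
    qed
    have "min \<delta> 1 > 0" "min \<kappa> 1 > 0" using dk by auto
    thus "\<exists>\<delta>>0. \<exists>\<kappa>>0. \<forall>x. (\<Sum>i\<in>UNIV. (x $ i)\<^sup>2) \<le> r \<longrightarrow> q x \<noteq> 0 \<longrightarrow>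
      g x \<noteq> 0 \<longrightarrow> \<bar>g x\<bar> < \<delta> \<longrightarrow> \<kappa> * \<bar>g x\<bar> ^ E \<le> h x"
      using main by blast
  qed
qed

section \<open>Real closure of a formally real field\<close>

class formally_real = field +
  assumes sum_squares_neq_uminus_1: "(\<Sum>x\<leftarrow>xs. x * x) \<noteq> - 1"

text \<open>A cone determines the field \<open>diffs T\<close> of which it is a preordering, so that maximal preordered
  subfields are obtained from a single application of Zorn's lemma.\<close>

definition precone :: "'e::field set \<Rightarrow> bool" where
  "precone T \<longleftrightarrow> 1 \<in> T \<and> - 1 \<notin> T \<and>
    (\<forall>a\<in>T. \<forall>b\<in>T. a + b \<in> T \<and> a * b \<in> T \<and> (a - b)\<^sup>2 \<in> T \<and> (inverse (a - b))\<^sup>2 \<in> T)"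

definition max_precone :: "'e::field set \<Rightarrow> bool" where
  "max_precone T \<longleftrightarrow> precone T \<and> (\<forall>U. precone U \<longrightarrow> T \<subseteq> U \<longrightarrow> U = T)"

definition diffs :: "'e::field set \<Rightarrow> 'e set" where
  "diffs T = {a - b |a b. a \<in> T \<and> b \<in> T}"

lemma precone_chain_Union:
  assumes "C \<noteq> {}" "subset.chain {T. precone T \<and> S \<subseteq> T} C"
  shows "precone (\<Union>C) \<and> S \<subseteq> \<Union>C"
proof -
  have C: "\<And>T. T \<in> C \<Longrightarrow> precone T \<and> S \<subseteq> T" "\<And>T T'. T \<in> C \<Longrightarrow> T' \<in> C \<Longrightarrow> T \<subseteq> T' \<or> T' \<subseteq> T"
    using assms(2) unfolding subset.chain_def by blast+
  have *: "\<exists>T\<in>C. a \<in> T \<and> b \<in> T" if "a \<in> \<Union>C" "b \<in> \<Union>C" for a b using that C(2) by blast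
  have "a + b \<in> \<Union>C \<and> a * b \<in> \<Union>C \<and> (a - b)\<^sup>2 \<in> \<Union>C \<and> (inverse (a - b))\<^sup>2 \<in> \<Union>C"
    if ab: "a \<in> \<Union>C" "b \<in> \<Union>C" for a b
  proof -
    obtain T where T: "T \<in> C" "a \<in> T" "b \<in> T" using *[OF ab] by blast
    hence "a + b \<in> T \<and> a * b \<in> T \<and> (a - b)\<^sup>2 \<in> T \<and> (inverse (a - b))\<^sup>2 \<in> T"
      using C(1)[OF T(1)] by (simp add: precone_def)
    thus ?thesis using T(1) by blast
  qed
  moreover obtain T where "T \<in> C" using assms(1) by blast
  hence "1 \<in> \<Union>C" "S \<subseteq> \<Union>C" using C(1)[of T] unfolding precone_def by blast+
  moreover have "- 1 \<notin> \<Union>C" using C(1) unfolding precone_def by blast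
  ultimately show ?thesis unfolding precone_def by blast
qed

lemma max_precone_exists:
  assumes "precone S"
  shows "\<exists>T. max_precone T \<and> S \<subseteq> T"
proof -
  have "\<exists>M\<in>{T. precone T \<and> S \<subseteq> T}. \<forall>U\<in>{T. precone T \<and> S \<subseteq> T}. M \<subseteq> U \<longrightarrow> U = M"
  proof (rule subset_Zorn_nonempty)
    show "{T. precone T \<and> S \<subseteq> T} \<noteq> {}" using assms by blast
  qed (use precone_chain_Union[of _ S] in simp)
  then obtain M where M: "precone M" "S \<subseteq> M" "\<And>U. precone U \<Longrightarrow> S \<subseteq> U \<Longrightarrow> M \<subseteq> U \<Longrightarrow> U = M" by auto
  have "max_precone M" unfolding max_precone_def using M(1) M(3)[OF _ order.trans[OF M(2)]] by simp
  thus ?thesis using M(2) by blast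
qed

context
  fixes T :: "'e::field set"
  assumes T: "precone T"
begin

lemma precone_1: "1 \<in> T" and precone_m1: "- 1 \<notin> T"
  and precone_add: "a \<in> T \<Longrightarrow> b \<in> T \<Longrightarrow> a + b \<in> T" and precone_mult: "a \<in> T \<Longrightarrow> b \<in> T \<Longrightarrow> a * b \<in> T"
  using T by (auto simp: precone_def)

lemma diffsE: "x \<in> diffs T \<Longrightarrow> \<exists>a\<in>T. \<exists>b\<in>T. x = a - b"
  by (auto simp: diffs_def)

lemma diffsI: "a \<in> T \<Longrightarrow> b \<in> T \<Longrightarrow> a - b \<in> diffs T"
  by (auto simp: diffs_def)

lemma diffs_square: "x \<in> diffs T \<Longrightarrow> x\<^sup>2 \<in> T" and diffs_inverse_square: "x \<in> diffs T \<Longrightarrow> (inverse x)\<^sup>2 \<in> T"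
  using T by (auto simp: diffs_def precone_def)

lemma precone_0: "0 \<in> T" using diffs_square[OF diffsI[OF precone_1 precone_1]] by simp

lemma precone_diffs: "a \<in> T \<Longrightarrow> a \<in> diffs T" using diffsI[OF _ precone_0, of a] by simp

lemma diffs_add: "x \<in> diffs T \<Longrightarrow> y \<in> diffs T \<Longrightarrow> x + y \<in> diffs T"
proof -
  assume "x \<in> diffs T" "y \<in> diffs T"
  then obtain a b c d where *: "a \<in> T" "b \<in> T" "c \<in> T" "d \<in> T" "x = a - b" "y = c - d"
    using diffsE by metis
  hence "x + y = (a + c) - (b + d)" by simp
  thus ?thesis using * diffsI precone_add by metis
qed

lemma diffs_uminus: "x \<in> diffs T \<Longrightarrow> - x \<in> diffs T"
  using diffsE diffsI by (metis minus_diff_eq)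

lemma diffs_diff: "x \<in> diffs T \<Longrightarrow> y \<in> diffs T \<Longrightarrow> x - y \<in> diffs T"
  using diffs_add[OF _ diffs_uminus, of x y] by simp

lemma diffs_mult: "x \<in> diffs T \<Longrightarrow> y \<in> diffs T \<Longrightarrow> x * y \<in> diffs T"
proof -
  assume "x \<in> diffs T" "y \<in> diffs T"
  then obtain a b c d where *: "a \<in> T" "b \<in> T" "c \<in> T" "d \<in> T" "x = a - b" "y = c - d"
    using diffsE by metis
  have "x * y = (a * c + b * d) - (a * d + b * c)" unfolding *(5,6) by (simp add: algebra_simps)
  thus ?thesis using * diffsI precone_add precone_mult by metis
qed

lemma diffs_inverse: "x \<in> diffs T \<Longrightarrow> inverse x \<in> diffs T"
proof -
  assume x: "x \<in> diffs T"
  have "inverse x = x * (inverse x)\<^sup>2" by (cases "x = 0") (simp_all add: power2_eq_square)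
  thus ?thesis using diffs_mult[OF x precone_diffs[OF diffs_inverse_square[OF x]]] by simp
qed

lemma precone_inverse: "a \<in> T \<Longrightarrow> inverse a \<in> T"
proof -
  assume a: "a \<in> T"
  have "inverse a = a * (inverse a)\<^sup>2" by (cases "a = 0") (simp_all add: power2_eq_square)
  thus ?thesis using precone_mult[OF a diffs_inverse_square[OF precone_diffs[OF a]]] by simp
qed

lemma precone_antisym: "a \<in> T \<Longrightarrow> - a \<in> T \<Longrightarrow> a = 0"
  using precone_mult[of "- a" "inverse a"] precone_inverse[of a] precone_m1 by (cases "a = 0") auto

end

text \<open>If -x is not in T, adjoining x to T gives a precone again: -1 = a + x * b would mean -x
  = (1 + a) / b, which is in T. Maximality then puts x into T.\<close>

lemma max_precone_total:
  assumes "max_precone T" "x \<in> diffs T"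
  shows "x \<in> T \<or> - x \<in> T"
proof -
  have T: "precone T" using assms by (simp add: max_precone_def)
  define U where "U = {a + x * b |a b. a \<in> T \<and> b \<in> T}"
  have UI: "a + x * b \<in> U" if "a \<in> T" "b \<in> T" for a b using that by (auto simp: U_def)
  have TU: "T \<subseteq> U" using UI[OF _ precone_0[OF T]] by auto
  have xU: "x \<in> U" using UI[OF precone_0[OF T] precone_1[OF T]] by simp
  have Ud: "u \<in> diffs T" if "u \<in> U" for u
    using that assms(2) diffs_add[OF T] diffs_mult[OF T] precone_diffs[OF T] by (auto simp: U_def)
  show ?thesis
  proof (cases "- 1 \<in> U")
    case True
    then obtain a b where ab: "a \<in> T" "b \<in> T" "- 1 = a + x * b" by (auto simp: U_def)
    have b0: "b \<noteq> 0" using ab precone_m1[OF T] by auto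
    have "x * b = - 1 - a" using ab(3) by (simp add: eq_diff_eq add.commute)
    hence "- x * b = 1 + a" by simp
    hence "- x = (1 + a) * inverse b" using b0 by (simp add: field_simps)
    thus ?thesis
      using precone_mult[OF T precone_add[OF T precone_1[OF T] ab(1)] precone_inverse[OF T ab(2)]] by simp
  next
    case False
    have "precone U"
      unfolding precone_def
    proof (intro conjI ballI)
      show "1 \<in> U" "- 1 \<notin> U" using TU precone_1[OF T] False by auto
      fix u w assume u: "u \<in> U" and w: "w \<in> U"
      have uw: "u - w \<in> diffs T" using diffs_diff[OF T] Ud u w by blast
      show "(u - w)\<^sup>2 \<in> U" "(inverse (u - w))\<^sup>2 \<in> U"
        using TU diffs_square[OF T uw] diffs_inverse_square[OF T uw] by blast+
      obtain a b c d where *: "a \<in> T" "b \<in> T" "c \<in> T" "d \<in> T" "u = a + x * b" "w = c + x * d"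
        using u w by (auto simp: U_def)
      have "u + w = (a + c) + x * (b + d)" using * by (simp add: algebra_simps)
      thus "u + w \<in> U" using UI * precone_add[OF T] by metis
      have "u * w = (a * c + x\<^sup>2 * (b * d)) + x * (a * d + b * c)" using * by (simp add: algebra_simps power2_eq_square)
      thus "u * w \<in> U"
        using UI[of "a * c + x\<^sup>2 * (b * d)" "a * d + b * c"] * precone_add[OF T] precone_mult[OF T] diffs_square[OF T assms(2)] by simp
    qed
    hence "U = T" using assms(1) TU by (simp add: max_precone_def)
    thus ?thesis using xU by simp
  qed
qed

section \<open>The cone of sums of squares and the ordered field it leads to\<close>

definition sums_of_squares :: "'k::field set" where
  "sums_of_squares = {(\<Sum>x\<leftarrow>xs. x * x) |xs. True}"

lemma sums_of_squares_add: "a \<in> sums_of_squares \<Longrightarrow> b \<in> sums_of_squares \<Longrightarrow> a + b \<in> sums_of_squares"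
  unfolding sums_of_squares_def by safe (metis map_append sum_list_append)

lemma square_in_sums_of_squares: "x * x \<in> sums_of_squares"
proof -
  have "x * x = (\<Sum>y\<leftarrow>[x]. y * y)" by simp
  thus ?thesis unfolding sums_of_squares_def by blast
qed

lemma sum_squares_scaled: "(\<Sum>y\<leftarrow>map ((*) x) ys. y * y) = x * x * (\<Sum>y\<leftarrow>ys. y * y)"
  for x :: "'a::comm_ring_1"
  by (induction ys) (simp_all add: algebra_simps)

lemma sums_of_squares_mult_square: "a \<in> sums_of_squares \<Longrightarrow> x * x * a \<in> sums_of_squares"
proof -
  assume "a \<in> sums_of_squares"
  then obtain xs where "a = (\<Sum>y\<leftarrow>xs. y * y)" by (auto simp: sums_of_squares_def)
  hence "x * x * a = (\<Sum>y\<leftarrow>map ((*) x) xs. y * y)" by (simp only: sum_squares_scaled)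
  thus ?thesis unfolding sums_of_squares_def by blast
qed

lemma sums_of_squares_mult:
  assumes "a \<in> sums_of_squares" "b \<in> sums_of_squares"
  shows "a * b \<in> sums_of_squares"
proof -
  obtain xs where "b = (\<Sum>y\<leftarrow>xs. y * y)" using assms(2) by (auto simp: sums_of_squares_def)
  moreover have "a * (\<Sum>y\<leftarrow>xs. y * y) \<in> sums_of_squares" for xs
  proof (induction xs)
    case Nil
    show ?case using square_in_sums_of_squares[of 0] by simp
  next
    case (Cons x xs)
    have "a * (\<Sum>y\<leftarrow>x # xs. y * y) = x * x * a + a * (\<Sum>y\<leftarrow>xs. y * y)" by (simp add: algebra_simps)
    thus ?case using sums_of_squares_add[OF sums_of_squares_mult_square[OF assms(1)] Cons.IH] by simp
  qed
  ultimately show ?thesis by simp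
qed

lemma precone_to_ac_sums_of_squares:
  "precone (to_ac ` (sums_of_squares :: 'k::formally_real set))"
proof -
  have neg: "to_ac (- 1 :: 'k) = - 1" by simp
  have "- 1 \<notin> to_ac ` (sums_of_squares :: 'k set)"
  proof
    assume "- 1 \<in> to_ac ` (sums_of_squares :: 'k set)"
    then obtain s :: 'k where s: "s \<in> sums_of_squares" "to_ac s = - 1" by auto
    hence "s = - 1" using neg by (metis to_ac_eq_iff)
    moreover obtain xs where "s = (\<Sum>x\<leftarrow>xs. x * x)" using s(1) unfolding sums_of_squares_def by blast
    ultimately show False using sum_squares_neq_uminus_1[of xs] by simp
  qed
  moreover have "(1 :: 'k alg_closure) \<in> to_ac ` sums_of_squares"
    using square_in_sums_of_squares[of "1 :: 'k"] by (metis image_eqI mult_1 to_ac_1)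
  moreover have "a + b \<in> to_ac ` sums_of_squares \<and> a * b \<in> to_ac ` sums_of_squares \<and>
      (a - b)\<^sup>2 \<in> to_ac ` sums_of_squares \<and> (inverse (a - b))\<^sup>2 \<in> to_ac ` sums_of_squares"
    if ab: "a \<in> to_ac ` (sums_of_squares :: 'k set)" "b \<in> to_ac ` (sums_of_squares :: 'k set)" for a b
  proof -
    obtain s t where st: "s \<in> sums_of_squares" "t \<in> sums_of_squares" "a = to_ac s" "b = to_ac t" using ab by auto
    have "a + b = to_ac (s + t)" "a * b = to_ac (s * t)" "(a - b)\<^sup>2 = to_ac ((s - t) * (s - t))"
      "(inverse (a - b))\<^sup>2 = to_ac (inverse (s - t) * inverse (s - t))"
      using st by (simp_all add: power2_eq_square)
    thus ?thesis
      using st sums_of_squares_add sums_of_squares_mult square_in_sums_of_squares by (metis imageI)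
  qed
  ultimately show ?thesis unfolding precone_def by blast
qed

text \<open>The cone is chosen inside the algebraic closure, where polynomials over its difference
  field already have their roots; maximality decides which of them belong to the real
  closure.\<close>

definition rcone :: "'k::formally_real alg_closure set" where
  "rcone = (SOME T. max_precone T \<and> to_ac ` sums_of_squares \<subseteq> T)"

lemma rcone: "max_precone rcone" "to_ac ` sums_of_squares \<subseteq> rcone"
  using someI_ex[OF max_precone_exists[OF precone_to_ac_sums_of_squares]] unfolding rcone_def by blast+

lemma precone_rcone: "precone rcone"
  by (rule conjunct1[OF rcone(1)[unfolded max_precone_def]])

typedef (overloaded) 'k rclos = "diffs (rcone :: 'k::formally_real alg_closure set)"
  using precone_diffs[OF precone_rcone precone_0[OF precone_rcone]] by blast

setup_lifting type_definition_rclos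

instantiation rclos :: (formally_real) field
begin

lift_definition zero_rclos :: "'a rclos" is 0 by (rule precone_diffs[OF precone_rcone precone_0[OF precone_rcone]])
lift_definition one_rclos :: "'a rclos" is 1 by (rule precone_diffs[OF precone_rcone precone_1[OF precone_rcone]])
lift_definition plus_rclos :: "'a rclos \<Rightarrow> 'a rclos \<Rightarrow> 'a rclos" is "(+)" by (rule diffs_add[OF precone_rcone])
lift_definition minus_rclos :: "'a rclos \<Rightarrow> 'a rclos \<Rightarrow> 'a rclos" is "(-)" by (rule diffs_diff[OF precone_rcone])
lift_definition uminus_rclos :: "'a rclos \<Rightarrow> 'a rclos" is uminus by (rule diffs_uminus[OF precone_rcone])
lift_definition times_rclos :: "'a rclos \<Rightarrow> 'a rclos \<Rightarrow> 'a rclos" is "(*)" by (rule diffs_mult[OF precone_rcone])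
lift_definition inverse_rclos :: "'a rclos \<Rightarrow> 'a rclos" is inverse by (rule diffs_inverse[OF precone_rcone])
lift_definition divide_rclos :: "'a rclos \<Rightarrow> 'a rclos \<Rightarrow> 'a rclos" is "(/)"
  by (simp add: divide_inverse diffs_mult[OF precone_rcone] diffs_inverse[OF precone_rcone])

lemmas rclos_reps = Rep_rclos_inject[symmetric] zero_rclos.rep_eq one_rclos.rep_eq plus_rclos.rep_eq
  minus_rclos.rep_eq uminus_rclos.rep_eq times_rclos.rep_eq inverse_rclos.rep_eq divide_rclos.rep_eq

instance
proof
  fix a b c :: "'a rclos"
  show "a * b * c = a * (b * c)" by (simp add: rclos_reps mult.assoc)
  show "a * b = b * a" by (simp add: rclos_reps mult.commute)
  show "1 * a = a" by (simp add: rclos_reps)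
  show "a + b + c = a + (b + c)" by (simp add: rclos_reps add.assoc)
  show "a + b = b + a" by (simp add: rclos_reps add.commute)
  show "0 + a = a" by (simp add: rclos_reps)
  show "- a + a = 0" by (simp add: rclos_reps)
  show "a - b = a + - b" by (simp add: rclos_reps)
  show "(a + b) * c = a * c + b * c" by (simp add: rclos_reps distrib_right)
  show "(0 :: 'a rclos) \<noteq> 1" by (simp add: rclos_reps)
  show "a \<noteq> 0 \<Longrightarrow> inverse a * a = 1" by (simp add: rclos_reps)
  show "a div b = a * inverse b" by (simp add: rclos_reps divide_inverse)
  show "inverse (0 :: 'a rclos) = 0" by (simp add: rclos_reps)
qed

end

instantiation rclos :: (formally_real) linordered_field
begin

lift_definition less_eq_rclos :: "'a rclos \<Rightarrow> 'a rclos \<Rightarrow> bool" is "\<lambda>x y. y - x \<in> rcone" .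
definition less_rclos :: "'a rclos \<Rightarrow> 'a rclos \<Rightarrow> bool" where "less_rclos x y \<longleftrightarrow> x \<le> y \<and> x \<noteq> y"
definition abs_rclos :: "'a rclos \<Rightarrow> 'a rclos" where "abs_rclos x = (if x < 0 then - x else x)"
definition sgn_rclos :: "'a rclos \<Rightarrow> 'a rclos" where "sgn_rclos x = (if x = 0 then 0 else if 0 < x then 1 else - 1)"

instance
proof
  fix x y z :: "'a rclos"
  note le = less_eq_rclos.rep_eq
  have antisym: "x = y" if "x \<le> y" "y \<le> x" for x y :: "'a rclos"
  proof -
    have "Rep_rclos y - Rep_rclos x \<in> rcone" "- (Rep_rclos y - Rep_rclos x) \<in> rcone"
      using that by (simp_all add: le)
    hence "Rep_rclos y - Rep_rclos x = 0" by (rule precone_antisym[OF precone_rcone])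
    thus ?thesis by (simp add: Rep_rclos_inject)
  qed
  show "(x < y) = (x \<le> y \<and> \<not> y \<le> x)"
    using antisym by (auto simp: less_rclos_def)
  show "x \<le> x" by (simp add: le precone_0[OF precone_rcone])
  show "x \<le> z" if "x \<le> y" "y \<le> z"
    using precone_add[OF precone_rcone, of "Rep_rclos y - Rep_rclos x" "Rep_rclos z - Rep_rclos y"] that
    by (simp add: le)
  show "x = y" if "x \<le> y" "y \<le> x" using antisym that .
  show "x \<le> y \<or> y \<le> x"
    using max_precone_total[OF rcone(1) diffs_diff[OF precone_rcone Rep_rclos[of y] Rep_rclos[of x]]]
    by (simp add: le)
  show "z + x \<le> z + y" if "x \<le> y" using that by (simp add: le plus_rclos.rep_eq)
  show "z * x < z * y" if "x < y" "0 < z"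
  proof -
    have xy: "x \<le> y" "0 \<le> z" "x \<noteq> y" "z \<noteq> 0" using that by (auto simp: less_rclos_def)
    have "Rep_rclos z * (Rep_rclos y - Rep_rclos x) \<in> rcone"
      using xy(1,2) by (intro precone_mult[OF precone_rcone]) (simp_all add: le zero_rclos.rep_eq)
    hence "z * x \<le> z * y" by (simp add: le times_rclos.rep_eq right_diff_distrib)
    thus ?thesis using xy by (simp add: less_rclos_def)
  qed
  show "\<bar>x\<bar> = (if x < 0 then - x else x)" by (rule abs_rclos_def)
  show "sgn x = (if x = 0 then 0 else if 0 < x then 1 else - 1)" by (rule sgn_rclos_def)
qed

end

definition ac_eval :: "'k::formally_real alg_closure \<Rightarrow> 'k rclos poly \<Rightarrow> 'k alg_closure" where
  "ac_eval \<theta> g = poly (map_poly Rep_rclos g) \<theta>"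

lemma hom_Rep_rclos: "hom_on UNIV Rep_rclos"
  by (simp add: hom_on_def zero_rclos.rep_eq one_rclos.rep_eq plus_rclos.rep_eq times_rclos.rep_eq)

lemma ring_set_UNIV: "ring_set UNIV" by (simp add: ring_set_def)

lemma polys_in_UNIV: "P \<in> polys_in UNIV" by (simp add: polys_in_def)

lemma ac_eval_add: "ac_eval \<theta> (f + g) = ac_eval \<theta> f + ac_eval \<theta> g"
  by (simp add: ac_eval_def map_hom_add[OF ring_set_UNIV hom_Rep_rclos polys_in_UNIV polys_in_UNIV])

lemma ac_eval_mult: "ac_eval \<theta> (f * g) = ac_eval \<theta> f * ac_eval \<theta> g"
  by (simp add: ac_eval_def map_hom_mult[OF ring_set_UNIV hom_Rep_rclos polys_in_UNIV polys_in_UNIV])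

lemma ac_eval_const: "ac_eval \<theta> [:c:] = Rep_rclos c"
  by (simp add: ac_eval_def map_poly_pCons zero_rclos.rep_eq)

lemma ac_eval_0: "ac_eval \<theta> 0 = 0" by (simp add: ac_eval_def)

lemma ac_eval_1: "ac_eval \<theta> 1 = 1"
  using ac_eval_const[of \<theta> 1] by (simp only: one_pCons one_rclos.rep_eq)

lemma ac_eval_uminus: "ac_eval \<theta> (- f) = - ac_eval \<theta> f"
  using ac_eval_add[of \<theta> f "- f"] ac_eval_0[of \<theta>] by (simp add: eq_neg_iff_add_eq_0 add.commute)

lemma ac_eval_diff: "ac_eval \<theta> (f - g) = ac_eval \<theta> f - ac_eval \<theta> g"
  using ac_eval_add[of \<theta> f "- g"] ac_eval_uminus[of \<theta> g] by simp

lemma ac_eval_var: "ac_eval \<theta> [:0, 1:] = \<theta>"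
  by (simp add: ac_eval_def map_poly_pCons zero_rclos.rep_eq one_rclos.rep_eq)

lemma ac_eval_Rep: "ac_eval (Rep_rclos c) f = Rep_rclos (poly f c)"
  unfolding ac_eval_def using hom_poly[OF ring_set_UNIV hom_Rep_rclos _ polys_in_UNIV, of c f] by simp

text \<open>Their values at an element \<theta> are the natural candidate for a cone that contains
  the nonnegative elements of the base field and all squares of the extension generated by
  \<theta>.\<close>

inductive_set psq :: "'a::linordered_field poly set" where
  psq_0: "0 \<in> psq"
| psq_step: "s \<in> psq \<Longrightarrow> 0 \<le> c \<Longrightarrow> s + smult c (g * g) \<in> psq"

lemma psq_add: "s \<in> psq \<Longrightarrow> t \<in> psq \<Longrightarrow> t + s \<in> psq"
  by (induction rule: psq.induct) (auto simp: add.assoc[symmetric] intro: psq_step)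

lemma psq_square: "0 \<le> c \<Longrightarrow> smult c (g * g) \<in> psq"
  using psq_step[OF psq_0] by simp

lemma psq_mult_square: "s \<in> psq \<Longrightarrow> 0 \<le> c \<Longrightarrow> s * smult c (g * g) \<in> psq"
proof (induction rule: psq.induct)
  case (psq_step s d k)
  have "(s + smult d (k * k)) * smult c (g * g) = s * smult c (g * g) + smult (c * d) ((k * g) * (k * g))"
    by (simp add: algebra_simps)
  thus ?case using psq_step psq.psq_step[of "s * smult c (g * g)" "c * d" "k * g"] by simp
qed (simp add: psq_0)

lemma psq_mult: "s \<in> psq \<Longrightarrow> t \<in> psq \<Longrightarrow> t * s \<in> psq"
  by (induction rule: psq.induct) (auto simp: distrib_left psq_0 intro!: psq_add psq_mult_square simp del: mult_smult_right)

lemma psq_nonneg: "s \<in> psq \<Longrightarrow> poly s x \<ge> 0"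
  by (induction rule: psq.induct) auto

text \<open>Each square is reduced modulo f separately, which keeps the weights nonnegative and the
  degree below 2 * degree f. The plain remainder of s need not be a weighted sum of squares.\<close>

lemma psq_reduce:
  assumes "s \<in> psq" "degree f > 0"
  shows "\<exists>t\<in>psq. degree t \<le> 2 * degree f - 2 \<and> f dvd s - t"
  using assms(1)
proof (induction rule: psq.induct)
  case psq_0
  show ?case by (rule bexI[of _ 0]) (auto simp: psq.psq_0)
next
  case (psq_step s c g)
  then obtain t where t: "t \<in> psq" "degree t \<le> 2 * degree f - 2" "f dvd s - t" by blast
  define k where "k = g mod f"
  have "k = 0 \<or> degree k < degree f" unfolding k_def using assms(2) by (intro degree_mod_less) auto
  hence "degree k \<le> degree f - 1" using assms(2) by auto
  hence "degree (smult c (k * k)) \<le> 2 * degree f - 2"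
    using degree_mult_le[of k k] degree_smult_le[of c "k * k"] by linarith
  hence 1: "degree (t + smult c (k * k)) \<le> 2 * degree f - 2" using t(2) by (intro degree_add_le) auto
  have "f dvd g - k" unfolding k_def by (simp add: dvd_minus_mod)
  hence "f dvd smult c ((g - k) * (g + k))" by (intro dvd_smult dvd_mult2)
  moreover have "(s + smult c (g * g)) - (t + smult c (k * k)) = (s - t) + smult c ((g - k) * (g + k))"
    by (simp add: algebra_simps smult_diff_right)
  ultimately have "f dvd (s + smult c (g * g)) - (t + smult c (k * k))" using t(3) by (simp only: dvd_add)
  thus ?case using 1 psq.psq_step[OF t(1) psq_step.hyps(2), of k] by blast
qed

text \<open>A Euclidean recursion: m = s * g + r gives 1 / g = - s / r at \<theta>, and r has
  smaller degree than g. The minimal degree of m prevents r from vanishing at \<theta>.\<close>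

lemma inverse_ac_eval:
  fixes m :: "'k::formally_real rclos poly"
  assumes m: "m \<noteq> 0" "ac_eval \<theta> m = 0" "\<And>g. g \<noteq> 0 \<Longrightarrow> ac_eval \<theta> g = 0 \<Longrightarrow> degree m \<le> degree g"
  shows "\<exists>g'. ac_eval \<theta> g' = inverse (ac_eval \<theta> g)"
proof -
  have *: "degree g < degree m \<Longrightarrow> ac_eval \<theta> g \<noteq> 0 \<Longrightarrow> \<exists>g'. ac_eval \<theta> g' = inverse (ac_eval \<theta> g)" for g
  proof (induction "degree g" arbitrary: g rule: less_induct)
    case less
    show ?case
    proof (cases "degree g = 0")
      case True
      then obtain c where c: "g = [:c:]" by (rule degree_eq_zeroE)
      have "ac_eval \<theta> [:inverse c:] = inverse (ac_eval \<theta> g)" by (simp add: c ac_eval_const inverse_rclos.rep_eq)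
      thus ?thesis by blast
    next
      case False
      define r where "r = m mod g"
      define s where "s = m div g"
      have g0: "g \<noteq> 0" using False by auto
      have ms: "m = s * g + r" by (simp add: r_def s_def)
      have er: "ac_eval \<theta> r = - (ac_eval \<theta> s * ac_eval \<theta> g)"
        using m(2) unfolding ms ac_eval_add ac_eval_mult by (simp add: eq_neg_iff_add_eq_0 add.commute)
      have dr: "degree r < degree g" using degree_mod_less[OF g0, of m] False by (auto simp: r_def)
      have r0: "ac_eval \<theta> r \<noteq> 0"
      proof
        assume "ac_eval \<theta> r = 0"
        hence "ac_eval \<theta> s = 0" using er less.prems(2) by simp
        moreover have s0: "s \<noteq> 0" using ms less.prems(1) dr by auto
        ultimately have "degree m \<le> degree s" by (intro m(3))
        moreover have "degree m = degree s + degree g"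
        proof -
          have "degree (s * g) = degree s + degree g" using s0 g0 by (rule degree_mult_eq)
          moreover have "degree r < degree (s * g)" using calculation dr by simp
          ultimately show ?thesis unfolding ms by (simp add: degree_add_eq_left)
        qed
        ultimately show False using False by simp
      qed
      obtain r' where r': "ac_eval \<theta> r' = inverse (ac_eval \<theta> r)"
        using less.hyps[OF dr _ r0] dr less.prems(1) by auto
      have "ac_eval \<theta> (- s * r') = inverse (ac_eval \<theta> g)"
        unfolding ac_eval_mult ac_eval_uminus r' using er r0 less.prems(2) by (simp add: field_simps)
      thus ?thesis by blast
    qed
  qed
  define k where "k = g mod m"
  have "g = (g div m) * m + k" by (simp add: k_def)
  hence eq: "ac_eval \<theta> g = ac_eval \<theta> k" using m(2) by (metis ac_eval_add ac_eval_mult add_0 mult_zero_right)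
  show ?thesis
  proof (cases "ac_eval \<theta> g = 0")
    case True
    thus ?thesis using ac_eval_0[of \<theta>] by (metis inverse_zero)
  next
    case False
    hence "k \<noteq> 0" using eq ac_eval_0 by metis
    hence "degree k < degree m" using degree_mod_less[OF m(1), of g] by (auto simp: k_def)
    thus ?thesis using *[of k] False eq by simp
  qed
qed

text \<open>The Artin-Schreier argument. Let f be, up to a constant, the minimal polynomial of
  \<theta>. If the values of \<open>psq\<close> at \<theta> contained -1, then 1 + t = f * w with t
  in \<open>psq\<close> and w of smaller degree than f. As f * w is positive, w changes sign along
  with f and has a root by induction, where 1 + t would be 0. Hence these values form a precone,
  which by maximality is \<open>rcone\<close> itself, and \<theta> lies in the real closure.\<close>

lemma rclos_root_of_sign_change:
  fixes f :: "'k::formally_real rclos poly"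
  shows "poly f a * poly f b < 0 \<Longrightarrow> \<exists>c. poly f c = 0"
proof (induction "degree f" arbitrary: f a b rule: less_induct)
  case less
  have f0: "f \<noteq> 0" using less.prems by auto
  have D: "degree f > 0"
  proof (rule ccontr)
    assume "\<not> ?thesis"
    then obtain c where "f = [:c:]" using degree_eq_zeroE by blast
    thus False using less.prems by (simp add: not_less)
  qed
  have "degree (map_poly Rep_rclos f) = degree f"
    by (rule degree_map_poly) (metis Rep_rclos_inject zero_rclos.rep_eq)
  then obtain \<theta> where th: "ac_eval \<theta> f = 0"
    using alg_closed_imp_poly_has_root[of "map_poly Rep_rclos f"] D by (auto simp: ac_eval_def)
  define A where "A = {g. g \<noteq> 0 \<and> ac_eval \<theta> g = 0}"
  have fA: "f \<in> A" using f0 th by (simp add: A_def)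
  obtain m where m: "m \<in> A" "\<And>g. g \<in> A \<Longrightarrow> degree m \<le> degree g"
    using ex_has_least_nat[of "\<lambda>g. g \<in> A" f degree] fA by blast
  have m0: "m \<noteq> 0" "ac_eval \<theta> m = 0" using m(1) by (auto simp: A_def)
  have mdvd: "m dvd g" if g: "ac_eval \<theta> g = 0" for g
  proof -
    have "ac_eval \<theta> (g mod m) = ac_eval \<theta> g - ac_eval \<theta> (g div m) * ac_eval \<theta> m"
      by (simp add: minus_div_mult_eq_mod[symmetric] ac_eval_diff ac_eval_mult)
    hence "ac_eval \<theta> (g mod m) = 0" using g m0 by simp
    hence "g mod m = 0 \<or> degree m \<le> degree (g mod m)" using m(2)[of "g mod m"] by (auto simp: A_def)
    hence "g mod m = 0" using degree_mod_less[OF m0(1), of g] by linarith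
    thus ?thesis by (rule mod_0_imp_dvd)
  qed
  obtain u where u: "f = m * u" using mdvd[OF th] by (auto simp: dvd_def)
  have u0: "u \<noteq> 0" using f0 u by auto
  have deg: "degree f = degree m + degree u" unfolding u using m0(1) u0 by (rule degree_mult_eq)
  have dm: "degree m > 0"
  proof (rule ccontr)
    assume "\<not> ?thesis"
    then obtain c where c: "m = [:c:]" using degree_eq_zeroE by blast
    hence "Rep_rclos c = Rep_rclos 0" using m0(2) by (simp add: ac_eval_const zero_rclos.rep_eq)
    thus False using m0(1) c by (simp add: Rep_rclos_inject)
  qed
  show ?case
  proof (cases "degree u = 0")
    \<comment> \<open>f is a proper product, and one of the factors changes sign.\<close>
    case False
    have lt: "degree m < degree f" "degree u < degree f" using deg False dm by auto
    have "poly m a * poly m b * (poly u a * poly u b) < 0" using less.prems unfolding u by (simp add: mult_ac)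
    hence "poly m a * poly m b < 0 \<or> poly u a * poly u b < 0"
      by (meson mult_less_0_iff)
    hence "(\<exists>c. poly m c = 0) \<or> (\<exists>c. poly u c = 0)"
      using less.hyps[OF lt(1), of a b] less.hyps[OF lt(2), of a b] by blast
    thus ?thesis unfolding u poly_mult by (metis mult_zero_left mult_zero_right)
  next
    case True
    have fdvd: "f dvd g" if "ac_eval \<theta> g = 0" for g
    proof -
      obtain c where c: "u = [:c:]" using True degree_eq_zeroE by blast
      have "c \<noteq> 0" using u0 c by auto
      hence "m = f * [:inverse c:]" using u c by simp
      hence "f dvd m" by (metis dvd_triv_left)
      thus ?thesis using mdvd[OF that] dvd_trans by blast
    qed
    define U where "U = ac_eval \<theta> ` psq"
    have m1: "- 1 \<notin> U"
    proof
      assume "- 1 \<in> U"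
      then obtain s where s: "s \<in> psq" "ac_eval \<theta> s = - 1" by (auto simp: U_def)
      obtain t where t: "t \<in> psq" "degree t \<le> 2 * degree f - 2" "f dvd s - t" using psq_reduce[OF s(1) D] by blast
      obtain w' where "s - t = f * w'" using t(3) by (auto simp: dvd_def)
      hence "ac_eval \<theta> (s - t) = 0" using th by (simp add: ac_eval_mult)
      hence "ac_eval \<theta> t = - 1" using s(2) by (simp add: ac_eval_diff)
      hence "ac_eval \<theta> (1 + t) = 0" by (simp add: ac_eval_add ac_eval_1)
      then obtain w where w: "1 + t = f * w" using fdvd by (auto simp: dvd_def)
      have pos: "poly (1 + t) x > 0" for x using psq_nonneg[OF t(1), of x] by (simp add: add_pos_nonneg)
      have w0: "w \<noteq> 0" using pos[of 0] w by auto
      have "degree (1 + t) \<le> 2 * degree f - 2" using t(2) by (intro degree_add_le) auto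
      moreover have "degree (1 + t) = degree f + degree w" unfolding w using f0 w0 by (rule degree_mult_eq)
      ultimately have dw: "degree w < degree f" using D by linarith
      have "poly f a * poly w a > 0" "poly f b * poly w b > 0" using pos[of a] pos[of b] unfolding w by auto
      hence "poly f a * poly f b * (poly w a * poly w b) > 0" by (metis mult.assoc mult.left_commute mult_pos_pos)
      hence "poly w a * poly w b < 0" using less.prems by (metis mult_pos_neg not_less_iff_gr_or_eq zero_less_mult_iff)
      from less.hyps[OF dw this] obtain c where "poly w c = 0" by blast
      thus False using pos[of c] unfolding w by simp
    qed
    have pU: "precone U"
      unfolding precone_def
    proof (intro conjI ballI m1)
      show "1 \<in> U" unfolding U_def using psq_square[of 1 1] ac_eval_1 by (metis imageI mult_1 smult_1_left zero_le_one)
      fix x y assume "x \<in> U" "y \<in> U"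
      then obtain s t where st: "s \<in> psq" "t \<in> psq" "x = ac_eval \<theta> s" "y = ac_eval \<theta> t" by (auto simp: U_def)
      show "x + y \<in> U" unfolding U_def st ac_eval_add[symmetric] using psq_add[OF st(2,1)] by blast
      show "x * y \<in> U" unfolding U_def st ac_eval_mult[symmetric] using psq_mult[OF st(2,1)] by blast
      have sq: "(ac_eval \<theta> g)\<^sup>2 \<in> U" for g
        unfolding U_def power2_eq_square ac_eval_mult[symmetric] using psq_square[of 1 g] by auto
      show "(x - y)\<^sup>2 \<in> U" using sq[of "s - t"] by (simp add: st ac_eval_diff)
      obtain g' where "ac_eval \<theta> g' = inverse (ac_eval \<theta> (s - t))"
        using inverse_ac_eval[OF m0, of "s - t"] m(2) by (auto simp: A_def)
      thus "(inverse (x - y))\<^sup>2 \<in> U" using sq[of g'] by (simp add: st ac_eval_diff)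
    qed
    have sU: "rcone \<subseteq> U"
    proof
      fix c :: "'k alg_closure" assume c: "c \<in> rcone"
      then obtain c' where c': "c = Rep_rclos c'"
        using precone_diffs[OF precone_rcone] Rep_rclos_cases by metis
      have "0 \<le> c'" using c unfolding c' by (simp add: less_eq_rclos.rep_eq zero_rclos.rep_eq)
      from psq_square[OF this, of 1] show "c \<in> U"
        unfolding U_def c' using ac_eval_const[of \<theta> c'] by (metis imageI mult_1 smult_one)
    qed
    have U: "U = rcone"
      by (rule conjunct2[OF rcone(1)[unfolded max_precone_def], rule_format, OF pU sU])
    \<comment> \<open>Every element is the difference of the squares of (\<theta> + 1) / 2 and
      (\<theta> - 1) / 2, hence a difference of elements of U.\<close>
    define h where "h = (1 / 2 :: 'k rclos)"
    have "[:0, 1:] = smult 1 ([:h, h:] * [:h, h:]) - smult 1 ([:- h, h:] * [:- h, h:])"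
      by (simp add: h_def)
    hence "\<theta> = ac_eval \<theta> (smult 1 ([:h, h:] * [:h, h:])) - ac_eval \<theta> (smult 1 ([:- h, h:] * [:- h, h:]))"
      by (metis ac_eval_var ac_eval_diff)
    hence "\<theta> \<in> diffs U"
      using psq_square[of 1] unfolding diffs_def U_def by (smt (verit, ccfv_threshold) imageI mem_Collect_eq zero_le_one)
    then obtain c where "\<theta> = Rep_rclos c" unfolding U using Rep_rclos_cases by metis
    hence "Rep_rclos (poly f c) = Rep_rclos 0" using th by (simp add: ac_eval_Rep zero_rclos.rep_eq)
    thus ?thesis by (auto simp: Rep_rclos_inject)
  qed
qed

text \<open>A root c outside the interval is divided out; (a - c) * (b - c) is positive, so the
  cofactor still changes sign.\<close>

lemma rclos_root_between:
  fixes f :: "'k::formally_real rclos poly"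
  assumes "a < b"
  shows "poly f a * poly f b < 0 \<Longrightarrow> \<exists>c. a < c \<and> c < b \<and> poly f c = 0"
proof (induction "degree f" arbitrary: f rule: less_induct)
  case less
  obtain c where c: "poly f c = 0" using rclos_root_of_sign_change[OF less.prems] by blast
  then obtain g where g: "f = [:- c, 1:] * g" by (auto simp: poly_eq_0_iff_dvd dvd_def)
  have g0: "g \<noteq> 0" using less.prems g by auto
  have lt: "degree g < degree f" unfolding g using g0 by (subst degree_mult_eq) auto
  show ?case
  proof (cases "a < c \<and> c < b")
    case True
    thus ?thesis using c by blast
  next
    case False
    have "c \<noteq> a" "c \<noteq> b" using less.prems c by auto
    hence "(a - c) * (b - c) > 0" using False assms by (auto simp: zero_less_mult_iff not_less)
    moreover have "(a - c) * (b - c) * (poly g a * poly g b) < 0"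
      using less.prems unfolding g by (simp add: algebra_simps)
    ultimately have "poly g a * poly g b < 0" by (metis mult_pos_pos not_less_iff_gr_or_eq mult_zero_right)
    from less.hyps[OF lt this] show ?thesis unfolding g by auto
  qed
qed

instance rclos :: (formally_real) rcf
proof
  fix a b :: "'a rclos" and n :: nat and f :: "nat \<Rightarrow> 'a rclos"
  assume *: "a < b" "(\<Sum>k\<le>n. f k * a ^ k) < 0" "0 < (\<Sum>k\<le>n. f k * b ^ k)"
  have eq: "poly (\<Sum>k\<le>n. monom (f k) k) x = (\<Sum>k\<le>n. f k * x ^ k)" for x
    by (simp add: poly_sum poly_monom)
  show "\<exists>x. a < x \<and> x < b \<and> (\<Sum>k\<le>n. f k * x ^ k) = 0"
    using rclos_root_between[OF *(1), of "\<Sum>k\<le>n. monom (f k) k"] *(2,3) unfolding eq by (simp add: mult_neg_pos)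
qed

text \<open>Again k is a difference of two squares. The division by 2 is legitimate because in
  characteristic 2 the square 1 would equal -1.\<close>

lemma to_ac_in_diffs: "to_ac (k :: 'k::formally_real) \<in> diffs rcone"
proof -
  have two: "(2 :: 'k) \<noteq> 0"
  proof
    assume "(2 :: 'k) = 0"
    hence "(\<Sum>x\<leftarrow>[1]. x * x) = (- 1 :: 'k)" by (simp add: eq_neg_iff_add_eq_0 one_add_one)
    thus False using sum_squares_neq_uminus_1 by blast
  qed
  have "k = ((k + 1) / 2) * ((k + 1) / 2) - ((k - 1) / 2) * ((k - 1) / 2)"
  proof -
    have four: "(4 :: 'k) = 2 * 2" by simp
    have quarter: "u / 2 * (u / 2) = u * u / 4" for u :: 'k by (simp only: times_divide_times_eq four)
    from four have "(4 :: 'k) \<noteq> 0" using two by (metis mult_eq_0_iff)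
    hence "k = (4 * k) / 4" by simp
    also have "4 * k = (k + 1) * (k + 1) - (k - 1) * (k - 1)" by (simp add: algebra_simps)
    also have "\<dots> / 4 = ((k + 1) / 2) * ((k + 1) / 2) - ((k - 1) / 2) * ((k - 1) / 2)"
      unfolding quarter by (rule diff_divide_distrib)
    finally show ?thesis .
  qed
  hence "to_ac k = to_ac (((k + 1) / 2) * ((k + 1) / 2)) - to_ac (((k - 1) / 2) * ((k - 1) / 2))"
    by (metis to_ac_diff)
  thus ?thesis
    using diffsI[OF precone_rcone] rcone(2) square_in_sums_of_squares by (metis image_subset_iff)
qed

lift_definition to_rclos :: "'k::formally_real \<Rightarrow> 'k rclos" is to_ac by (rule to_ac_in_diffs)

lemma to_rclos_hom: "to_rclos 0 = 0" "to_rclos 1 = 1" "to_rclos (x + y) = to_rclos x + to_rclos y"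
  "to_rclos (x * y) = to_rclos x * to_rclos y" "to_rclos x = 0 \<longleftrightarrow> x = 0"
  by (transfer; simp)+

section \<open>The real Nullstellensatz\<close>

class real_idom = idom +
  assumes sum_squares_zero: "(\<Sum>x\<leftarrow>xs. x * x) = 0 \<Longrightarrow> x \<in> set xs \<Longrightarrow> x = 0"

text \<open>Denominators are cleared by their squares, which keeps the numerator a sum of
  squares.\<close>

lemma sum_squares_fract:
  fixes xs :: "'a::idom fract list"
  shows "\<exists>b ys. b \<noteq> 0 \<and> (\<Sum>x\<leftarrow>xs. x * x) = Fract (\<Sum>y\<leftarrow>ys. y * y) (b * b)"
proof (induction xs)
  case Nil
  show ?case by (rule exI[of _ 1], rule exI[of _ "[]"]) (simp add: Zero_fract_def)
next
  case (Cons x xs)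
  then obtain b ys where b: "b \<noteq> 0" "(\<Sum>x\<leftarrow>xs. x * x) = Fract (\<Sum>y\<leftarrow>ys. y * y) (b * b)" by blast
  obtain c d where x: "x = Fract c d" "d \<noteq> 0" by (cases x) auto
  define zs where "zs = c * b # map ((*) d) ys"
  have "(\<Sum>y\<leftarrow>zs. y * y) = c * c * (b * b) + (\<Sum>y\<leftarrow>ys. y * y) * (d * d)"
    unfolding zs_def list.map sum_list.Cons using sum_squares_scaled[of d ys] by (simp add: mult_ac)
  moreover have "(\<Sum>x\<leftarrow>x # xs. x * x) = Fract (c * c * (b * b) + (\<Sum>y\<leftarrow>ys. y * y) * (d * d)) ((d * d) * (b * b))"
    using b x by simp
  ultimately have "(\<Sum>x\<leftarrow>x # xs. x * x) = Fract (\<Sum>y\<leftarrow>zs. y * y) ((d * b) * (d * b))" by (simp add: mult_ac)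
  moreover have "d * b \<noteq> 0" using b x by simp
  ultimately show ?case by blast
qed

instance fract :: (real_idom) formally_real
proof
  fix xs :: "'a fract list"
  show "(\<Sum>x\<leftarrow>xs. x * x) \<noteq> - 1"
  proof
    assume *: "(\<Sum>x\<leftarrow>xs. x * x) = - 1"
    obtain b ys where b: "b \<noteq> 0" "(\<Sum>x\<leftarrow>xs. x * x) = Fract (\<Sum>y\<leftarrow>ys. y * y) (b * b)"
      using sum_squares_fract by blast
    hence "Fract (\<Sum>y\<leftarrow>ys. y * y) (b * b) = Fract (- 1) 1" using * by (simp add: One_fract_def)
    hence "(\<Sum>y\<leftarrow>b # ys. y * y) = 0" using b(1) by (simp add: eq_fract)
    hence "b = 0" by (rule sum_squares_zero) simp
    thus False using b(1) by simp
  qed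
qed

section \<open>Closure of the polynomial functions under ring operations, and real prime
  ideals\<close>

lemma poly_fun_monomial: "poly_fun (\<lambda>x. c * (\<Prod>i\<in>UNIV. (x $ i) ^ (\<alpha> i)))"
  unfolding poly_fun_def by (rule exI[of _ "{\<alpha>}"], rule exI[of _ "\<lambda>_. c"]) simp

lemma poly_fun_const: "poly_fun (\<lambda>x. c)"
  using poly_fun_monomial[of c "\<lambda>_. 0"] by simp

lemma poly_fun_var: "poly_fun (\<lambda>x. x $ (i :: 'n::finite))"
proof -
  have "(\<Prod>j\<in>UNIV. (x $ j) ^ (if j = i then 1 else 0)) = x $ i" for x :: "real^'n"
    by (simp add: if_distrib[of "power _"] cong: if_cong)
  thus ?thesis using poly_fun_monomial[of 1 "\<lambda>j. if j = i then 1 else 0"] by simp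
qed

lemma poly_fun_add:
  assumes "poly_fun p" "poly_fun q"
  shows "poly_fun (\<lambda>x. p x + q x)"
proof -
  obtain S c where S: "finite S" "p = (\<lambda>x. \<Sum>\<alpha>\<in>S. c \<alpha> * (\<Prod>i\<in>UNIV. (x $ i) ^ (\<alpha> i :: nat)))"
    using assms(1) by (auto simp: poly_fun_def)
  obtain T d where T: "finite T" "q = (\<lambda>x. \<Sum>\<alpha>\<in>T. d \<alpha> * (\<Prod>i\<in>UNIV. (x $ i) ^ (\<alpha> i :: nat)))"
    using assms(2) by (auto simp: poly_fun_def)
  define e where "e \<alpha> = (if \<alpha> \<in> S then c \<alpha> else 0) + (if \<alpha> \<in> T then d \<alpha> else 0)" for \<alpha>
  have "p x + q x = (\<Sum>\<alpha>\<in>S \<union> T. e \<alpha> * (\<Prod>i\<in>UNIV. (x $ i) ^ (\<alpha> i)))" for x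
  proof -
    have 1: "(\<Sum>\<alpha>\<in>S \<union> T. (if \<alpha> \<in> S then c \<alpha> else 0) * (\<Prod>i\<in>UNIV. (x $ i) ^ (\<alpha> i))) = p x"
      unfolding S(2) by (rule sum.mono_neutral_cong_right) (use S T in auto)
    have 2: "(\<Sum>\<alpha>\<in>S \<union> T. (if \<alpha> \<in> T then d \<alpha> else 0) * (\<Prod>i\<in>UNIV. (x $ i) ^ (\<alpha> i))) = q x"
      unfolding T(2) by (rule sum.mono_neutral_cong_right) (use S T in auto)
    show ?thesis unfolding 1[symmetric] 2[symmetric] e_def distrib_right sum.distrib ..
  qed
  thus ?thesis unfolding poly_fun_def using S(1) T(1) by (intro exI[of _ "S \<union> T"] exI[of _ e]) auto
qed

lemma poly_fun_sum: "(\<And>a. a \<in> A \<Longrightarrow> poly_fun (f a)) \<Longrightarrow> poly_fun (\<lambda>x. \<Sum>a\<in>A. f a x)"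
  by (induction A rule: infinite_finite_induct) (auto intro: poly_fun_add poly_fun_const)

lemma poly_fun_mult:
  assumes "poly_fun p" "poly_fun q"
  shows "poly_fun (\<lambda>x. p x * q x)"
proof -
  obtain S c where S: "finite S" "p = (\<lambda>x. \<Sum>\<alpha>\<in>S. c \<alpha> * (\<Prod>i\<in>UNIV. (x $ i) ^ (\<alpha> i :: nat)))"
    using assms(1) by (auto simp: poly_fun_def)
  obtain T d where T: "finite T" "q = (\<lambda>x. \<Sum>\<alpha>\<in>T. d \<alpha> * (\<Prod>i\<in>UNIV. (x $ i) ^ (\<alpha> i :: nat)))"
    using assms(2) by (auto simp: poly_fun_def)
  have "(\<lambda>x. p x * q x) = (\<lambda>x. \<Sum>\<alpha>\<in>S. \<Sum>\<beta>\<in>T. (c \<alpha> * d \<beta>) * (\<Prod>i\<in>UNIV. (x $ i) ^ (\<alpha> i + \<beta> i)))"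
    unfolding S(2) T(2) sum_product by (simp add: power_add prod.distrib mult_ac)
  thus ?thesis by (simp only:) (intro poly_fun_sum poly_fun_monomial)
qed

lemma poly_fun_uminus: "poly_fun p \<Longrightarrow> poly_fun (\<lambda>x. - p x)"
  using poly_fun_mult[OF poly_fun_const[of "-1"], of p] by simp

lemma poly_fun_diff: "poly_fun p \<Longrightarrow> poly_fun q \<Longrightarrow> poly_fun (\<lambda>x. p x - q x)"
  using poly_fun_add[OF _ poly_fun_uminus, of p q] by simp

lemma poly_fun_power: "poly_fun p \<Longrightarrow> poly_fun (\<lambda>x. p x ^ k)"
  by (induction k) (auto intro: poly_fun_const poly_fun_mult)

lemma pfun_imp_poly_fun: "f \<in> pfun UNIV \<Longrightarrow> poly_fun (\<lambda>x. f (\<lambda>i. x $ i))"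
  by (induction rule: pfun.induct) (auto intro: poly_fun_const poly_fun_var poly_fun_add poly_fun_mult)

definition real_prime :: "(real^'n \<Rightarrow> real) set \<Rightarrow> bool" where
  "real_prime P \<longleftrightarrow> (\<forall>f\<in>P. poly_fun f) \<and> (\<lambda>x. 0) \<in> P \<and> (\<lambda>x. 1) \<notin> P \<and>
    (\<forall>f\<in>P. \<forall>g\<in>P. (\<lambda>x. f x + g x) \<in> P) \<and>
    (\<forall>f\<in>P. \<forall>g. poly_fun g \<longrightarrow> (\<lambda>x. g x * f x) \<in> P) \<and>
    (\<forall>f g. poly_fun f \<longrightarrow> poly_fun g \<longrightarrow> (\<lambda>x. f x * g x) \<in> P \<longrightarrow> f \<in> P \<or> g \<in> P) \<and>
    (\<forall>fs. \<forall>f\<in>set fs. (\<forall>g\<in>set fs. poly_fun g) \<longrightarrow> (\<lambda>x. \<Sum>g\<leftarrow>fs. g x * g x) \<in> P \<longrightarrow> f \<in> P)"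

text \<open>One member h of P stands for the zero set, because several conditions from P can be
  merged into a sum of squares before the theorem is applied.\<close>

definition satisfies_nullstellensatz :: "(real^'n \<Rightarrow> real) set \<Rightarrow> bool" where
  "satisfies_nullstellensatz P \<longleftrightarrow>
     (\<forall>h\<in>P. \<forall>p. poly_fun p \<longrightarrow> (\<forall>x. h x = 0 \<longrightarrow> p x = 0) \<longrightarrow> p \<in> P)"

text \<open>A putative counterexample to the Nullstellensatz is turned into a constant, so that its residue ring,
  and then a real closed field containing it, can be formed as types.\<close>

definition bad_prime :: "(real^'n \<Rightarrow> real) set" where
  "bad_prime = (if \<exists>P. real_prime P \<and> \<not> satisfies_nullstellensatz (P :: (real^'n \<Rightarrow> real) set)
     then SOME P. real_prime P \<and> \<not> satisfies_nullstellensatz P else {\<lambda>x. 0})"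

lemma poly_fun_line:
  assumes "poly_fun p"
  shows "\<exists>P. \<forall>t. p (x + t *\<^sub>R v) = poly P t"
proof -
  have "\<exists>P. \<forall>t. f (\<lambda>i. x $ i + t * v $ i) = poly P t" if "f \<in> pfun UNIV" for f
    using that
  proof (induction rule: pfun.induct)
    case (pfun_const c)
    show ?case by (rule exI[of _ "[:c:]"]) simp
  next
    case (pfun_var i)
    show ?case by (rule exI[of _ "[:x $ i, v $ i:]"]) simp
  next
    case (pfun_add f g)
    then obtain P Q where "\<And>t. f (\<lambda>i. x $ i + t * v $ i) = poly P t" "\<And>t. g (\<lambda>i. x $ i + t * v $ i) = poly Q t" by blast
    thus ?case by (intro exI[of _ "P + Q"]) simp
  next
    case (pfun_mult f g)
    then obtain P Q where "\<And>t. f (\<lambda>i. x $ i + t * v $ i) = poly P t" "\<And>t. g (\<lambda>i. x $ i + t * v $ i) = poly Q t" by blast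
    thus ?case by (intro exI[of _ "P * Q"]) simp
  qed
  from this[OF poly_fun_imp_pfun[OF assms]] show ?thesis
    by (simp add: plus_vec_def scaleR_vec_def)
qed

text \<open>Restriction to the line through a point where f is nonzero and one where g is nonzero
  reduces the claim to one variable.\<close>

lemma poly_fun_mult_eq_0:
  assumes "poly_fun f" "poly_fun g" "\<And>x. f x * g x = 0"
  shows "(\<forall>x. f x = 0) \<or> (\<forall>x. g x = 0)"
proof (rule ccontr)
  assume "\<not> ?thesis"
  then obtain x y where xy: "f x \<noteq> 0" "g y \<noteq> 0" by blast
  obtain P where P: "\<And>t. f (x + t *\<^sub>R (y - x)) = poly P t" using poly_fun_line[OF assms(1)] by blast
  obtain Q where Q: "\<And>t. g (x + t *\<^sub>R (y - x)) = poly Q t" using poly_fun_line[OF assms(2)] by blast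
  have "poly P 0 \<noteq> 0" "poly Q 1 \<noteq> 0" using xy P[of 0] Q[of 1] by auto
  hence "P * Q \<noteq> 0" by auto
  moreover have "poly (P * Q) t = 0" for t using assms(3) by (simp add: P[symmetric] Q[symmetric])
  ultimately show False using poly_all_0_iff_0 by blast
qed

text \<open>The zero ideal is the default value of \<open>bad_prime\<close>; this makes the quotient
  a domain in which sums of squares vanish only trivially, whichever case applies.\<close>

lemma real_prime_zero: "real_prime {\<lambda>x :: real^'n. 0}"
proof -
  have "f = (\<lambda>x. 0) \<or> g = (\<lambda>x. 0)" if "poly_fun f" "poly_fun g" "(\<lambda>x. f x * g x) = (\<lambda>x. 0)" for f g :: "real^'n \<Rightarrow> real"
    using poly_fun_mult_eq_0[OF that(1,2)] that(3) by (auto simp: fun_eq_iff)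
  moreover have "f = (\<lambda>x. 0)" if f: "f \<in> set fs" "(\<lambda>x. \<Sum>g\<leftarrow>fs. g x * g x) = (\<lambda>x. 0)" for f and fs :: "(real^'n \<Rightarrow> real) list"
  proof
    fix x
    have "(\<Sum>g\<leftarrow>fs. g x * g x) = 0" using f(2) by (metis)
    hence "\<forall>y\<in>set (map (\<lambda>g. g x * g x) fs). y = 0"
      by (subst (asm) sum_list_nonneg_eq_0_iff) auto
    thus "f x = 0" using f(1) by auto
  qed
  ultimately show ?thesis
    unfolding real_prime_def by (auto simp: fun_eq_iff poly_fun_const)
qed

lemma real_prime_bad_prime: "real_prime (bad_prime :: (real^'n \<Rightarrow> real) set)"
proof (cases "\<exists>P. real_prime P \<and> \<not> satisfies_nullstellensatz (P :: (real^'n \<Rightarrow> real) set)")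
  case True
  from someI_ex[OF this] show ?thesis unfolding bad_prime_def using True by simp
next
  case False
  thus ?thesis unfolding bad_prime_def by (simp only: if_False real_prime_zero)
qed

lemma
  assumes "real_prime P"
  shows real_prime_poly_fun: "f \<in> P \<Longrightarrow> poly_fun f" and real_prime_0: "(\<lambda>x. 0) \<in> P" and real_prime_1: "(\<lambda>x. 1) \<notin> P"
    and real_prime_add: "f \<in> P \<Longrightarrow> g \<in> P \<Longrightarrow> (\<lambda>x. f x + g x) \<in> P"
    and real_prime_mult: "f \<in> P \<Longrightarrow> poly_fun g \<Longrightarrow> (\<lambda>x. g x * f x) \<in> P"
    and real_prime_prime: "poly_fun f \<Longrightarrow> poly_fun g \<Longrightarrow> (\<lambda>x. f x * g x) \<in> P \<Longrightarrow> f \<in> P \<or> g \<in> P"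
    and real_prime_real: "f \<in> set fs \<Longrightarrow> (\<And>g. g \<in> set fs \<Longrightarrow> poly_fun g) \<Longrightarrow>
      (\<lambda>x. \<Sum>g\<leftarrow>fs. g x * g x) \<in> P \<Longrightarrow> f \<in> P"
proof -
  note P = assms[unfolded real_prime_def]
  have 1: "\<forall>f\<in>P. poly_fun f" using P by (elim conjE)
  show "f \<in> P \<Longrightarrow> poly_fun f" using 1 by (rule bspec)
  show "(\<lambda>x. 0) \<in> P" using P by (elim conjE)
  show "(\<lambda>x. 1) \<notin> P" using P by (elim conjE)
  have 2: "\<forall>f\<in>P. \<forall>g\<in>P. (\<lambda>x. f x + g x) \<in> P" using P by (elim conjE)
  show "f \<in> P \<Longrightarrow> g \<in> P \<Longrightarrow> (\<lambda>x. f x + g x) \<in> P" using 2[rule_format, of f g] .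
  have 3: "\<forall>f\<in>P. \<forall>g. poly_fun g \<longrightarrow> (\<lambda>x. g x * f x) \<in> P" using P by (elim conjE)
  show "f \<in> P \<Longrightarrow> poly_fun g \<Longrightarrow> (\<lambda>x. g x * f x) \<in> P" using 3[rule_format, of f g] .
  have 4: "\<forall>f g. poly_fun f \<longrightarrow> poly_fun g \<longrightarrow> (\<lambda>x. f x * g x) \<in> P \<longrightarrow> f \<in> P \<or> g \<in> P" using P by (elim conjE)
  show "poly_fun f \<Longrightarrow> poly_fun g \<Longrightarrow> (\<lambda>x. f x * g x) \<in> P \<Longrightarrow> f \<in> P \<or> g \<in> P" using 4[rule_format, of f g] .
  have 5: "\<forall>fs. \<forall>f\<in>set fs. (\<forall>g\<in>set fs. poly_fun g) \<longrightarrow> (\<lambda>x. \<Sum>g\<leftarrow>fs. g x * g x) \<in> P \<longrightarrow> f \<in> P" using P by (elim conjE)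
  show "f \<in> set fs \<Longrightarrow> (\<And>g. g \<in> set fs \<Longrightarrow> poly_fun g) \<Longrightarrow> (\<lambda>x. \<Sum>g\<leftarrow>fs. g x * g x) \<in> P \<Longrightarrow> f \<in> P"
    using 5[rule_format, of f fs] by simp
qed

lemma real_prime_diff:
  assumes "real_prime P" "f \<in> P" "g \<in> P"
  shows "(\<lambda>x. f x - g x) \<in> P"
  using real_prime_add[OF assms(1,2) real_prime_mult[OF assms(1,3) poly_fun_const[of "-1"]]] by simp

text \<open>Functions that are not polynomial are identified with \<open>0\<close>, which makes the quotient a total one.\<close>

definition as_poly :: "(real^'n \<Rightarrow> real) \<Rightarrow> real^'n \<Rightarrow> real" where
  "as_poly f = (if poly_fun f then f else (\<lambda>x. 0))"

lemma poly_fun_as_poly: "poly_fun (as_poly f)"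
  by (simp add: as_poly_def poly_fun_const)

lemma as_poly_poly_fun: "poly_fun f \<Longrightarrow> as_poly f = f"
  by (simp add: as_poly_def)

definition pq_rel :: "(real^'n \<Rightarrow> real) \<Rightarrow> (real^'n \<Rightarrow> real) \<Rightarrow> bool" where
  "pq_rel f g \<longleftrightarrow> (\<lambda>x. as_poly f x - as_poly g x) \<in> bad_prime"

lemma equivp_pq_rel: "equivp pq_rel"
proof (rule equivpI)
  show "reflp pq_rel" by (simp add: reflp_def pq_rel_def real_prime_0[OF real_prime_bad_prime])
  show "symp pq_rel"
  proof (rule sympI)
    fix f g :: "real^'n \<Rightarrow> real" assume "pq_rel f g"
    hence "(\<lambda>x. (- 1) * (as_poly f x - as_poly g x)) \<in> bad_prime"
      unfolding pq_rel_def by (rule real_prime_mult[OF real_prime_bad_prime _ poly_fun_const])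
    thus "pq_rel g f" by (simp add: pq_rel_def)
  qed
  show "transp pq_rel"
  proof (rule transpI)
    fix f g h :: "real^'n \<Rightarrow> real" assume "pq_rel f g" "pq_rel g h"
    from real_prime_add[OF real_prime_bad_prime this[unfolded pq_rel_def]] show "pq_rel f h"
      by (simp add: pq_rel_def)
  qed
qed

quotient_type (overloaded) 'n pq = "real^'n \<Rightarrow> real" / pq_rel
  by (rule equivp_pq_rel)

lemma pq_rel_mult:
  assumes "pq_rel f f'" "pq_rel g g'"
  shows "pq_rel (\<lambda>x. as_poly f x * as_poly g x) (\<lambda>x. as_poly f' x * as_poly g' x)"
proof -
  have "(\<lambda>x. as_poly f x * (as_poly g x - as_poly g' x) + as_poly g' x * (as_poly f x - as_poly f' x)) \<in> bad_prime"
    using assms unfolding pq_rel_def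
    by (intro real_prime_add[OF real_prime_bad_prime] real_prime_mult[OF real_prime_bad_prime] poly_fun_as_poly)
  thus ?thesis
    unfolding pq_rel_def
    by (simp add: as_poly_poly_fun poly_fun_mult poly_fun_as_poly algebra_simps)
qed

instantiation pq :: (finite) "{zero, one, plus, minus, uminus, times}"
begin

lift_definition zero_pq :: "'a pq" is "\<lambda>x. 0" .
lift_definition one_pq :: "'a pq" is "\<lambda>x. 1" .
lift_definition plus_pq :: "'a pq \<Rightarrow> 'a pq \<Rightarrow> 'a pq" is "\<lambda>f g x. as_poly f x + as_poly g x"
proof -
  fix f f' g g' :: "real^'a \<Rightarrow> real" assume "pq_rel f f'" "pq_rel g g'"
  from real_prime_add[OF real_prime_bad_prime this[unfolded pq_rel_def]]
  show "pq_rel (\<lambda>x. as_poly f x + as_poly g x) (\<lambda>x. as_poly f' x + as_poly g' x)"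
    by (simp add: pq_rel_def as_poly_poly_fun poly_fun_add poly_fun_as_poly algebra_simps)
qed
lift_definition minus_pq :: "'a pq \<Rightarrow> 'a pq \<Rightarrow> 'a pq" is "\<lambda>f g x. as_poly f x - as_poly g x"
proof -
  fix f f' g g' :: "real^'a \<Rightarrow> real" assume "pq_rel f f'" "pq_rel g g'"
  from real_prime_diff[OF real_prime_bad_prime this[unfolded pq_rel_def]]
  show "pq_rel (\<lambda>x. as_poly f x - as_poly g x) (\<lambda>x. as_poly f' x - as_poly g' x)"
    by (simp add: pq_rel_def as_poly_poly_fun poly_fun_diff poly_fun_as_poly algebra_simps)
qed
lift_definition uminus_pq :: "'a pq \<Rightarrow> 'a pq" is "\<lambda>f x. - as_poly f x"
proof -
  fix f f' :: "real^'a \<Rightarrow> real" assume "pq_rel f f'"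
  from real_prime_mult[OF real_prime_bad_prime this[unfolded pq_rel_def] poly_fun_const[of "-1"]]
  show "pq_rel (\<lambda>x. - as_poly f x) (\<lambda>x. - as_poly f' x)"
    by (simp add: pq_rel_def as_poly_poly_fun poly_fun_uminus poly_fun_as_poly algebra_simps)
qed
lift_definition times_pq :: "'a pq \<Rightarrow> 'a pq \<Rightarrow> 'a pq" is "\<lambda>f g x. as_poly f x * as_poly g x"
  by (rule pq_rel_mult)

instance ..

end

lemma abs_pq_eq: "poly_fun f \<Longrightarrow> poly_fun g \<Longrightarrow> abs_pq f = abs_pq g \<longleftrightarrow> (\<lambda>x. f x - g x) \<in> bad_prime"
  by (simp add: pq.abs_eq_iff pq_rel_def as_poly_poly_fun)

lemma abs_pq_0: "poly_fun f \<Longrightarrow> abs_pq f = 0 \<longleftrightarrow> f \<in> bad_prime"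
  using abs_pq_eq[OF _ poly_fun_const[of 0], of f] by (simp add: zero_pq_def)

lemma abs_pq_add: "poly_fun f \<Longrightarrow> poly_fun g \<Longrightarrow> abs_pq f + abs_pq g = abs_pq (\<lambda>x. f x + g x)"
  by (simp add: plus_pq.abs_eq as_poly_poly_fun)

lemma abs_pq_mult: "poly_fun f \<Longrightarrow> poly_fun g \<Longrightarrow> abs_pq f * abs_pq g = abs_pq (\<lambda>x. f x * g x)"
  by (simp add: times_pq.abs_eq as_poly_poly_fun)

lemma abs_pq_diff: "poly_fun f \<Longrightarrow> poly_fun g \<Longrightarrow> abs_pq f - abs_pq g = abs_pq (\<lambda>x. f x - g x)"
  by (simp add: minus_pq.abs_eq as_poly_poly_fun)

lemma abs_pq_uminus: "poly_fun f \<Longrightarrow> - abs_pq f = abs_pq (\<lambda>x. - f x)"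
  by (simp add: uminus_pq.abs_eq as_poly_poly_fun)

lemma pq_exhaust: "\<exists>f. poly_fun f \<and> a = abs_pq f"
proof -
  have "\<exists>g. poly_fun g \<and> abs_pq f = abs_pq g" for f :: "real^'a \<Rightarrow> real"
  proof -
    have "as_poly (as_poly f) = as_poly f" by (rule as_poly_poly_fun[OF poly_fun_as_poly])
    hence "abs_pq f = abs_pq (as_poly f)"
      by (simp add: pq.abs_eq_iff pq_rel_def real_prime_0[OF real_prime_bad_prime])
    thus ?thesis using poly_fun_as_poly by blast
  qed
  thus ?thesis by (rule pq.abs_induct)
qed

lemmas abs_pq_ops = abs_pq_add abs_pq_mult abs_pq_diff abs_pq_uminus poly_fun_add poly_fun_mult poly_fun_diff
  poly_fun_uminus poly_fun_const

instance pq :: (finite) idom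
proof
  fix a b c :: "'a pq"
  obtain f g h where f: "poly_fun f" "a = abs_pq f" and g: "poly_fun g" "b = abs_pq g"
    and h: "poly_fun h" "c = abs_pq h"
    using pq_exhaust by metis
  note fgh = f g h abs_pq_ops
  show "a * b * c = a * (b * c)" by (simp add: fgh mult.assoc)
  show "a * b = b * a" by (simp add: fgh mult.commute)
  show "1 * a = a" by (simp add: fgh one_pq_def)
  show "a + b + c = a + (b + c)" by (simp add: fgh add.assoc)
  show "a + b = b + a" by (simp add: fgh add.commute)
  show "0 + a = a" by (simp add: fgh zero_pq_def)
  show "- a + a = 0" by (simp add: fgh zero_pq_def)
  show "a - b = a + - b" by (simp add: fgh)
  show "(a + b) * c = a * c + b * c" by (simp add: fgh distrib_right)
  show "a * (b + c) = a * b + a * c" by (simp add: fgh distrib_left)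
  show "0 * a = 0" "a * 0 = 0" by (simp_all add: fgh zero_pq_def)
  show "(0 :: 'a pq) \<noteq> 1"
    using abs_pq_0[OF poly_fun_const[of 1]] real_prime_1[OF real_prime_bad_prime] by (metis one_pq_def)
  show "a \<noteq> 0 \<Longrightarrow> b \<noteq> 0 \<Longrightarrow> a * b \<noteq> 0"
    using real_prime_prime[OF real_prime_bad_prime f(1) g(1)] by (auto simp: fgh abs_pq_0)
qed

instance pq :: (finite) real_idom
proof
  fix xs :: "'a pq list" and x
  assume *: "(\<Sum>x\<leftarrow>xs. x * x) = 0" "x \<in> set xs"
  obtain g where g: "\<And>a :: 'a pq. poly_fun (g a)" "\<And>a. abs_pq (g a) = a" using pq_exhaust by metis
  have "map abs_pq (map g xs) = xs" by (simp add: g(2) map_idI)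
  hence "(\<forall>f\<in>set (map g xs). poly_fun f) \<and> xs = map abs_pq (map g xs)" using g(1) by auto
  then obtain fs where fs0: "\<forall>f\<in>set fs. poly_fun f" "xs = map abs_pq fs" by (elim exE conjE)
  note fs = bspec[OF fs0(1)] fs0(2)
  have "(\<Sum>x\<leftarrow>map abs_pq fs. x * x) = abs_pq (\<lambda>x. \<Sum>f\<leftarrow>fs. f x * f x) \<and> poly_fun (\<lambda>x. \<Sum>f\<leftarrow>fs. f x * f x)"
    using fs(1)
  proof (induction fs)
    case Nil
    show ?case by (simp add: zero_pq_def poly_fun_const)
  next
    case (Cons f fs)
    thus ?case by (simp add: abs_pq_ops)
  qed
  hence "(\<lambda>x. \<Sum>f\<leftarrow>fs. f x * f x) \<in> bad_prime" using *(1) fs(2) abs_pq_0[of "\<lambda>x. \<Sum>f\<leftarrow>fs. f x * f x"] by simp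
  moreover obtain f where f: "f \<in> set fs" "x = abs_pq f" using *(2) fs(2) by auto
  ultimately have "f \<in> bad_prime" by (intro real_prime_real[OF real_prime_bad_prime f(1) fs(1)])
  thus "x = 0" using f(2) abs_pq_0[OF fs(1)[OF f(1)]] by simp
qed

text \<open>Residue classes are sent to the real closure of the fraction field of the residue ring.
  Artin-Lang gives a real point at which h and p have the signs of their images. There h is 0 since
  h lies in the prime, hence p is 0 at that point, its image is 0, and p lies in the prime
  too.\<close>

lemma nullstellensatz_bad_prime: "satisfies_nullstellensatz (bad_prime :: (real^'n \<Rightarrow> real) set)"
  unfolding satisfies_nullstellensatz_def
proof (intro ballI allI impI)
  fix h p :: "real^'n \<Rightarrow> real"
  assume h: "h \<in> bad_prime" and p: "poly_fun p" and zero: "\<forall>x. h x = 0 \<longrightarrow> p x = 0"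
  define e :: "(('n \<Rightarrow> real) \<Rightarrow> real) \<Rightarrow> 'n pq fract rclos" where
    "e f = to_rclos (Fract (abs_pq (\<lambda>v. f (\<lambda>i. v $ i))) 1)" for f
  have "hom_on (pfun UNIV) e"
    unfolding hom_on_def
  proof (intro conjI ballI)
    have "Fract (abs_pq (\<lambda>v :: real^'n. 0)) 1 = 0" by (simp add: Zero_fract_def zero_pq_def)
    thus "e 0 = 0" by (simp add: e_def zero_fun_def to_rclos_hom)
    have "Fract (abs_pq (\<lambda>v :: real^'n. 1)) 1 = 1" by (simp add: One_fract_def one_pq_def)
    thus "e 1 = 1" by (simp add: e_def one_fun_def to_rclos_hom)
    fix f g :: "('n \<Rightarrow> real) \<Rightarrow> real" assume f: "f \<in> pfun UNIV" and g: "g \<in> pfun UNIV"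
    note fg = pfun_imp_poly_fun[OF f] pfun_imp_poly_fun[OF g]
    show "e (f + g) = e f + e g"
      unfolding e_def to_rclos_hom(3)[symmetric] by (simp add: plus_fun_def abs_pq_add[OF fg])
    show "e (f * g) = e f * e g"
      unfolding e_def to_rclos_hom(4)[symmetric] by (simp add: times_fun_def abs_pq_mult[OF fg])
  qed
  note e = this
  have e0: "e (\<lambda>z. f (\<chi> i. z i)) = 0 \<longleftrightarrow> f \<in> bad_prime" if "poly_fun f" for f
    using abs_pq_0[OF that] by (simp add: e_def to_rclos_hom(5) Zero_fract_def eq_fract)
  have hp: "poly_fun h" using real_prime_poly_fun[OF real_prime_bad_prime h] .
  have "\<exists>x. \<forall>l\<in>{\<lambda>z. h (\<chi> i. z i), \<lambda>z. p (\<chi> i. z i)}. sg (e l) = sg (l x)"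
    by (rule artin_lang[OF e]) (use poly_fun_imp_pfun hp p in auto)
  then obtain x where x: "sg (e (\<lambda>z. h (\<chi> i. z i))) = sg (h (\<chi> i. x i))"
    "sg (e (\<lambda>z. p (\<chi> i. z i))) = sg (p (\<chi> i. x i))" by auto
  have "h (\<chi> i. x i) = 0" using x(1) e0[OF hp] h by (metis sg_0_iff)
  hence "p (\<chi> i. x i) = 0" using zero by blast
  hence "e (\<lambda>z. p (\<chi> i. z i)) = 0" using x(2) by (metis sg_0_iff)
  thus "p \<in> bad_prime" using e0[OF p] by blast
qed

text \<open>If some P violated the claim, \<open>bad_prime\<close> would be such a P.\<close>

theorem real_nullstellensatz:
  assumes "real_prime P" "h \<in> P" "poly_fun p" "\<And>x. h x = 0 \<Longrightarrow> p x = 0"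
  shows "p \<in> P"
proof -
  have "satisfies_nullstellensatz P"
  proof (rule ccontr)
    assume "\<not> ?thesis"
    with assms(1) have ex: "\<exists>P. real_prime P \<and> \<not> satisfies_nullstellensatz (P :: (real^'a \<Rightarrow> real) set)" by blast
    have "\<not> satisfies_nullstellensatz (bad_prime :: (real^'a \<Rightarrow> real) set)"
      using someI_ex[OF ex] ex unfolding bad_prime_def by simp
    thus False using nullstellensatz_bad_prime by blast
  qed
  thus ?thesis using assms(2-4) unfolding satisfies_nullstellensatz_def by blast
qed

section \<open>Hilbert's basis theorem\<close>

inductive_set gen :: "'c::comm_ring_1 set \<Rightarrow> 'c set \<Rightarrow> 'c set" for B S where
  gen_0: "0 \<in> gen B S"
| gen_step: "a \<in> gen B S \<Longrightarrow> r \<in> B \<Longrightarrow> s \<in> S \<Longrightarrow> a + r * s \<in> gen B S"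

text \<open>Finite generation is asked for arbitrary subsets, with generators from the subset
  itself, so that the equations of an algebraic set can be thinned out directly.\<close>

definition noetherian :: "'c::comm_ring_1 set \<Rightarrow> bool" where
  "noetherian B \<longleftrightarrow> (\<forall>S\<subseteq>B. \<exists>S0\<subseteq>S. finite S0 \<and> S \<subseteq> gen B S0)"

lemma noetherianD: "noetherian B \<Longrightarrow> S \<subseteq> B \<Longrightarrow> \<exists>S0\<subseteq>S. finite S0 \<and> S \<subseteq> gen B S0"
  by (simp add: noetherian_def)

lemma gen_add: "b \<in> gen B S \<Longrightarrow> a \<in> gen B S \<Longrightarrow> a + b \<in> gen B S"
  by (induction rule: gen.induct) (auto simp: add.assoc[symmetric] intro: gen_step)

lemma gen_mult: "a \<in> gen B S \<Longrightarrow> ring_set B \<Longrightarrow> r \<in> B \<Longrightarrow> r * a \<in> gen B S"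
proof (induction rule: gen.induct)
  case (gen_step a q s)
  have "r * (a + q * s) = r * a + (r * q) * s" by (simp add: algebra_simps)
  thus ?case using gen_step gen.gen_step[of "r * a" B S "r * q" s] ring_set_mult by metis
qed (simp add: gen_0)

lemma gen_base: "ring_set B \<Longrightarrow> s \<in> S \<Longrightarrow> s \<in> gen B S"
  using gen_step[OF gen_0, of 1 B s S] by (simp add: ring_set_1)

lemma gen_trans: "a \<in> gen B S \<Longrightarrow> ring_set B \<Longrightarrow> S \<subseteq> gen B T \<Longrightarrow> a \<in> gen B T"
  by (induction rule: gen.induct) (auto intro: gen_0 gen_add gen_mult)

lemma gen_mono: "a \<in> gen B S \<Longrightarrow> S \<subseteq> T \<Longrightarrow> a \<in> gen B T"
  by (induction rule: gen.induct) (auto intro: gen_0 gen_step)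

lemma gen_subset: "a \<in> gen B S \<Longrightarrow> ring_set B \<Longrightarrow> S \<subseteq> B \<Longrightarrow> a \<in> B"
  by (induction rule: gen.induct) (auto intro: ring_set_0 ring_set_add ring_set_mult)

lemma gen_finite_support: "a \<in> gen B S \<Longrightarrow> \<exists>S0\<subseteq>S. finite S0 \<and> a \<in> gen B S0"
proof (induction rule: gen.induct)
  case gen_0
  show ?case by (rule exI[of _ "{}"]) (auto intro: gen.gen_0)
next
  case (gen_step a r s)
  then obtain S0 where S0: "S0 \<subseteq> S" "finite S0" "a \<in> gen B S0" by blast
  have "a + r * s \<in> gen B (insert s S0)"
    by (rule gen.gen_step) (use gen_mono[OF S0(3)] gen_step in auto)
  thus ?case using S0 gen_step.hyps(3) by (intro exI[of _ "insert s S0"]) auto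
qed

lemma gen_finite_support_set:
  assumes "finite G" "G \<subseteq> gen B S"
  shows "\<exists>S0\<subseteq>S. finite S0 \<and> G \<subseteq> gen B S0"
  using assms
proof (induction rule: finite_induct)
  case (insert g G)
  then obtain S0 where S0: "S0 \<subseteq> S" "finite S0" "G \<subseteq> gen B S0" by auto
  obtain S1 where S1: "S1 \<subseteq> S" "finite S1" "g \<in> gen B S1" using gen_finite_support insert.prems by blast
  have "insert g G \<subseteq> gen B (S0 \<union> S1)" using S0(3) S1(3) gen_mono by blast
  thus ?case using S0 S1 by (intro exI[of _ "S0 \<union> S1"]) auto
qed auto

lemma ring_set_polys_in:
  assumes "ring_set B"
  shows "ring_set (polys_in B)"
proof -
  have "1 \<in> polys_in B" using ring_set_0[OF assms] ring_set_1[OF assms] by (simp add: polys_in_def coeff_1)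
  thus ?thesis
    unfolding ring_set_def
    using polys_in_0[OF assms] polys_in_uminus[OF assms] polys_in_add[OF assms] polys_in_mult[OF assms] by simp
qed

text \<open>The leading coefficient argument. The sets \<open>lc d\<close> increase with d, and the
  finite set \<open>C'\<close> inside \<open>lc D\<close> generates all of them. G lifts generators
  of the levels up to D, and members of A are reduced to 0 by removing the top coefficient degree by
  degree.\<close>

theorem hilbert_basis:
  fixes B :: "'c::comm_ring_1 set"
  assumes B: "ring_set B" and noeth: "noetherian B"
  shows "noetherian (polys_in B)"
  unfolding noetherian_def
proof (intro allI impI)
  fix S assume S: "S \<subseteq> polys_in B"
  note R = ring_set_polys_in[OF B]
  define A where "A = gen (polys_in B) S"
  have AB: "f \<in> polys_in B" if "f \<in> A" for f using gen_subset[OF _ R S] that by (simp add: A_def)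
  have A_add: "f + g \<in> A" if "f \<in> A" "g \<in> A" for f g using gen_add that by (auto simp: A_def)
  have A_mult: "r * f \<in> A" if "f \<in> A" "r \<in> polys_in B" for f r using gen_mult[OF _ R] that by (auto simp: A_def)
  \<comment> \<open>Degree at most d instead of exactly d, so that 0 and sums with cancelling top
    terms belong to \<open>lc d\<close>.\<close>
  define lc where "lc d = {coeff f d |f. f \<in> A \<and> degree f \<le> d}" for d
  have lcB: "lc d \<subseteq> B" for d using AB by (auto simp: lc_def polys_in_def)
  have lc_mono: "lc d \<subseteq> lc (d + k)" for d k
  proof
    fix c assume "c \<in> lc d"
    then obtain f where f: "f \<in> A" "degree f \<le> d" "c = coeff f d" by (auto simp: lc_def)
    have "monom 1 k * f \<in> A" using A_mult f(1) polys_in_monom[OF B ring_set_1[OF B]] by blast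
    moreover have "coeff (monom 1 k * f) (d + k) = c" by (simp add: coeff_monom_mult f(3))
    moreover have "degree (monom 1 k * f) \<le> d + k"
      using degree_mult_le[of "monom (1 :: 'c) k" f] degree_monom_le[of "1 :: 'c" k] f(2) by linarith
    ultimately show "c \<in> lc (d + k)" unfolding lc_def by blast
  qed
  obtain C where C: "\<And>d. C d \<subseteq> lc d" "\<And>d. finite (C d)" "\<And>d. lc d \<subseteq> gen B (C d)"
    using noetherianD[OF noeth lcB] by metis
  have "(\<Union>d. lc d) \<subseteq> B" using lcB by blast
  from noetherianD[OF noeth this] obtain C' where C': "C' \<subseteq> (\<Union>d. lc d)" "finite C'" "(\<Union>d. lc d) \<subseteq> gen B C'"
    by (elim exE conjE)
  have "\<forall>c\<in>C'. \<exists>d. c \<in> lc d" using C'(1) by blast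
  then obtain dc where dc: "\<And>c. c \<in> C' \<Longrightarrow> c \<in> lc (dc c)" by metis
  define D where "D = Max (insert 0 (dc ` C'))"
  have C'D: "C' \<subseteq> lc D"
  proof
    fix c assume c: "c \<in> C'"
    hence "dc c \<le> D" using C'(2) by (simp add: D_def)
    thus "c \<in> lc D" using dc[OF c] lc_mono[of "dc c" "D - dc c"] by auto
  qed
  define E where "E e = (if e < D then C e else C')" for e
  have E: "E e \<subseteq> lc e" if "e \<le> D" for e using that C(1) C'D by (auto simp: E_def)
  have "\<forall>e c. \<exists>f. e \<le> D \<longrightarrow> c \<in> E e \<longrightarrow> f \<in> A \<and> degree f \<le> e \<and> coeff f e = c"
    using E unfolding lc_def by blast
  then obtain w where w: "\<And>e c. e \<le> D \<Longrightarrow> c \<in> E e \<Longrightarrow> w e c \<in> A \<and> degree (w e c) \<le> e \<and> coeff (w e c) e = c"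
    by metis
  define G where "G = (\<Union>e\<in>{..D}. w e ` E e)"
  have Gfin: "finite G" using C(2) C'(2) by (auto simp: G_def E_def)
  have GA: "G \<subseteq> A" using w by (auto simp: G_def)
  have lift: "\<exists>g\<in>gen (polys_in B) G. degree g \<le> d \<and> coeff g d = c"
    if "c \<in> gen B (E e)" and e: "e \<le> D" "e \<le> d" for c d e
    using that(1)
  proof (induction rule: gen.induct)
    case gen_0
    show ?case by (rule bexI[of _ 0]) (auto intro: gen.gen_0)
  next
    case (gen_step a r s)
    then obtain g where g: "g \<in> gen (polys_in B) G" "degree g \<le> d" "coeff g d = a" by blast
    note ws = w[OF e(1) gen_step.hyps(3)]
    define g' where "g' = g + monom r (d - e) * w e s"
    have "g' \<in> gen (polys_in B) G"
      unfolding g'_def by (rule gen.gen_step[OF g(1) polys_in_monom[OF B gen_step.hyps(2)]])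
        (use e gen_step.hyps(3) in \<open>auto simp: G_def\<close>)
    moreover have "degree (monom r (d - e) * w e s) \<le> d"
      using degree_mult_le[of "monom r (d - e)" "w e s"] degree_monom_le[of r "d - e"] ws e(2) by linarith
    hence "degree g' \<le> d" unfolding g'_def using g(2) by (intro degree_add_le)
    moreover have "coeff g' d = a + r * s" using g(3) ws e(2) by (simp add: g'_def coeff_monom_mult)
    ultimately show ?case by blast
  qed
  have "f \<in> gen (polys_in B) G" if "f \<in> A" "\<And>i. i \<ge> n \<Longrightarrow> coeff f i = 0" for n f
    using that
  proof (induction n arbitrary: f)
    case 0
    hence "f = 0" by (simp add: poly_eq_iff)
    thus ?case by (simp add: gen_0)
  next
    case (Suc n)
    \<comment> \<open>Above level D the generators of level D serve, shifted by a monomial.\<close>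
    define e where "e = min n D"
    have "degree f \<le> n" using Suc.prems(2) by (intro degree_le) auto
    hence "coeff f n \<in> lc n" using Suc.prems(1) by (auto simp: lc_def)
    hence "coeff f n \<in> gen B (E e)" using C(3)[of n] C'(3) by (auto simp: E_def e_def)
    then obtain g where g: "g \<in> gen (polys_in B) G" "degree g \<le> n" "coeff g n = coeff f n"
      using lift[of "coeff f n" e n] by (auto simp: e_def)
    have gA: "g \<in> A"
      unfolding A_def by (rule gen_trans[OF g(1) R]) (use GA in \<open>simp add: A_def\<close>)
    have m1: "- 1 \<in> polys_in B" using R ring_set_uminus ring_set_1 by blast
    have "f + - 1 * g \<in> gen (polys_in B) G"
    proof (rule Suc.IH)
      show "f + - 1 * g \<in> A" by (rule A_add[OF Suc.prems(1) A_mult[OF gA m1]])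
      show "coeff (f + - 1 * g) i = 0" if "n \<le> i" for i
        using that g(2,3) Suc.prems(2)[of i] by (cases "i = n") (auto simp: coeff_eq_0)
    qed
    from gen_add[OF g(1) this] show ?case by simp
  qed
  hence AG: "A \<subseteq> gen (polys_in B) G" using coeff_eq_0 by (metis less_eq_Suc_le subsetI)
  obtain S0 where S0: "S0 \<subseteq> S" "finite S0" "G \<subseteq> gen (polys_in B) S0"
    using gen_finite_support_set[OF Gfin, of "polys_in B" S] GA by (auto simp: A_def)
  have "s \<in> gen (polys_in B) S0" if "s \<in> S" for s
  proof -
    have "s \<in> A" using gen_base[OF R that] by (simp add: A_def)
    hence "s \<in> gen (polys_in B) G" using AG by blast
    thus ?thesis using gen_trans[OF _ R S0(3)] by blast
  qed
  thus "\<exists>S0\<subseteq>S. finite S0 \<and> S \<subseteq> gen (polys_in B) S0" using S0(1,2) by blast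
qed

lemma noetherian_pfun_insert:
  assumes "noetherian (pfun I)"
  shows "noetherian (pfun (insert i I))"
  unfolding noetherian_def
proof (intro allI impI)
  fix S assume S: "S \<subseteq> pfun (insert i I)"
  define ev where "ev P = poly P (\<lambda>x :: 'a \<Rightarrow> real. x i)" for P
  have xi: "(\<lambda>x :: 'a \<Rightarrow> real. x i) \<in> pfun (insert i I)" by (rule pfun_var) simp
  have sub: "pfun I \<subseteq> pfun (insert i I)" using pfun_mono by blast
  have evin: "ev P \<in> pfun (insert i I)" if "P \<in> polys_in (pfun I)" for P
    using hom_poly[OF ring_set_pfun hom_on_ev xi polys_in_mono[OF that sub]] by (simp add: ev_def)
  define T where "T = {P \<in> polys_in (pfun I). ev P \<in> S}"
  have "noetherian (polys_in (pfun I))" by (rule hilbert_basis[OF ring_set_pfun assms])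
  moreover have "T \<subseteq> polys_in (pfun I)" by (auto simp: T_def)
  ultimately have "\<exists>T0\<subseteq>T. finite T0 \<and> T \<subseteq> gen (polys_in (pfun I)) T0" by (rule noetherianD)
  then obtain T0 where T0: "T0 \<subseteq> T" "finite T0" "T \<subseteq> gen (polys_in (pfun I)) T0" by (elim exE conjE)
  have img: "ev P \<in> gen (pfun (insert i I)) (ev ` T0)" if "P \<in> gen (polys_in (pfun I)) T0" for P
    using that
  proof (induction rule: gen.induct)
    case gen_0
    show ?case unfolding ev_def poly_0 by (rule gen.gen_0)
  next
    case (gen_step a r s)
    have eq: "ev (a + r * s) = ev a + ev r * ev s" by (simp only: ev_def poly_add poly_mult)
    show ?case unfolding eq by (rule gen.gen_step[OF gen_step.IH evin[OF gen_step.hyps(2)] imageI[OF gen_step.hyps(3)]])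
  qed
  have "s \<in> gen (pfun (insert i I)) (ev ` T0)" if s: "s \<in> S" for s
  proof -
    have "s \<in> pfun (insert i I)" using S s by blast
    from pfun_insert_as_poly[OF this] obtain P where "P \<in> polys_in (pfun I)" "ev P = s"
      unfolding ev_def by (elim bexE)
    moreover hence "P \<in> T" using s by (simp add: T_def)
    ultimately show ?thesis using img T0(3) by blast
  qed
  moreover have "ev ` T0 \<subseteq> S" using T0(1) by (auto simp: T_def)
  ultimately show "\<exists>S0\<subseteq>S. finite S0 \<and> S \<subseteq> gen (pfun (insert i I)) S0"
    using T0(2) by (intro exI[of _ "ev ` T0"]) auto
qed

lemma noetherian_pfun_empty: "noetherian (pfun {})"
  unfolding noetherian_def
proof (intro allI impI)
  fix S :: "(('a \<Rightarrow> real) \<Rightarrow> real) set" assume S: "S \<subseteq> pfun {}"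
  show "\<exists>S0\<subseteq>S. finite S0 \<and> S \<subseteq> gen (pfun {}) S0"
  proof (cases "S \<subseteq> {0}")
    case True
    thus ?thesis by (intro exI[of _ "{}"]) (auto intro: gen_0)
  next
    case False
    then obtain s where s: "s \<in> S" "s \<noteq> 0" by blast
    then obtain c where c: "s = (\<lambda>x. c)" using S pfun_empty by blast
    hence c0: "c \<noteq> 0" using s(2) by (auto simp: zero_fun_def)
    have "t \<in> gen (pfun {}) {s}" if t: "t \<in> S" for t
    proof -
      obtain d where d: "t = (\<lambda>x. d)" using S pfun_empty t by blast
      have "t = 0 + (\<lambda>x. d / c) * s" using c0 by (simp add: fun_eq_iff c d)
      thus ?thesis using gen_step[OF gen_0 pfun_const[of "d / c"], of s "{s}"] by simp
    qed
    thus ?thesis using s(1) by (intro exI[of _ "{s}"]) auto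
  qed
qed

lemma noetherian_pfun: "finite J \<Longrightarrow> noetherian (pfun J)"
  by (induction rule: finite_induct) (auto intro: noetherian_pfun_empty noetherian_pfun_insert)

lemma gen_vanishes: "a \<in> gen B S \<Longrightarrow> (\<And>s. s \<in> S \<Longrightarrow> s z = 0) \<Longrightarrow> a z = 0"
  for a :: "'a \<Rightarrow> real"
  by (induction rule: gen.induct) auto

text \<open>Finitely many equations suffice, and over the reals a sum of squares merges them into
  one.\<close>

theorem algebraic_set_single_equation:
  fixes V :: "(real^'n) set"
  assumes "algebraic_set V"
  shows "\<exists>k. poly_fun k \<and> V = {x. k x = 0}"
proof -
  obtain S where S: "\<And>p. p \<in> S \<Longrightarrow> poly_fun p" "V = zero_set S" using assms by (auto simp: algebraic_set_def)
  define c :: "(real^'n \<Rightarrow> real) \<Rightarrow> ('n \<Rightarrow> real) \<Rightarrow> real" where "c p z = p (\<chi> i. z i)" for p z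
  have "c ` S \<subseteq> pfun UNIV" using poly_fun_imp_pfun S(1) unfolding c_def by blast
  from noetherianD[OF noetherian_pfun[OF finite_class.finite_UNIV] this]
  obtain T where T: "T \<subseteq> c ` S" "finite T" "c ` S \<subseteq> gen (pfun UNIV) T" by (elim exE conjE)
  obtain S0 where S0: "S0 \<subseteq> S" "finite S0" "T = c ` S0" using finite_subset_image[OF T(2,1)] by blast
  define k where "k x = (\<Sum>p\<in>S0. p x * p x)" for x
  have "poly_fun k" unfolding k_def using S0 S(1) by (intro poly_fun_sum poly_fun_mult) auto
  moreover have "V = {x. k x = 0}"
  proof (intro equalityI subsetI)
    fix x assume "x \<in> V"
    thus "x \<in> {x. k x = 0}" using S0(1) S(2) by (auto simp: k_def zero_set_def intro!: sum.neutral)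
  next
    fix x assume "x \<in> {x. k x = 0}"
    hence "\<forall>p\<in>S0. p x * p x = 0" using S0(2) by (simp add: k_def sum_nonneg_eq_0_iff)
    hence z: "\<And>s. s \<in> T \<Longrightarrow> s (\<lambda>i. x $ i) = 0" using S0(3) by (auto simp: c_def)
    have "p x = 0" if "p \<in> S" for p
    proof -
      have "c p \<in> gen (pfun UNIV) T" using T(3) that by blast
      hence "c p (\<lambda>i. x $ i) = 0" by (rule gen_vanishes) (rule z)
      thus ?thesis by (simp add: c_def)
    qed
    thus "x \<in> V" by (simp add: S(2) zero_set_def)
  qed
  ultimately show ?thesis by blast
qed

section \<open>Continuous rational functions\<close>

lemma path_tendsto:
  fixes F :: "real^'n \<Rightarrow> real"
  assumes "continuous_on UNIV F"
  shows "((\<lambda>t. F (x + t *\<^sub>R v)) \<longlongrightarrow> F x) (at 0)"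
proof -
  have "isCont (\<lambda>t. F (x + t *\<^sub>R v)) 0"
    by (rule continuous_at_compose[of 0 "\<lambda>t. x + t *\<^sub>R v" F, unfolded o_def])
      (use assms in \<open>auto intro!: continuous_intros simp: continuous_on_eq_continuous_at\<close>)
  thus ?thesis by (simp add: isCont_def)
qed

lemma path_eventually_nonzero:
  fixes q :: "real^'n \<Rightarrow> real"
  assumes "poly_fun q" "q y \<noteq> 0"
  shows "eventually (\<lambda>t. q (x + t *\<^sub>R (y - x)) \<noteq> 0) (at 0)"
proof -
  obtain P where P: "\<And>t. q (x + t *\<^sub>R (y - x)) = poly P t" using poly_fun_line[OF assms(1)] by blast
  have "poly P 1 \<noteq> 0" using P[of 1] assms(2) by simp
  hence "P \<noteq> 0" by auto
  hence "\<not> 0 islimpt {t. poly P t = 0}" by (intro islimpt_finite poly_roots_finite)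
  thus ?thesis by (simp add: islimpt_iff_eventually P)
qed

lemma zero_of_dense_zero:
  fixes F :: "real^'n \<Rightarrow> real"
  assumes "poly_fun s" "s y \<noteq> 0" "continuous_on UNIV F" "\<And>x. s x \<noteq> 0 \<Longrightarrow> F x = 0"
  shows "F x = 0"
proof -
  have "eventually (\<lambda>t. F (x + t *\<^sub>R (y - x)) = 0) (at 0)"
    using path_eventually_nonzero[OF assms(1,2)] by (rule eventually_mono) (use assms(4) in auto)
  hence "((\<lambda>t. F (x + t *\<^sub>R (y - x))) \<longlongrightarrow> 0) (at 0)" by (rule tendsto_eventually)
  thus ?thesis using path_tendsto[OF assms(3), of x "y - x"] tendsto_unique trivial_limit_at by blast
qed

text \<open>Clearing the denominator turns the local description into an identity that holds at the
  poles too: both sides are continuous and agree on the dense set where a nonzero polynomial s does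
  not vanish.\<close>

lemma cont_rational_iff:
  "cont_rational f \<longleftrightarrow> continuous_on UNIV f \<and>
    (\<exists>p q y. poly_fun p \<and> poly_fun q \<and> q y \<noteq> 0 \<and> (\<forall>x. q x * f x = p x))" (is "_ \<longleftrightarrow> _ \<and> ?R")
proof
  assume "cont_rational f"
  then obtain U where cont: "continuous_on UNIV f" and U: "zariski_open U" "U \<noteq> {}" "regular_on f U"
    by (auto simp: cont_rational_def)
  obtain S where S: "\<And>p. p \<in> S \<Longrightarrow> poly_fun p" "- U = zero_set S"
    using U(1) by (auto simp: zariski_open_def algebraic_set_def)
  obtain y where "y \<in> U" using U(2) by blast
  hence "y \<notin> zero_set S" using S(2) by blast
  then obtain s where s: "s \<in> S" "s y \<noteq> 0" by (auto simp: zero_set_def)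
  obtain p q where pq: "poly_fun p" "poly_fun q" "\<And>x. x \<in> U \<Longrightarrow> q x \<noteq> 0 \<and> f x = p x / q x"
    using U(3) by (auto simp: regular_on_def)
  have "q x * f x - p x = 0" for x
  proof (rule zero_of_dense_zero[where F = "\<lambda>x. q x * f x - p x"])
    show "continuous_on UNIV (\<lambda>x. q x * f x - p x)"
      by (intro continuous_on_diff continuous_on_mult cont continuous_on_poly_fun pq(1,2))
    fix x assume "s x \<noteq> 0"
    hence "x \<notin> zero_set S" using s(1) by (auto simp: zero_set_def)
    hence "x \<in> U" using S(2) by blast
    thus "q x * f x - p x = 0" using pq(3) by simp
  qed (use s S(1) in auto)
  thus "continuous_on UNIV f \<and> ?R" using cont pq(1,2) pq(3)[OF \<open>y \<in> U\<close>] by (metis eq_iff_diff_eq_0)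
next
  assume "continuous_on UNIV f \<and> ?R"
  then obtain p q y where f: "continuous_on UNIV f" "poly_fun p" "poly_fun q" "q y \<noteq> 0" "\<And>x. q x * f x = p x"
    by blast
  define U where "U = {x. q x \<noteq> 0}"
  have "- U = zero_set {q}" by (auto simp: U_def zero_set_def)
  hence "zariski_open U" unfolding zariski_open_def algebraic_set_def using f(3) by blast
  moreover have "U \<noteq> {}" using f(4) by (auto simp: U_def)
  moreover have "\<forall>x\<in>U. q x \<noteq> 0 \<and> f x = p x / q x" by (simp add: U_def f(5)[symmetric])
  hence "regular_on f U" unfolding regular_on_def using f(2,3) by blast
  ultimately show "cont_rational f" unfolding cont_rational_def using f(1) by blast
qed

lemma cont_rationalI:
  assumes "continuous_on UNIV f" "poly_fun p" "poly_fun q" "q y \<noteq> 0" "\<And>x. q x * f x = p x"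
  shows "cont_rational f"
  using assms unfolding cont_rational_iff by blast

lemma cont_rational_poly_fun: "poly_fun p \<Longrightarrow> cont_rational p"
  by (rule cont_rationalI[of p p "\<lambda>x. 1"]) (auto simp: continuous_on_poly_fun poly_fun_const)

lemma cont_rational_add_mult:
  assumes "cont_rational f" "cont_rational g"
  shows "cont_rational (\<lambda>x. f x + g x)" "cont_rational (\<lambda>x. f x * g x)"
proof -
  obtain p q y where f: "continuous_on UNIV f" "poly_fun p" "poly_fun q" "q y \<noteq> 0" "\<And>x. q x * f x = p x"
    using assms(1) unfolding cont_rational_iff by blast
  obtain a b z where g: "continuous_on UNIV g" "poly_fun a" "poly_fun b" "b z \<noteq> 0" "\<And>x. b x * g x = a x"
    using assms(2) unfolding cont_rational_iff by blast
  obtain w where w: "q w * b w \<noteq> 0" using poly_fun_mult_eq_0[OF f(3) g(3)] f(4) g(4) by blast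
  show "cont_rational (\<lambda>x. f x + g x)"
  proof (rule cont_rationalI[of _ "\<lambda>x. b x * p x + q x * a x" "\<lambda>x. q x * b x" w])
    show "q x * b x * (f x + g x) = b x * p x + q x * a x" for x
      unfolding f(5)[symmetric] g(5)[symmetric] by (simp add: algebra_simps)
  qed (use f g w in \<open>auto intro!: continuous_intros poly_fun_add poly_fun_mult\<close>)
  show "cont_rational (\<lambda>x. f x * g x)"
  proof (rule cont_rationalI[of _ "\<lambda>x. p x * a x" "\<lambda>x. q x * b x" w])
    show "q x * b x * (f x * g x) = p x * a x" for x
      unfolding f(5)[symmetric] g(5)[symmetric] by (simp add: algebra_simps)
  qed (use f g w in \<open>auto intro!: continuous_intros poly_fun_mult\<close>)
qed

lemma pfun_subst:
  "f \<in> pfun I \<Longrightarrow> (\<And>i. i \<in> I \<Longrightarrow> s i \<in> pfun J) \<Longrightarrow> (\<lambda>z. f (\<lambda>i. s i z)) \<in> pfun J"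
  by (induction rule: pfun.induct) (auto intro: pfun_const pfun_add pfun_mult)

lemma pfun_subst_poly_fun:
  "f \<in> pfun I \<Longrightarrow> (\<And>i. i \<in> I \<Longrightarrow> poly_fun (s i)) \<Longrightarrow> poly_fun (\<lambda>x. f (\<lambda>i. s i x))"
  by (induction rule: pfun.induct) (auto intro: poly_fun_const poly_fun_add poly_fun_mult)

lemma poly_fun_path:
  fixes q :: "real^'n \<Rightarrow> real"
  assumes "poly_fun q"
  shows "\<exists>D c. (\<forall>j. poly_fun (c j)) \<and> (\<forall>x t. q (x + t *\<^sub>R (y - x)) = (\<Sum>j\<le>(D::nat). c j x * t ^ j))"
proof -
  \<comment> \<open>The path parameter t becomes the extra variable \<open>None\<close>; expansion
    in it leaves coefficients that are polynomial in x.\<close>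
  define s where "s i z = z (Some i) + z None * (y $ i - z (Some i))" for i and z :: "'n option \<Rightarrow> real"
  have "(\<lambda>z. (\<lambda>z. q (\<chi> i. z i)) (\<lambda>i. s i z)) \<in> pfun (insert None (range Some))"
    by (rule pfun_subst[OF poly_fun_imp_pfun[OF assms]])
      (unfold s_def, intro pfun_add pfun_mult pfun_diff pfun_const pfun_var, auto)
  from pfun_insert_expand[OF this] obtain D b where
    b: "\<And>k. b k \<in> pfun (range Some)" "\<And>z. q (\<chi> i. s i z) = (\<Sum>k\<le>(D::nat). b k z * z None ^ k)" by blast
  define w where "w x o' = (case o' of None \<Rightarrow> 0 | Some i \<Rightarrow> x $ i)" for x :: "real^'n" and o'
  define c where "c k x = b k (w x)" for k x
  have "poly_fun (c k)" for k
  proof -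
    have "poly_fun (\<lambda>x. b k (\<lambda>o'. w x o'))"
      by (rule pfun_subst_poly_fun[OF b(1)]) (auto simp: w_def poly_fun_var)
    thus ?thesis by (simp add: c_def[abs_def])
  qed
  moreover have "q (x + t *\<^sub>R (y - x)) = (\<Sum>k\<le>D. c k x * t ^ k)" for x t
  proof -
    define z where "z = (w x)(None := t)"
    have "(\<chi> i. s i z) = x + t *\<^sub>R (y - x)" by (simp add: vec_eq_iff s_def z_def w_def)
    moreover have "b k z = b k (w x)" for k by (rule pfun_cong[OF b(1)]) (auto simp: z_def)
    ultimately show ?thesis using b(2)[of z] by (simp add: c_def) (simp add: z_def)
  qed
  ultimately show ?thesis by blast
qed

text \<open>As G converges, R vanishes at 0 while m is positive. A factor t is split off each time,
  and for m = 0 the limit is the value at 0.\<close>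

lemma coeff_of_limit:
  fixes R :: "real poly"
  assumes "\<And>t. t \<noteq> 0 \<Longrightarrow> poly R t = t ^ m * G t" "(G \<longlongrightarrow> l) (at 0)"
  shows "coeff R m = l"
  using assms(1)
proof (induction m arbitrary: R)
  case 0
  have "(poly R \<longlongrightarrow> poly R 0) (at 0)" using isCont_def by (metis poly_isCont)
  moreover have "(poly R \<longlongrightarrow> l) (at 0)"
    by (rule Lim_transform_eventually[OF assms(2)]) (use 0 in \<open>auto simp: eventually_at_filter\<close>)
  ultimately have "poly R 0 = l" using tendsto_unique trivial_limit_at by blast
  thus ?case by (simp add: poly_0_coeff_0)
next
  case (Suc m)
  have "(poly R \<longlongrightarrow> poly R 0) (at 0)" using isCont_def by (metis poly_isCont)
  moreover have "((\<lambda>t. t ^ Suc m * G t) \<longlongrightarrow> 0 ^ Suc m * l) (at 0)"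
    by (intro tendsto_intros assms(2))
  hence "(poly R \<longlongrightarrow> 0 ^ Suc m * l) (at 0)"
    by (rule Lim_transform_eventually) (use Suc.prems in \<open>auto simp: eventually_at_filter\<close>)
  ultimately have "poly R 0 = 0" using tendsto_unique trivial_limit_at by (metis mult_zero_left power_0_Suc)
  hence R0: "coeff R 0 = 0" by (simp add: poly_0_coeff_0)
  obtain a Q where R: "R = pCons a Q" by (cases R)
  hence "a = 0" using R0 by simp
  have "poly Q t = t ^ m * G t" if "t \<noteq> 0" for t
    using Suc.prems[OF that] that by (simp add: R \<open>a = 0\<close>)
  from Suc.IH[OF this] show ?case by (simp add: R)
qed

text \<open>On the path from \<open>x\<close> to a fixed point \<open>y\<close> with \<open>q y \<noteq> 0\<close>, the limit \<open>f x\<close> of \<open>p / q\<close> is the quotient of the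
  first coefficients that do not vanish; the coefficients of \<open>q\<close> sum to the nonzero constant \<open>q y\<close>, so they
  cannot all lie in \<open>P\<close>.\<close>

lemma rational_on_prime:
  fixes f :: "real^'n \<Rightarrow> real"
  assumes P: "real_prime P" and "cont_rational f"
  shows "\<exists>a b h. poly_fun a \<and> poly_fun b \<and> b \<notin> P \<and> h \<in> P \<and> (\<forall>x. h x = 0 \<longrightarrow> b x * f x = a x)"
proof -
  obtain p q y where f: "continuous_on UNIV f" "poly_fun p" "poly_fun q" "q y \<noteq> 0" "\<And>x. q x * f x = p x"
    using assms(2) unfolding cont_rational_iff by blast
  obtain D c where c: "\<And>j. poly_fun (c j)" "\<And>x t. q (x + t *\<^sub>R (y - x)) = (\<Sum>j\<le>(D::nat). c j x * t ^ j)"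
    using poly_fun_path[OF f(3)] by blast
  obtain D' d where d: "\<And>j. poly_fun (d j)" "\<And>x t. p (x + t *\<^sub>R (y - x)) = (\<Sum>j\<le>(D'::nat). d j x * t ^ j)"
    using poly_fun_path[OF f(2)] by blast
  have P_sum: "(\<lambda>x. \<Sum>j\<in>J. g j x) \<in> P" if "\<And>j. j \<in> J \<Longrightarrow> g j \<in> P" for J :: "nat set" and g
    using that by (induction J rule: infinite_finite_induct) (auto intro: real_prime_0[OF P] real_prime_add[OF P])
  have ex: "\<exists>j\<le>D. c j \<notin> P"
  proof (rule ccontr)
    assume "\<not> ?thesis"
    hence "(\<lambda>x. \<Sum>j\<le>D. c j x) \<in> P" by (intro P_sum) auto
    moreover have "(\<Sum>j\<le>D. c j x) = q y" for x using c(2)[of x 1] by simp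
    ultimately have "(\<lambda>x. q y) \<in> P" by simp
    from real_prime_mult[OF P this poly_fun_const[of "1 / q y"]] show False using f(4) real_prime_1[OF P] by simp
  qed
  define m where "m = (LEAST j. c j \<notin> P)"
  obtain j0 where j0: "j0 \<le> D" "c j0 \<notin> P" using ex by blast
  have m: "c m \<notin> P" "m \<le> D" "\<And>j. j < m \<Longrightarrow> c j \<in> P"
    using LeastI[of "\<lambda>j. c j \<notin> P", OF j0(2)] Least_le[of "\<lambda>j. c j \<notin> P", OF j0(2)] j0(1) not_less_Least[of _ "\<lambda>j. c j \<notin> P"]
    unfolding m_def by (blast, linarith, blast)
  \<comment> \<open>On the zeros of h all coefficients before the m-th vanish.\<close>
  define h where "h x = (\<Sum>j<m. c j x * c j x)" for x
  have hP: "h \<in> P" unfolding h_def using m(3) c(1) by (intro P_sum real_prime_mult[OF P]) auto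
  define b where "b x = c m x * c m x" for x
  \<comment> \<open>Beyond \<open>D'\<close> the expansion of p contributes the coefficient
    0.\<close>
  define a where "a x = c m x * (if m \<le> D' then d m x else 0)" for x
  have bP: "b \<notin> P" unfolding b_def using real_prime_prime[OF P c(1) c(1)] m(1) by blast
  have dm: "poly_fun (\<lambda>x. if m \<le> D' then d m x else 0)" using d(1)[of m] by (cases "m \<le> D'") (simp_all add: poly_fun_const)
  have pf: "poly_fun a" "poly_fun b" unfolding a_def b_def using c(1) dm by (auto intro!: poly_fun_mult)
  have "b x * f x = a x" if "h x = 0" for x
  proof (cases "c m x = 0")
    case True
    thus ?thesis by (simp add: a_def b_def)
  next
    case False
    have "\<forall>j\<in>{..<m}. c j x * c j x = 0"
      using that unfolding h_def by (subst (asm) sum_nonneg_eq_0_iff) auto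
    hence c0: "c j x = 0" if "j < m" for j using that by auto
    define G where "G t = (\<Sum>j\<in>{m..D}. c j x * t ^ (j - m)) * f (x + t *\<^sub>R (y - x))" for t
    define R where "R = (\<Sum>j\<le>D'. monom (d j x) j)"
    have "poly R t = t ^ m * G t" for t
    proof -
      have "poly R t = p (x + t *\<^sub>R (y - x))" by (simp add: R_def d(2) poly_sum poly_monom)
      also have "\<dots> = (\<Sum>j\<le>D. c j x * t ^ j) * f (x + t *\<^sub>R (y - x))" by (simp add: f(5)[symmetric] c(2))
      also have "(\<Sum>j\<le>D. c j x * t ^ j) = (\<Sum>j\<in>{m..D}. c j x * t ^ j)"
        by (rule sum.mono_neutral_right) (use c0 in auto)
      also have "\<dots> = t ^ m * (\<Sum>j\<in>{m..D}. c j x * t ^ (j - m))"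
        unfolding sum_distrib_left by (rule sum.cong) (auto simp: power_add[symmetric] mult_ac)
      finally show ?thesis by (simp add: G_def)
    qed
    moreover have "(G \<longlongrightarrow> (\<Sum>j\<in>{m..D}. c j x * 0 ^ (j - m)) * f x) (at 0)"
      unfolding G_def by (intro tendsto_intros path_tendsto[OF f(1)])
    ultimately have "coeff R m = (\<Sum>j\<in>{m..D}. c j x * 0 ^ (j - m)) * f x" by (intro coeff_of_limit)
    also have "(\<Sum>j\<in>{m..D}. c j x * 0 ^ (j - m)) = (\<Sum>j\<in>{m..D}. if j = m then c j x else 0)"
      by (rule sum.cong) auto
    also have "\<dots> = c m x" using m(2) by simp
    also have "coeff R m = (if m \<le> D' then d m x else 0)"
      unfolding R_def by (simp add: coeff_sum)
    finally show ?thesis by (simp add: a_def b_def)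
  qed
  thus ?thesis using pf bP hP by blast
qed

text \<open>The Lojasiewicz inequality bounds \<open>g ^ E / h\<close> near a zero of h; the extra
  factor in the quotient \<open>g ^ Suc E / h\<close> makes it tend to 0 there.\<close>

theorem power_divisible_of_vanishing:
  fixes g h :: "real^'n \<Rightarrow> real"
  assumes "cont_rational g" "poly_fun h" "\<And>x. h x \<ge> 0" "\<And>x. h x = 0 \<Longrightarrow> g x = 0"
  shows "\<exists>N k. cont_rational k \<and> (\<forall>x. g x ^ N = h x * k x)"
proof (cases "\<exists>y. h y \<noteq> 0")
  case False
  hence "\<forall>x. g x ^ 1 = h x * 0" using assms(4) by simp
  thus ?thesis using cont_rational_poly_fun[OF poly_fun_const[of 0]] by blast
next
  case True
  then obtain y0 where y0: "h y0 \<noteq> 0" by blast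
  obtain p q y where g: "continuous_on UNIV g" "poly_fun p" "poly_fun q" "q y \<noteq> 0" "\<And>x. q x * g x = p x"
    using assms(1) unfolding cont_rational_iff by blast
  obtain E where E: "\<And>r. \<exists>\<delta>>0. \<exists>\<kappa>>0. \<forall>x. (\<Sum>i\<in>UNIV. (x $ i)\<^sup>2) \<le> r \<longrightarrow> q x \<noteq> 0 \<longrightarrow>
    g x \<noteq> 0 \<longrightarrow> \<bar>g x\<bar> < \<delta> \<longrightarrow> \<kappa> * \<bar>g x\<bar> ^ E \<le> h x"
    using lojasiewicz_rational[OF g(2,3) assms(2) g(1,5) assms(3,4)] by blast
  \<comment> \<open>Division by 0 yields 0, so k is 0 on the zeros of h, the value that continuity
    demands.\<close>
  define k where "k x = g x ^ Suc E / h x" for x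
  have id: "g x ^ Suc E = h x * k x" for x using assms(4)[of x] by (cases "h x = 0") (auto simp: k_def)
  have "continuous_on UNIV k"
    unfolding continuous_on_eq_continuous_at[OF open_UNIV]
  proof
    fix x0 :: "real^'n"
    have gc: "isCont g x0" "isCont h x0"
      using g(1) continuous_on_poly_fun[OF assms(2), of UNIV] by (auto simp: continuous_on_eq_continuous_at)
    show "isCont k x0"
    proof (cases "h x0 = 0")
      case False
      thus ?thesis unfolding k_def using gc by (intro continuous_intros) auto
    next
      case h0: True
      define n2 where "n2 x = (\<Sum>i\<in>UNIV. (x $ i)\<^sup>2)" for x :: "real^'n"
      have n2c: "continuous_on UNIV n2" unfolding n2_def by (intro continuous_intros)
      define r where "r = n2 x0 + 1"
      obtain \<delta> \<kappa> where dk: "\<delta> > 0" "\<kappa> > 0" and low: "\<And>x. n2 x \<le> r \<Longrightarrow> q x \<noteq> 0 \<Longrightarrow> g x \<noteq> 0 \<Longrightarrow> \<bar>g x\<bar> < \<delta> \<Longrightarrow> \<kappa> * \<bar>g x\<bar> ^ E \<le> h x"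
        using E[of r] unfolding n2_def by blast
      \<comment> \<open>Points with q = 0 are reached as limits along the segment towards y, on
        which q is nonzero for all small parameters other than 0.\<close>
      have low': "\<kappa> * \<bar>g x\<bar> ^ E \<le> h x" if x: "n2 x < r" "g x \<noteq> 0" "\<bar>g x\<bar> < \<delta>" for x
      proof (rule tendsto_le[OF trivial_limit_at[of "0 :: real"]])
        let ?x = "\<lambda>t. x + t *\<^sub>R (y - x)"
        show "((\<lambda>t. h (?x t)) \<longlongrightarrow> h x) (at 0)" by (rule path_tendsto[OF continuous_on_poly_fun[OF assms(2)]])
        have gt: "((\<lambda>t. g (?x t)) \<longlongrightarrow> g x) (at 0)" by (rule path_tendsto[OF g(1)])
        show "((\<lambda>t. \<kappa> * \<bar>g (?x t)\<bar> ^ E) \<longlongrightarrow> \<kappa> * \<bar>g x\<bar> ^ E) (at 0)" by (intro tendsto_intros gt)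
        have "eventually (\<lambda>t. n2 (?x t) < r) (at 0)" using path_tendsto[OF n2c] x(1) by (rule order_tendstoD)
        moreover have "eventually (\<lambda>t. g (?x t) \<noteq> 0) (at 0)" using gt x(2) by (rule tendsto_imp_eventually_ne)
        moreover have "eventually (\<lambda>t. \<bar>g (?x t)\<bar> < \<delta>) (at 0)"
          using tendsto_rabs[OF gt] x(3) by (rule order_tendstoD)
        moreover have "eventually (\<lambda>t. q (?x t) \<noteq> 0) (at 0)" by (rule path_eventually_nonzero[of q, OF g(3,4)])
        ultimately show "eventually (\<lambda>t. \<kappa> * \<bar>g (?x t)\<bar> ^ E \<le> h (?x t)) (at 0)"
          by eventually_elim (use low in auto)
      qed
      have bound: "\<bar>k x\<bar> \<le> \<bar>g x\<bar> / \<kappa>" if x: "n2 x < r" "\<bar>g x\<bar> < \<delta>" for x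
      proof (cases "g x = 0")
        case True
        thus ?thesis by (simp add: k_def)
      next
        case False
        hence hx: "h x > 0" using assms(3)[of x] assms(4)[of x] by (cases "h x = 0") auto
        have "\<bar>k x\<bar> * \<kappa> = \<bar>g x\<bar> * (\<kappa> * \<bar>g x\<bar> ^ E) / h x" using hx by (simp add: k_def abs_mult power_abs)
        also have "\<dots> \<le> \<bar>g x\<bar> * h x / h x" using low'[OF x(1) False x(2)] hx by (intro divide_right_mono mult_left_mono) auto
        finally show ?thesis using dk hx by (simp add: field_simps)
      qed
      have g0: "g x0 = 0" using assms(4) h0 by blast
      have gt: "(g \<longlongrightarrow> 0) (at x0)" using gc(1) g0 by (simp add: isCont_def)
      have "eventually (\<lambda>x. n2 x < r) (at x0)"
      proof -
        have "(n2 \<longlongrightarrow> n2 x0) (at x0)" using n2c by (simp add: continuous_on_eq_continuous_at isCont_def)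
        thus ?thesis by (rule order_tendstoD) (simp add: r_def)
      qed
      moreover have "eventually (\<lambda>x. \<bar>g x\<bar> < \<delta>) (at x0)"
        using tendsto_rabs[OF gt] dk(1) by (intro order_tendstoD) auto
      ultimately have ev: "eventually (\<lambda>x. \<bar>k x\<bar> \<le> \<bar>g x\<bar> / \<kappa>) (at x0)" by eventually_elim (use bound in auto)
      have "((\<lambda>x. \<bar>g x\<bar> / \<kappa>) \<longlongrightarrow> \<bar>0\<bar> / \<kappa>) (at x0)" using dk by (intro tendsto_intros gt) auto
      hence "((\<lambda>x. \<bar>g x\<bar> / \<kappa>) \<longlongrightarrow> 0) (at x0)" by simp
      hence "(k \<longlongrightarrow> 0) (at x0)" by (rule Lim_null_comparison[rotated]) (use ev in simp)
      moreover have "k x0 = 0" by (simp add: k_def h0)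
      ultimately show ?thesis by (simp add: isCont_def)
    qed
  qed
  moreover obtain w where w: "q w * h w \<noteq> 0" using poly_fun_mult_eq_0[OF g(3) assms(2)] g(4) y0 by blast
  ultimately have "cont_rational k"
  proof (rule_tac cont_rationalI[of k "\<lambda>x. p x ^ Suc E" "\<lambda>x. q x ^ Suc E * h x" w])
    show "q x ^ Suc E * h x * k x = p x ^ Suc E" for x
      unfolding g(5)[symmetric] power_mult_distrib id[of x] by (simp add: mult.assoc)
  qed (use g assms(2) in \<open>auto intro!: poly_fun_mult poly_fun_power simp del: power_Suc\<close>)
  thus ?thesis using id by blast
qed

section \<open>Extending a real point to the continuous rational functions\<close>

text \<open>In the application \<open>ev\<close> is the given homomorphism composed with the passage
  from polynomials to R[V]; the extension is built before any cosets of functions come in.\<close>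

locale real_point = R: field R for R :: "('r, 'm) ring_scheme" (structure) +
  fixes ev :: "(real^'n \<Rightarrow> real) \<Rightarrow> 'r"
  assumes ev_closed: "poly_fun p \<Longrightarrow> ev p \<in> carrier R"
    and ev_add: "poly_fun p \<Longrightarrow> poly_fun q \<Longrightarrow> ev (\<lambda>x. p x + q x) = ev p \<oplus> ev q"
    and ev_mult: "poly_fun p \<Longrightarrow> poly_fun q \<Longrightarrow> ev (\<lambda>x. p x * q x) = ev p \<otimes> ev q"
    and ev_1: "ev (\<lambda>x. 1) = \<one>"
    and formally_real: "set xs \<subseteq> carrier R \<Longrightarrow> foldr (\<lambda>a s. a \<otimes> a \<oplus> s) xs \<zero> \<noteq> \<ominus> \<one>"
begin

lemma ev_0: "ev (\<lambda>x. 0) = \<zero>"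
proof -
  have "ev (\<lambda>x. 0) \<oplus> ev (\<lambda>x. 0) = ev (\<lambda>x. 0)"
    using ev_add[OF poly_fun_const[of 0] poly_fun_const[of 0]] by simp
  thus ?thesis using ev_closed[OF poly_fun_const[of 0]] R.add.l_cancel_one by blast
qed

abbreviation sqsum :: "'r list \<Rightarrow> 'r" where "sqsum xs \<equiv> foldr (\<lambda>a s. a \<otimes> a \<oplus> s) xs \<zero>"

lemma sqsum_closed: "set xs \<subseteq> carrier R \<Longrightarrow> sqsum xs \<in> carrier R"
  by (induction xs) auto

lemma sqsum_remove1:
  "set xs \<subseteq> carrier R \<Longrightarrow> x \<in> set xs \<Longrightarrow> sqsum xs = x \<otimes> x \<oplus> sqsum (remove1 x xs)"
proof (induction xs)
  case (Cons a xs)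
  show ?case
  proof (cases "a = x")
    case False
    hence x: "x \<in> set xs" "set xs \<subseteq> carrier R" "a \<in> carrier R" "x \<in> carrier R" using Cons.prems by auto
    have "set (remove1 x xs) \<subseteq> carrier R" using x(2) set_remove1_subset[of x xs] by blast
    note c = sqsum_closed[OF this] R.m_closed[OF x(3,3)] R.m_closed[OF x(4,4)]
    have "sqsum (a # xs) = a \<otimes> a \<oplus> (x \<otimes> x \<oplus> sqsum (remove1 x xs))" using Cons.IH[OF x(2,1)] by simp
    also have "\<dots> = x \<otimes> x \<oplus> (a \<otimes> a \<oplus> sqsum (remove1 x xs))" by (rule R.a_lcomm[OF c(2,3,1)])
    finally show ?thesis using False by simp
  qed simp
qed simp

lemma sqsum_scale:
  assumes "u \<in> carrier R"
  shows "set xs \<subseteq> carrier R \<Longrightarrow> sqsum (map (\<lambda>a. a \<otimes> u) xs) = (u \<otimes> u) \<otimes> sqsum xs"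
proof (induction xs)
  case Nil
  show ?case using assms by simp
next
  case (Cons a xs)
  hence a: "a \<in> carrier R" "set xs \<subseteq> carrier R" by auto
  have "(a \<otimes> u) \<otimes> (a \<otimes> u) = (u \<otimes> u) \<otimes> (a \<otimes> a)" using a(1) assms by (simp add: R.m_ac)
  thus ?case using Cons.IH[OF a(2)] a assms sqsum_closed[OF a(2)] by (simp add: R.r_distr)
qed

definition ker :: "(real^'n \<Rightarrow> real) set" where
  "ker = {p. poly_fun p \<and> ev p = \<zero>}"

lemma kerI: "poly_fun p \<Longrightarrow> ev p = \<zero> \<Longrightarrow> p \<in> ker"
  by (simp add: ker_def)

lemma kerD: "p \<in> ker \<Longrightarrow> poly_fun p" "p \<in> ker \<Longrightarrow> ev p = \<zero>"
  by (simp_all add: ker_def)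

lemma real_prime_ker: "real_prime ker"
  unfolding real_prime_def
proof (intro conjI ballI allI impI)
  show "(\<lambda>x. 0) \<in> ker" by (rule kerI[OF poly_fun_const ev_0])
  show "(\<lambda>x. 1) \<notin> ker" using kerD(2)[of "\<lambda>x. 1"] ev_1 R.one_not_zero by auto
  fix f assume f: "f \<in> ker"
  show "poly_fun f" using kerD(1)[OF f] .
  show "(\<lambda>x. f x + g x) \<in> ker" if g: "g \<in> ker" for g
    using kerD[OF f] kerD[OF g] by (intro kerI poly_fun_add) (auto simp: ev_add)
  show "(\<lambda>x. g x * f x) \<in> ker" if g: "poly_fun g" for g
    using kerD[OF f] g ev_closed[OF g] by (intro kerI poly_fun_mult) (auto simp: ev_mult)
next
  fix f g assume f: "poly_fun f" and g: "poly_fun g" and fg: "(\<lambda>x. f x * g x) \<in> ker"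
  have "ev f \<otimes> ev g = \<zero>" using kerD(2)[OF fg] ev_mult[OF f g] by simp
  hence "ev f = \<zero> \<or> ev g = \<zero>" using ev_closed[OF f] ev_closed[OF g] R.integral by blast
  thus "f \<in> ker \<or> g \<in> ker" using f g kerI by blast
next
  fix fs f assume f: "f \<in> set fs" and fs: "\<forall>g\<in>set fs. poly_fun g" and s: "(\<lambda>x. \<Sum>g\<leftarrow>fs. g x * g x) \<in> ker"
  have "ev (\<lambda>x. \<Sum>g\<leftarrow>gs. g x * g x) = sqsum (map ev gs) \<and> poly_fun (\<lambda>x. \<Sum>g\<leftarrow>gs. g x * g x)"
    if "set gs \<subseteq> set fs" for gs
    using that
  proof (induction gs)
    case Nil
    show ?case using ev_0 poly_fun_const[of 0] by simp
  next
    case (Cons g gs)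
    hence "poly_fun g" using fs by auto
    thus ?case using Cons by (simp add: ev_add ev_mult poly_fun_mult poly_fun_add)
  qed
  hence S: "sqsum (map ev fs) = \<zero>" using kerD(2)[OF s] by simp
  have c: "set (map ev fs) \<subseteq> carrier R" using fs ev_closed by auto
  show "f \<in> ker"
  proof (rule ccontr)
    assume "f \<notin> ker"
    hence nz: "ev f \<noteq> \<zero>" using fs f kerI by blast
    \<comment> \<open>Dividing the vanishing sum of squares by the square of \<open>ev f\<close>
      exhibits -1 as a sum of squares.\<close>
    define u where "u = inv (ev f)"
    define ys where "ys = remove1 (ev f) (map ev fs)"
    have evf: "ev f \<in> carrier R" using fs f ev_closed by blast
    have U: "ev f \<in> Units R" using evf nz by (simp add: R.field_Units)
    have u: "u \<in> carrier R" "ev f \<otimes> u = \<one>" unfolding u_def using U by simp_all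
    have ys: "set ys \<subseteq> carrier R" unfolding ys_def using c set_remove1_subset[of "ev f" "map ev fs"] by blast
    note yc = sqsum_closed[OF ys]
    have "ev f \<otimes> ev f \<oplus> sqsum ys = \<zero>" using sqsum_remove1[OF c, of "ev f"] f S by (simp add: ys_def)
    hence "(u \<otimes> u) \<otimes> (ev f \<otimes> ev f \<oplus> sqsum ys) = \<zero>" using u by simp
    hence "(u \<otimes> u) \<otimes> (ev f \<otimes> ev f) \<oplus> (u \<otimes> u) \<otimes> sqsum ys = \<zero>" using u evf yc by (simp add: R.r_distr)
    moreover have "(u \<otimes> u) \<otimes> (ev f \<otimes> ev f) = (ev f \<otimes> u) \<otimes> (ev f \<otimes> u)" using u(1) evf by (simp add: R.m_ac)
    moreover have "(u \<otimes> u) \<otimes> sqsum ys = sqsum (map (\<lambda>a. a \<otimes> u) ys)" using sqsum_scale[OF u(1) ys] by simp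
    ultimately have "\<one> \<oplus> sqsum (map (\<lambda>a. a \<otimes> u) ys) = \<zero>" using u(2) by simp
    moreover have c': "set (map (\<lambda>a. a \<otimes> u) ys) \<subseteq> carrier R" using ys u(1) by auto
    ultimately have "sqsum (map (\<lambda>a. a \<otimes> u) ys) = \<ominus> \<one>"
      using sqsum_closed[OF c'] by (metis R.a_comm R.minus_equality R.one_closed)
    thus False using formally_real[OF c'] by blast
  qed
qed

definition represents where
  "represents f a b h \<longleftrightarrow> poly_fun a \<and> poly_fun b \<and> b \<notin> ker \<and> h \<in> ker \<and> (\<forall>x. h x = 0 \<longrightarrow> b x * f x = a x)"

lemma represents_exists: "cont_rational f \<Longrightarrow> \<exists>a b h. represents f a b h"
  unfolding represents_def using rational_on_prime[OF real_prime_ker] by blast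

lemma ev_denominator: "represents f a b h \<Longrightarrow> ev b \<in> carrier R \<and> ev b \<noteq> \<zero> \<and> ev a \<in> carrier R"
  unfolding represents_def using ev_closed kerI by blast

text \<open>On the zeros of H, which are the common zeros of h, \<open>h'\<close> and k, both
  fractions describe the same function, so \<open>a x * b' x - a' x * b x\<close> vanishes there and
  the Nullstellensatz puts it into the kernel. The function k lets f and g differ outside its zero
  set.\<close>

lemma represents_unique:
  assumes f: "represents f a b h" and g: "represents g a' b' h'" and k: "k \<in> ker" "\<And>x. k x = 0 \<Longrightarrow> f x = g x"
  shows "ev a \<otimes> ev b' = ev a' \<otimes> ev b"
proof -
  note F = f[unfolded represents_def] and G = g[unfolded represents_def]
  define p where "p x = a x * b' x - a' x * b x" for x
  define H where "H x = h x * h x + (h' x * h' x + k x * k x)" for x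
  have pp: "poly_fun p" unfolding p_def using F G by (intro poly_fun_diff poly_fun_mult) auto
  have "H \<in> ker"
    unfolding H_def using F G k(1) kerD(1)
    by (intro real_prime_add[OF real_prime_ker] real_prime_mult[OF real_prime_ker]) auto
  moreover have "p x = 0" if "H x = 0" for x
  proof -
    have "h x = 0 \<and> h' x = 0 \<and> k x = 0"
      using that zero_le_square[of "h x"] zero_le_square[of "h' x"] zero_le_square[of "k x"]
      unfolding H_def by (metis add_nonneg_eq_0_iff add_nonneg_nonneg mult_eq_0_iff)
    hence "a x = b x * f x" "a' x = b' x * f x" using F G k(2)[of x] by auto
    thus ?thesis by (simp add: p_def)
  qed
  ultimately have "p \<in> ker" using real_nullstellensatz[OF real_prime_ker _ pp] by blast
  hence "ev (\<lambda>x. p x + a' x * b x) = \<zero> \<oplus> ev (\<lambda>x. a' x * b x)"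
    using kerD(2) ev_add[OF pp poly_fun_mult] F G by simp
  moreover have "(\<lambda>x. p x + a' x * b x) = (\<lambda>x. a x * b' x)" by (simp add: p_def)
  ultimately show ?thesis using F G ev_closed by (simp add: ev_mult)
qed

definition extend :: "(real^'n \<Rightarrow> real) \<Rightarrow> 'r" where
  "extend f = (THE r. r \<in> carrier R \<and> (\<forall>a b h. represents f a b h \<longrightarrow> r \<otimes> ev b = ev a))"

lemma extend_unique:
  assumes "represents f a b h" "r \<in> carrier R" "r \<otimes> ev b = ev a" "represents g a' b' h'"
    "k \<in> ker" "\<And>x. k x = 0 \<Longrightarrow> f x = g x"
  shows "r \<otimes> ev b' = ev a'"
proof -
  note c = ev_denominator[OF assms(1)] ev_denominator[OF assms(4)]
  have "(r \<otimes> ev b') \<otimes> ev b = (r \<otimes> ev b) \<otimes> ev b'" using assms(2) c by (simp add: R.m_ac)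
  also have "\<dots> = ev a' \<otimes> ev b" using represents_unique[OF assms(1,4,5,6)] assms(3) by simp
  finally show ?thesis using c assms(2) by (simp add: R.m_rcancel)
qed

lemma extend:
  assumes "represents f a b h"
  shows "extend f \<in> carrier R \<and> extend f \<otimes> ev b = ev a"
proof -
  note c = ev_denominator[OF assms]
  define r where "r = ev a \<otimes> inv (ev b)"
  have U: "ev b \<in> Units R" using c by (simp add: R.field_Units)
  have r: "r \<in> carrier R" "r \<otimes> ev b = ev a" unfolding r_def using c U by (simp_all add: R.m_assoc)
  have all: "r \<otimes> ev b' = ev a'" if "represents f a' b' h'" for a' b' h'
    by (rule extend_unique[OF assms r that, of "\<lambda>x. 0"]) (auto intro: kerI[OF poly_fun_const ev_0])
  have "extend f = r"
    unfolding extend_def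
  proof (rule the_equality)
    show "r \<in> carrier R \<and> (\<forall>a b h. represents f a b h \<longrightarrow> r \<otimes> ev b = ev a)" using r all by blast
    fix s assume "s \<in> carrier R \<and> (\<forall>a b h. represents f a b h \<longrightarrow> s \<otimes> ev b = ev a)"
    hence "s \<in> carrier R" "s \<otimes> ev b = r \<otimes> ev b" using assms r by auto
    thus "s = r" using R.m_rcancel[of "ev b" s r] c r(1) by simp
  qed
  thus ?thesis using r by simp
qed

lemma extend_eqI:
  assumes "represents f a b h" "r \<in> carrier R" "r \<otimes> ev b = ev a"
  shows "extend f = r"
  using extend[OF assms(1)] assms(2,3) ev_denominator[OF assms(1)] R.m_rcancel[of "ev b" "extend f" r] by simp

lemma extend_closed: "cont_rational f \<Longrightarrow> extend f \<in> carrier R"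
  using represents_exists extend by blast

lemma extend_cong:
  assumes "cont_rational f" "cont_rational g" "k \<in> ker" "\<And>x. k x = 0 \<Longrightarrow> f x = g x"
  shows "extend f = extend g"
proof -
  obtain a b h where f: "represents f a b h" using represents_exists[OF assms(1)] by blast
  obtain a' b' h' where g: "represents g a' b' h'" using represents_exists[OF assms(2)] by blast
  have "extend f \<otimes> ev b' = ev a'" using extend_unique[OF f _ _ g assms(3,4)] extend[OF f] by blast
  thus ?thesis using extend_eqI[OF g, of "extend f"] extend[OF f] by simp
qed

lemma extend_poly_fun: "poly_fun p \<Longrightarrow> extend p = ev p"
proof (rule extend_eqI[of p p "\<lambda>x. 1" "\<lambda>x. 0"])
  assume p: "poly_fun p"
  show "represents p p (\<lambda>x. 1) (\<lambda>x. 0)"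
    unfolding represents_def using p poly_fun_const real_prime_0[OF real_prime_ker] real_prime_1[OF real_prime_ker] by simp
  show "ev p \<in> carrier R" "ev p \<otimes> ev (\<lambda>x. 1) = ev p" using ev_closed[OF p] by (simp_all add: ev_1)
qed

lemma extend_add_mult:
  assumes "cont_rational f" "cont_rational g"
  shows "extend (\<lambda>x. f x + g x) = extend f \<oplus> extend g" "extend (\<lambda>x. f x * g x) = extend f \<otimes> extend g"
proof -
  obtain a b h where f: "represents f a b h" using represents_exists[OF assms(1)] by blast
  obtain a' b' h' where g: "represents g a' b' h'" using represents_exists[OF assms(2)] by blast
  note F = f[unfolded represents_def] and G = g[unfolded represents_def]
  define H where "H x = h x * h x + h' x * h' x" for x
  have H: "H \<in> ker"
    unfolding H_def using F G kerD(1)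
    by (intro real_prime_add[OF real_prime_ker] real_prime_mult[OF real_prime_ker]) auto
  have H0: "h x = 0" "h' x = 0" if "H x = 0" for x
    using that zero_le_square[of "h x"] zero_le_square[of "h' x"] unfolding H_def
    by (metis add_nonneg_eq_0_iff mult_eq_0_iff)+
  have bb: "poly_fun (\<lambda>x. b x * b' x)" "(\<lambda>x. b x * b' x) \<notin> ker"
    using F G real_prime_prime[OF real_prime_ker] poly_fun_mult by blast+
  note c = ev_denominator[OF f] ev_denominator[OF g] extend[OF f] extend[OF g]
  have evbb: "ev (\<lambda>x. b x * b' x) = ev b \<otimes> ev b'" using F G by (simp add: ev_mult)
  have distr: "(r \<oplus> s) \<otimes> (u \<otimes> v) = (r \<otimes> u) \<otimes> v \<oplus> (s \<otimes> v) \<otimes> u"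
    and rearrange: "(r \<otimes> s) \<otimes> (u \<otimes> v) = (r \<otimes> u) \<otimes> (s \<otimes> v)"
    if "r \<in> carrier R" "s \<in> carrier R" "u \<in> carrier R" "v \<in> carrier R" for r s u v
    using that by (simp_all add: R.l_distr R.r_distr R.m_ac)
  have "represents (\<lambda>x. f x + g x) (\<lambda>x. a x * b' x + a' x * b x) (\<lambda>x. b x * b' x) H"
    unfolding represents_def
  proof (intro conjI allI impI bb H)
    show "poly_fun (\<lambda>x. a x * b' x + a' x * b x)" using F G by (intro poly_fun_add poly_fun_mult) auto
    fix x assume "H x = 0"
    hence "a x = b x * f x" "a' x = b' x * g x" using F G H0[of x] by auto
    thus "b x * b' x * (f x + g x) = a x * b' x + a' x * b x" by (simp add: algebra_simps)
  qed
  moreover have "(extend f \<oplus> extend g) \<otimes> ev (\<lambda>x. b x * b' x) = ev (\<lambda>x. a x * b' x + a' x * b x)"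
  proof -
    have "(extend f \<oplus> extend g) \<otimes> (ev b \<otimes> ev b') = (extend f \<otimes> ev b) \<otimes> ev b' \<oplus> (extend g \<otimes> ev b') \<otimes> ev b"
      by (rule distr) (use c in auto)
    also have "\<dots> = ev a \<otimes> ev b' \<oplus> ev a' \<otimes> ev b" using c by simp
    also have "\<dots> = ev (\<lambda>x. a x * b' x + a' x * b x)" using F G by (simp add: ev_add ev_mult poly_fun_mult)
    finally show ?thesis by (simp add: evbb)
  qed
  ultimately show "extend (\<lambda>x. f x + g x) = extend f \<oplus> extend g" using c by (intro extend_eqI) auto
  have "represents (\<lambda>x. f x * g x) (\<lambda>x. a x * a' x) (\<lambda>x. b x * b' x) H"
    unfolding represents_def
  proof (intro conjI allI impI bb H)
    show "poly_fun (\<lambda>x. a x * a' x)" using F G by (intro poly_fun_mult) auto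
    fix x assume "H x = 0"
    hence "a x = b x * f x" "a' x = b' x * g x" using F G H0[of x] by auto
    thus "b x * b' x * (f x * g x) = a x * a' x" by (simp add: algebra_simps)
  qed
  moreover have "(extend f \<otimes> extend g) \<otimes> ev (\<lambda>x. b x * b' x) = ev (\<lambda>x. a x * a' x)"
  proof -
    have "(extend f \<otimes> extend g) \<otimes> (ev b \<otimes> ev b') = (extend f \<otimes> ev b) \<otimes> (extend g \<otimes> ev b')"
      by (rule rearrange) (use c in auto)
    also have "\<dots> = ev a \<otimes> ev a'" using c by simp
    also have "\<dots> = ev (\<lambda>x. a x * a' x)" using F G by (simp add: ev_mult)
    finally show ?thesis by (simp add: evbb)
  qed
  ultimately show "extend (\<lambda>x. f x * g x) = extend f \<otimes> extend g" using c by (intro extend_eqI) auto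
qed

lemma extension_unique:
  assumes cl: "\<And>f. cont_rational f \<Longrightarrow> e f \<in> carrier R"
    and add: "\<And>f g. cont_rational f \<Longrightarrow> cont_rational g \<Longrightarrow> e (\<lambda>x. f x + g x) = e f \<oplus> e g"
    and mult: "\<And>f g. cont_rational f \<Longrightarrow> cont_rational g \<Longrightarrow> e (\<lambda>x. f x * g x) = e f \<otimes> e g"
    and poly: "\<And>p. poly_fun p \<Longrightarrow> e p = ev p"
    and f: "cont_rational f"
  shows "e f = extend f"
proof -
  obtain a b h where r: "represents f a b h" using represents_exists[OF f] by blast
  note F = r[unfolded represents_def]
  define g where "g x = b x * f x + - a x" for x
  have cb: "cont_rational b" "cont_rational a" using F cont_rational_poly_fun by auto
  have ma: "cont_rational (\<lambda>x. - a x)" using F cont_rational_poly_fun[OF poly_fun_uminus] by blast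
  have g: "cont_rational g"
    unfolding g_def by (intro cont_rational_add_mult(1) cont_rational_add_mult(2) cb f ma)
  \<comment> \<open>A nonnegative equation with the same zeros as h, as
    \<open>power_divisible_of_vanishing\<close> expects.\<close>
  define h2 where "h2 x = h x * h x" for x
  have h2: "h2 \<in> ker" unfolding h2_def using F kerD(1) by (intro real_prime_mult[OF real_prime_ker]) auto
  obtain N k where k: "cont_rational k" "\<And>x. g x ^ N = h2 x * k x"
    using power_divisible_of_vanishing[OF g kerD(1)[OF h2]] F by (auto simp: g_def h2_def)
  have "e (\<lambda>x. h2 x * k x) = \<zero>"
    using mult[OF cont_rational_poly_fun[OF kerD(1)[OF h2]] k(1)] poly[OF kerD(1)[OF h2]] kerD(2)[OF h2] cl[OF k(1)] by simp
  hence gN: "e (\<lambda>x. g x ^ N) = \<zero>" using k(2) by simp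
  have pw: "cont_rational (\<lambda>x. g x ^ n)" for n
  proof (induction n)
    case 0
    show ?case using cont_rational_poly_fun[OF poly_fun_const[of 1]] by simp
  next
    case (Suc n)
    show ?case using cont_rational_add_mult(2)[OF g Suc.IH] by simp
  qed
  \<comment> \<open>R has no zero divisors, so a vanishing power forces e g = 0; the exponent 0 is
    excluded by 1 \<noteq> 0.\<close>
  have "e (\<lambda>x. g x ^ n) = \<zero> \<Longrightarrow> e g = \<zero>" for n
  proof (induction n)
    case 0
    thus ?case using poly[OF poly_fun_const[of 1]] ev_1 by simp
  next
    case (Suc n)
    have "e g \<otimes> e (\<lambda>x. g x ^ n) = \<zero>" using Suc.prems mult[OF g pw[of n]] by simp
    thus ?case using Suc.IH R.integral cl[OF g] cl[OF pw[of n]] by blast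
  qed
  hence eg: "e g = \<zero>" using gN by blast
  have "(\<lambda>x. b x * f x) = (\<lambda>x. g x + a x)" by (simp add: g_def)
  hence "e b \<otimes> e f = e g \<oplus> e a"
    using mult[OF cb(1) f] add[OF g cb(2)] by simp
  hence "e f \<otimes> ev b = ev a" using eg poly F cl[OF f] cl[OF cb(1)] cl[OF cb(2)] by (simp add: R.m_comm)
  thus ?thesis using extend_eqI[OF r cl[OF f]] by simp
qed

end

section \<open>The substitution property\<close>

lemma fun_ring_simps [simp]:
  "carrier (fun_ring C) = C" "\<one>\<^bsub>fun_ring C\<^esub> = (\<lambda>x. 1)" "\<zero>\<^bsub>fun_ring C\<^esub> = (\<lambda>x. 0)"
  "f \<oplus>\<^bsub>fun_ring C\<^esub> g = (\<lambda>x. f x + g x)" "f \<otimes>\<^bsub>fun_ring C\<^esub> g = (\<lambda>x. f x * g x)"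
  by (simp_all add: fun_ring_def)

lemma cring_fun_ring:
  assumes "(\<lambda>x. 0) \<in> C" "(\<lambda>x. 1) \<in> C" "\<And>f g. f \<in> C \<Longrightarrow> g \<in> C \<Longrightarrow> (\<lambda>x. f x + g x) \<in> C"
    "\<And>f g. f \<in> C \<Longrightarrow> g \<in> C \<Longrightarrow> (\<lambda>x. f x * g x) \<in> C" "\<And>f. f \<in> C \<Longrightarrow> (\<lambda>x. - f x) \<in> C"
  shows "cring (fun_ring C)"
proof (rule cringI)
  show "abelian_group (fun_ring C)"
  proof (rule abelian_groupI)
    fix f assume "f \<in> carrier (fun_ring C)"
    thus "\<exists>g\<in>carrier (fun_ring C). g \<oplus>\<^bsub>fun_ring C\<^esub> f = \<zero>\<^bsub>fun_ring C\<^esub>"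
      using assms(5) by (intro bexI[of _ "\<lambda>x. - f x"]) auto
  qed (use assms in \<open>auto simp: algebra_simps\<close>)
  show "comm_monoid (fun_ring C)"
    by (rule comm_monoidI) (use assms in \<open>auto simp: algebra_simps\<close>)
qed (auto simp: algebra_simps)

lemma ideal_fun_ring:
  assumes C: "cring (fun_ring C)" and m1: "(\<lambda>x. - 1) \<in> C" and "I \<subseteq> C" "(\<lambda>x. 0) \<in> I"
    "\<And>f g. f \<in> I \<Longrightarrow> g \<in> I \<Longrightarrow> (\<lambda>x. f x + g x) \<in> I" and mult: "\<And>f g. f \<in> I \<Longrightarrow> g \<in> C \<Longrightarrow> (\<lambda>x. g x * f x) \<in> I"
  shows "ideal I (fun_ring C)"
proof -
  interpret C: cring "fun_ring C" by (rule C)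
  show ?thesis
  proof (rule idealI[OF C.ring_axioms])
    show "subgroup I (add_monoid (fun_ring C))"
    proof (rule group.subgroupI[OF C.a_group])
      fix f assume f: "f \<in> I"
      have nf: "(\<lambda>x. - f x) \<in> I" using mult[OF f m1] by simp
      have "\<ominus>\<^bsub>fun_ring C\<^esub> f = (\<lambda>x. - f x)"
        by (rule C.minus_equality) (use f nf assms(3) in auto)
      thus "inv\<^bsub>add_monoid (fun_ring C)\<^esub> f \<in> I" using nf by (simp add: a_inv_def)
    qed (use assms in auto)
  qed (use mult in \<open>auto simp: mult.commute\<close>)
qed

lemma mem_coset_fun_ring: "f \<in> J +>\<^bsub>fun_ring C\<^esub> g \<longleftrightarrow> (\<exists>j\<in>J. f = (\<lambda>x. j x + g x))"
  by (auto simp: a_r_coset_def')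

lemma cring_poly_ring: "cring Defs.poly_ring"
  unfolding Defs.poly_ring_def
  by (rule cring_fun_ring) (auto intro: poly_fun_const poly_fun_add poly_fun_mult poly_fun_uminus)

lemma cont_rational_uminus: "cont_rational f \<Longrightarrow> cont_rational (\<lambda>x. - f x)"
  using cont_rational_add_mult(2)[OF cont_rational_poly_fun[OF poly_fun_const[of "- 1"]], of f] by simp

lemma cring_R0_ring: "cring R0_ring"
  unfolding R0_ring_def
  by (rule cring_fun_ring)
    (auto intro: cont_rational_poly_fun poly_fun_const cont_rational_add_mult cont_rational_uminus)

lemma ideal_vanishing_ideal: "ideal (vanishing_ideal V) Defs.poly_ring"
  using cring_poly_ring unfolding Defs.poly_ring_def
  by (rule ideal_fun_ring) (auto simp: vanishing_ideal_def intro: poly_fun_const poly_fun_add poly_fun_mult)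

lemma mem_regulous_ideal: "f \<in> regulous_ideal V \<longleftrightarrow> cont_rational f \<and> (\<forall>x\<in>V. f x = 0)"
  by (auto simp: regulous_ideal_def)

lemma ideal_regulous_ideal: "ideal (regulous_ideal V) R0_ring"
  using cring_R0_ring unfolding R0_ring_def
  by (rule ideal_fun_ring)
    (auto simp: mem_regulous_ideal intro: cont_rational_poly_fun poly_fun_const cont_rational_add_mult)

lemma carrier_poly_ring: "carrier Defs.poly_ring = {p. poly_fun p}"
  by (simp add: Defs.poly_ring_def)

lemma carrier_R0_ring: "carrier R0_ring = {f. cont_rational f}"
  by (simp add: R0_ring_def)

lemma carrier_coord_ring: "C \<in> carrier (coord_ring V) \<longleftrightarrow> (\<exists>p. poly_fun p \<and> C = vanishing_ideal V +>\<^bsub>Defs.poly_ring\<^esub> p)"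
  by (auto simp: coord_ring_def FactRing_def A_RCOSETS_def' carrier_poly_ring)

lemma carrier_regulous_ring: "C \<in> carrier (regulous_ring V) \<longleftrightarrow> (\<exists>f. cont_rational f \<and> C = regulous_ideal V +>\<^bsub>R0_ring\<^esub> f)"
  by (auto simp: regulous_ring_def FactRing_def A_RCOSETS_def' carrier_R0_ring)

lemma regulous_coset_eq:
  assumes "cont_rational f" "cont_rational g" "\<And>x. x \<in> V \<Longrightarrow> f x = g x"
  shows "regulous_ideal V +>\<^bsub>R0_ring\<^esub> f = regulous_ideal V +>\<^bsub>R0_ring\<^esub> g"
proof -
  have *: "h \<in> regulous_ideal V +>\<^bsub>R0_ring\<^esub> g" if h: "h \<in> regulous_ideal V +>\<^bsub>R0_ring\<^esub> f"
    and fg: "cont_rational f" "cont_rational g" "\<And>x. x \<in> V \<Longrightarrow> f x = g x" for f g h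
  proof -
    obtain j where j: "j \<in> regulous_ideal V" "h = (\<lambda>x. j x + f x)"
      using h by (auto simp: R0_ring_def mem_coset_fun_ring)
    define i where "i x = j x + (f x + - g x)" for x
    have "cont_rational i" unfolding i_def
      using j(1) fg by (intro cont_rational_add_mult(1) cont_rational_uminus) (auto simp: regulous_ideal_def)
    moreover have "i x = 0" if "x \<in> V" for x using that fg(3) j(1) by (auto simp: i_def regulous_ideal_def)
    ultimately have "i \<in> regulous_ideal V" by (auto simp: regulous_ideal_def)
    moreover have "h = (\<lambda>x. i x + g x)" by (simp add: i_def j(2))
    ultimately show ?thesis by (auto simp: R0_ring_def mem_coset_fun_ring)
  qed
  show ?thesis using *[of _ f g] *[of _ g f] assms by fastforce
qed

text \<open>All polynomials of one class agree on V, so the union in \<open>struct_map\<close> runs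
  over equal cosets.\<close>

lemma struct_map_coset:
  assumes "poly_fun p"
  shows "struct_map V (vanishing_ideal V +>\<^bsub>Defs.poly_ring\<^esub> p) = regulous_ideal V +>\<^bsub>R0_ring\<^esub> p"
proof -
  let ?C = "vanishing_ideal V +>\<^bsub>Defs.poly_ring\<^esub> p"
  have "regulous_ideal V +>\<^bsub>R0_ring\<^esub> q = regulous_ideal V +>\<^bsub>R0_ring\<^esub> p" if q: "q \<in> ?C" for q
  proof -
    obtain j where j: "j \<in> vanishing_ideal V" "q = (\<lambda>x. j x + p x)"
      using q by (auto simp: Defs.poly_ring_def mem_coset_fun_ring)
    show ?thesis
      by (rule regulous_coset_eq)
        (use j assms in \<open>auto simp: vanishing_ideal_def intro!: cont_rational_poly_fun poly_fun_add\<close>)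
  qed
  moreover have "p \<in> ?C"
    unfolding Defs.poly_ring_def mem_coset_fun_ring
    by (rule bexI[of _ "\<lambda>x. 0"]) (auto simp: vanishing_ideal_def poly_fun_const)
  ultimately show ?thesis unfolding struct_map_def by blast
qed

theorem theorem2p13:
  fixes V :: "(real^'n) set"
  assumes "algebraic_set V" and "irreducible_alg V" and "central V"
  shows "substitution_property (coord_ring V) (regulous_ring V) (struct_map V)
           TYPE(('r, 'm) ring_scheme)"
  unfolding substitution_property_def
proof (intro allI impI)
  fix R :: "('r, 'm) ring_scheme" and \<phi>
  assume *: "real_closed_field R \<and> \<phi> \<in> ring_hom (coord_ring V) R"
  define I where "I = vanishing_ideal V"
  define J where "J = regulous_ideal V"
  define ev where "ev p = \<phi> (I +>\<^bsub>Defs.poly_ring\<^esub> p)" for p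
  define cls where "cls f = J +>\<^bsub>R0_ring\<^esub> f" for f
  interpret I: ideal I Defs.poly_ring unfolding I_def by (rule ideal_vanishing_ideal)
  interpret J: ideal J R0_ring unfolding J_def by (rule ideal_regulous_ideal)
  have "(+>\<^bsub>Defs.poly_ring\<^esub>) I \<in> ring_hom Defs.poly_ring (coord_ring V)"
    unfolding coord_ring_def I_def[symmetric] by (rule I.rcos_ring_hom)
  from ring_hom_trans[OF this] have "\<phi> \<circ> (+>\<^bsub>Defs.poly_ring\<^esub>) I \<in> ring_hom Defs.poly_ring R" using * by blast
  moreover have "\<phi> \<circ> (+>\<^bsub>Defs.poly_ring\<^esub>) I = ev" by (simp add: fun_eq_iff ev_def)
  ultimately have ev: "ev \<in> ring_hom Defs.poly_ring R" by simp
  have cls: "cls \<in> ring_hom R0_ring (regulous_ring V)"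
    unfolding regulous_ring_def J_def[symmetric] cls_def[abs_def] by (rule J.rcos_ring_hom)
  have carr: "poly_fun p \<longleftrightarrow> p \<in> carrier Defs.poly_ring" "cont_rational f \<longleftrightarrow> f \<in> carrier R0_ring" for p f
    by (simp_all add: carrier_poly_ring carrier_R0_ring)
  have cls_add: "cls (\<lambda>x. f x + g x) = cls f \<oplus>\<^bsub>regulous_ring V\<^esub> cls g"
    and cls_mult: "cls (\<lambda>x. f x * g x) = cls f \<otimes>\<^bsub>regulous_ring V\<^esub> cls g"
    if "cont_rational f" "cont_rational g" for f g
    using ring_hom_add[OF cls, of f g] ring_hom_mult[OF cls, of f g] that by (simp_all add: R0_ring_def)
  have cls_closed: "cls f \<in> carrier (regulous_ring V)" if "cont_rational f" for f
    using ring_hom_closed[OF cls, of f] that by (simp add: R0_ring_def)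
  have cls_one: "cls (\<lambda>x. 1) = \<one>\<^bsub>regulous_ring V\<^esub>"
    using ring_hom_one[OF cls] by (simp add: R0_ring_def)
  have cls_exhaust: "\<exists>f. cont_rational f \<and> C = cls f" if "C \<in> carrier (regulous_ring V)" for C
    using that by (simp add: carrier_regulous_ring cls_def J_def)
  interpret real_point R ev
  proof (rule real_point.intro)
    show "field R" using * by (simp add: real_closed_field_def)
    show "real_point_axioms R ev"
    proof
      fix p q :: "real^'n \<Rightarrow> real"
      show "ev p \<in> carrier R" if "poly_fun p" using ring_hom_closed[OF ev, of p] that by (simp add: carr)
      show "ev (\<lambda>x. p x + q x) = ev p \<oplus>\<^bsub>R\<^esub> ev q" "ev (\<lambda>x. p x * q x) = ev p \<otimes>\<^bsub>R\<^esub> ev q" if "poly_fun p" "poly_fun q"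
        using ring_hom_add[OF ev, of p q] ring_hom_mult[OF ev, of p q] that by (simp_all add: Defs.poly_ring_def)
      show "ev (\<lambda>x. 1) = \<one>\<^bsub>R\<^esub>" using ring_hom_one[OF ev] by (simp add: Defs.poly_ring_def)
      show "foldr (\<lambda>a s. a \<otimes>\<^bsub>R\<^esub> a \<oplus>\<^bsub>R\<^esub> s) xs \<zero>\<^bsub>R\<^esub> \<noteq> \<ominus>\<^bsub>R\<^esub> \<one>\<^bsub>R\<^esub>" if "set xs \<subseteq> carrier R" for xs
        using * that unfolding real_closed_field_def by blast
    qed
  qed
  obtain k where k: "poly_fun k" "V = {x. k x = 0}" using algebraic_set_single_equation[OF assms(1)] by blast
  have kI: "k \<in> I" using k by (simp add: I_def vanishing_ideal_def)
  have zI: "(\<lambda>x. 0) \<in> I" by (simp add: I_def vanishing_ideal_def poly_fun_const)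
  \<comment> \<open>k and 0 lie in the same class modulo the ideal of V.\<close>
  have "ev k = ev (\<lambda>x. 0)" unfolding ev_def I.a_rcos_const[OF kI] I.a_rcos_const[OF zI] ..
  hence kker: "k \<in> ker" using kerI[OF k(1)] ev_0 by simp
  \<comment> \<open>Any continuous rational member of the class serves: two of them agree on V, the
    zero set of k, and \<open>extend_cong\<close> identifies their extensions.\<close>
  define \<psi> where "\<psi> C = extend (SOME f. f \<in> C \<and> cont_rational f)" for C
  have psi: "\<psi> (cls f) = extend f" if f: "cont_rational f" for f
  proof -
    have "f \<in> cls f"
      unfolding cls_def R0_ring_def mem_coset_fun_ring
      by (rule bexI[of _ "\<lambda>x. 0"]) (auto simp: J_def regulous_ideal_def intro: cont_rational_poly_fun poly_fun_const)
    hence "\<exists>g. g \<in> cls f \<and> cont_rational g" using f by blast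
    from someI_ex[OF this] obtain g where g: "g \<in> cls f" "cont_rational g" "\<psi> (cls f) = extend g"
      by (auto simp: \<psi>_def)
    obtain j where j: "j \<in> J" "g = (\<lambda>x. j x + f x)" using g(1) by (auto simp: cls_def R0_ring_def mem_coset_fun_ring)
    have "g x = f x" if "k x = 0" for x using that j k(2) by (auto simp: J_def regulous_ideal_def)
    hence "extend g = extend f" using extend_cong[OF g(2) f kker] by blast
    thus ?thesis using g(3) by simp
  qed
  have hom: "\<psi> \<in> ring_hom (regulous_ring V) R"
  proof (rule ring_hom_memI)
    show "\<psi> \<one>\<^bsub>regulous_ring V\<^esub> = \<one>\<^bsub>R\<^esub>"
      unfolding cls_one[symmetric]
      using psi[OF cont_rational_poly_fun[OF poly_fun_const]] extend_poly_fun[OF poly_fun_const] ev_1 by simp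
    fix C assume "C \<in> carrier (regulous_ring V)"
    then obtain f where f: "cont_rational f" "C = cls f" using cls_exhaust by blast
    show "\<psi> C \<in> carrier R" using psi[OF f(1)] extend_closed[OF f(1)] f(2) by simp
    fix D assume "D \<in> carrier (regulous_ring V)"
    then obtain g where g: "cont_rational g" "D = cls g" using cls_exhaust by blast
    show "\<psi> (C \<otimes>\<^bsub>regulous_ring V\<^esub> D) = \<psi> C \<otimes>\<^bsub>R\<^esub> \<psi> D" "\<psi> (C \<oplus>\<^bsub>regulous_ring V\<^esub> D) = \<psi> C \<oplus>\<^bsub>R\<^esub> \<psi> D"
      unfolding f(2) g(2) cls_mult[OF f(1) g(1), symmetric] cls_add[OF f(1) g(1), symmetric]
      using psi f(1) g(1) cont_rational_add_mult[OF f(1) g(1)] extend_add_mult[OF f(1) g(1)] by simp_all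
  qed
  have sm: "struct_map V (I +>\<^bsub>Defs.poly_ring\<^esub> p) = cls p" if "poly_fun p" for p
    using struct_map_coset[OF that] by (simp add: I_def cls_def J_def)
  have ext: "\<psi> (struct_map V a) = \<phi> a" if "a \<in> carrier (coord_ring V)" for a
  proof -
    obtain p where p: "poly_fun p" "a = I +>\<^bsub>Defs.poly_ring\<^esub> p" using \<open>a \<in> _\<close> by (auto simp: carrier_coord_ring I_def)
    have "\<psi> (struct_map V a) = ev p"
      using sm[OF p(1)] psi[OF cont_rational_poly_fun[OF p(1)]] extend_poly_fun[OF p(1)] p(2) by simp
    thus ?thesis by (simp add: ev_def p(2))
  qed
  have uniq: "\<psi>' b = \<psi> b"
    if h: "\<psi>' \<in> ring_hom (regulous_ring V) R" "\<forall>a\<in>carrier (coord_ring V). \<psi>' (struct_map V a) = \<phi> a"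
      and b: "b \<in> carrier (regulous_ring V)" for \<psi>' b
  proof -
    obtain f where f: "cont_rational f" "b = cls f" using cls_exhaust[OF b] by blast
    have "\<psi>' (cls f) = extend f"
    \<comment> \<open>Composed with \<open>cls\<close>, the competitor \<open>\<psi>'\<close>
      becomes an extension of \<open>ev\<close> to all continuous rational functions.\<close>
    proof (rule extension_unique[where e = "\<lambda>f. \<psi>' (cls f)"])
      fix g g' :: "real^'n \<Rightarrow> real" assume g: "cont_rational g"
      show "\<psi>' (cls g) \<in> carrier R" using ring_hom_closed[OF h(1) cls_closed[OF g]] .
      assume g': "cont_rational g'"
      show "\<psi>' (cls (\<lambda>x. g x + g' x)) = \<psi>' (cls g) \<oplus>\<^bsub>R\<^esub> \<psi>' (cls g')"
        unfolding cls_add[OF g g'] by (rule ring_hom_add[OF h(1) cls_closed[OF g] cls_closed[OF g']])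
      show "\<psi>' (cls (\<lambda>x. g x * g' x)) = \<psi>' (cls g) \<otimes>\<^bsub>R\<^esub> \<psi>' (cls g')"
        unfolding cls_mult[OF g g'] by (rule ring_hom_mult[OF h(1) cls_closed[OF g] cls_closed[OF g']])
    next
      fix p :: "real^'n \<Rightarrow> real" assume p: "poly_fun p"
      hence c: "I +>\<^bsub>Defs.poly_ring\<^esub> p \<in> carrier (coord_ring V)" by (auto simp: carrier_coord_ring I_def)
      show "\<psi>' (cls p) = ev p" using h(2)[rule_format, OF c] sm[OF p] by (simp add: ev_def)
    qed (rule f(1))
    thus ?thesis using psi[OF f(1)] f(2) by simp
  qed
  show "\<exists>\<psi>\<in>ring_hom (regulous_ring V) R. (\<forall>a\<in>carrier (coord_ring V). \<psi> (struct_map V a) = \<phi> a) \<and>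
      (\<forall>\<psi>'\<in>ring_hom (regulous_ring V) R. (\<forall>a\<in>carrier (coord_ring V). \<psi>' (struct_map V a) = \<phi> a) \<longrightarrow>
        (\<forall>b\<in>carrier (regulous_ring V). \<psi>' b = \<psi> b))"
    using hom ext uniq by (intro bexI[of _ \<psi>]) auto
qed

end
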